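(* Let $\mathcal{H}$ be a real Hilbert space and $n\ge1$ an integer. Assume the following. Functionals: $L\in\mathfrak{S}_{++}(\mathcal{H})$ and $f\colon\mathcal{H}\to\mathbb{R}$ is convex and everywhere differentiable such that its gradient in $\mathcal{H}_L$ is nonexpansive, that is, $x\mapsto L^{-1}\nabla f(x)$ is $1$-Lipschitz for the norm $\|\cdot\|_L$; for each $i\in\{1,\dots,n\}$, $\mathcal{H}_i\subseteq\mathcal{H}$ is a closed subspace and $g_i\colon\mathcal{H}\to\left]-\infty,+\infty\right]$ is convex, proper and lower semicontinuous such that $g_i=g_i\circ P_{\mathcal{H}_i}$; $h\colon\mathcal{H}\to\left]-\infty,+\infty\right]$ is convex, proper and lower semicontinuous; $0\in\operatorname{sri}\{\operatorname{dom}h-\bigcap_{i=1}^n\operatorname{dom}g_i\}$ and, for all $i\in\{1,\dots,n\}$, $0\in\operatorname{sri}\{\operatorname{dom}g_i-\bigcap_{j=1}^{i-1}\operatorname{dom}g_j\}$; and $\arg\min\left(\sum_{i=1}^ng_i+f+h\right)\neq\emptyset$. Preconditioners: $\Gamma\in\mathfrak{S}_{++}(\mathcal{H})$ satisfies $\|L^{1/2}\Gamma L^{1/2}\|<2$ and $\Gamma(\mathcal{H}_i)\subseteq\mathcal{H}_i$ for all $i$; for each $i$, $W_i\in\mathfrak{S}_+(\mathcal{H})$ satisfies $\ker W_i=\mathcal{H}_i^\perp$, $W_{i|\mathcal{H}_i}\in\mathfrak{S}_{++}(\mathcal{H}_i)$ and $\Gamma^{-1}W_i=W_i\Gamma^{-1}$;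 and $\sum_{i=1}^nW_i=\mathrm{Id}_{\mathcal{H}}$. Set $(z_{i,0})_{1\le i\le n}\in\prod_{i=1}^n\mathcal{H}_i$ and define $(x_k)_{k\in\mathbb{N}}$ in $\mathcal{H}$ and $\left((z_{i,k})_{1\le i\le n}\right)_{k\in\mathbb{N}}$ in $\prod_{i=1}^n\mathcal{H}_i$ such that for all $k\in\mathbb{N}$, $$x_k=\operatorname{prox}_h^{\Gamma^{-1}}\Big(\sum_{i=1}^nW_iz_{i,k}\Big)+c_k,$$ and for all $i\in\{1,\dots,n\}$, $$z_{i,k+1}=z_{i,k}+\rho_k\Big(\operatorname{prox}_{g_i|\mathcal{H}_i}^{\Gamma^{-1}W_i}\big(2x_k^{\mathcal{H}_i}-z_{i,k}-\Gamma(\nabla f(x_k)+b_k)^{\mathcal{H}_i}\big)+a_{i,k}-x_k^{\mathcal{H}_i}\Big),$$ where $b_k,c_k\in\mathcal{H}$, $a_{i,k}\in\mathcal{H}_i$ and $\rho_k\in\left]0,\,2-\tfrac12\|L^{1/2}\Gamma L^{1/2}\|\right[$. If $\sum_{k\in\mathbb{N}}\rho_k\left(2-\tfrac12\|L^{1/2}\Gamma L^{1/2}\|-\rho_k\right)=+\infty$, $\sum_{k\in\mathbb{N}}\rho_k\|b_k\|<+\infty$, $\sum_{k\in\mathbb{N}}\rho_k\|c_k\|<+\infty$ and, for all $i\in\{1,\dots,n\}$, $\sum_{k\in\mathbb{N}}\rho_k\|a_{i,k}\|<+\infty$, then $(x_k)_{k\in\mathbb{N}}$ converges weakly towards a minimizer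 of $\sum_{i=1}^ng_i+f+h$. If moreover there exists $i\in\{1,\dots,n\}$ such that $g_i$ is uniformly convex, then $\left(x_k^{\mathcal{H}_i}\right)_{k\in\mathbb{N}}$ converges strongly; alternatively, if moreover $f$ or $h$ is uniformly convex, then $(x_k)_{k\in\mathbb{N}}$ converges strongly.
   Context: $\mathfrak{S}_+(\mathcal{H})$ (resp. $\mathfrak{S}_{++}(\mathcal{H})$) is the set of bounded linear selfadjoint operators $M$ on $\mathcal{H}$ that are positive, $\langle Mx\mid x\rangle\ge0$ for all $x$ (resp. strongly positive: there is $m>0$ with $\langle Mx\mid x\rangle\ge m\|x\|^2$ for all $x$). For $M\in\mathfrak{S}_{++}(\mathcal{H})$, $\|x\|_M=\sqrt{\langle Mx\mid x\rangle}$ and $\mathcal{H}_M$ is $\mathcal{H}$ endowed with the inner product $\langle Mx\mid y\rangle$. $\nabla f$ is the gradient for the original inner product of $\mathcal{H}$. For a closed subspace $S$, $P_S$ is the orthogonal projector onto $S$ and $x^S=P_Sx$. For a set $D\subseteq\mathcal{H}$ convex, $\operatorname{sri}D$ (strong relative interior) is the set of $x\in D$ such that the cone generated by $D-x$ equals the closed linear span of $D-x$. $D-E=\{d-e\mid d\in D,e\in E\}$, and the empty intersection (case $i=1$) is $\mathcal{H}$. $\operatorname{dom}g=\{x\mid g(x)<+\infty\}$. For $g$ proper, convex, lower semicontinuous on a Hilbert space and $M$ strongly positive selfadjoint on it, $\operatorname{prox}_g^M(x)$ is the unique minimizer of $\xi\mapsto\tfrac12\langle x-\xi\mid M(x-\xi)\rangle+g(\xi)$.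 $\operatorname{prox}_h^{\Gamma^{-1}}$ is taken on $\mathcal{H}$; $\operatorname{prox}_{g_i|\mathcal{H}_i}^{\Gamma^{-1}W_i}$ is taken on the Hilbert space $\mathcal{H}_i$ for the restriction of $g_i$ to $\mathcal{H}_i$ and the restriction of $\Gamma^{-1}W_i$ to $\mathcal{H}_i$ (which is selfadjoint and strongly positive on $\mathcal{H}_i$). A proper function $g$ is uniformly convex if there is a nondecreasing $\phi\colon[0,+\infty[\to[0,+\infty]$ vanishing only at $0$ such that $g(tx+(1-t)y)+t(1-t)\phi(\|x-y\|)\le tg(x)+(1-t)g(y)$ for all $x,y\in\operatorname{dom}g$ and $t\in\left]0,1\right[$.
   Formalization: The formal theorem additionally assumes that the errors c_k converge strongly to 0; without this the claim fails, since ρ_k may vanish along the iterations and Σρ_k‖c_k‖<∞ then does not control c_k, which is added directly to x_k. *)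

theory Defs
  imports "HOL-Analysis.Analysis"
begin

text \<open>A real Hilbert space is a type of class \<open>{real_inner, complete_space}\<close>. An operator on a
  closed subspace \<open>S\<close> is represented by a bounded operator on the whole space that leaves \<open>S\<close>
  invariant, so that \<open>pos_op_on UNIV\<close> and \<open>spos_op_on UNIV\<close> are the classes of positive and of
  strongly positive selfadjoint operators on the whole space.\<close>

definition pos_op_on :: "'a::real_inner set \<Rightarrow> ('a \<Rightarrow>\<^sub>L 'a) \<Rightarrow> bool" where
  "pos_op_on S M \<longleftrightarrow>
     blinfun_apply M ` S \<subseteq> S \<and>
     (\<forall>x\<in>S. \<forall>y\<in>S. M x \<bullet> y = x \<bullet> M y) \<and>
     (\<forall>x\<in>S. 0 \<le> M x \<bullet> x)"

definition spos_op_on :: "'a::real_inner set \<Rightarrow> ('a \<Rightarrow>\<^sub>L 'a) \<Rightarrow> bool" where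
  "spos_op_on S M \<longleftrightarrow> pos_op_on S M \<and> (\<exists>m>0. \<forall>x\<in>S. m * (norm x)\<^sup>2 \<le> M x \<bullet> x)"

definition op_sqrt :: "('a::real_inner \<Rightarrow>\<^sub>L 'a) \<Rightarrow> ('a \<Rightarrow>\<^sub>L 'a)" where
  "op_sqrt M = (THE R. pos_op_on UNIV R \<and> R o\<^sub>L R = M)"

definition norm_wrt :: "('a::real_inner \<Rightarrow>\<^sub>L 'a) \<Rightarrow> 'a \<Rightarrow> real" where
  "norm_wrt M x = sqrt (M x \<bullet> x)"

definition orth_proj :: "'a::real_inner set \<Rightarrow> 'a \<Rightarrow> 'a" where
  "orth_proj S x = (THE p. p \<in> S \<and> x - p \<in> S\<^sup>\<bottom>)"

definition gradient :: "('a::real_inner \<Rightarrow> real) \<Rightarrow> 'a \<Rightarrow> 'a" where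
  "gradient f x = (THE D. GDERIV f x :> D)"

definition effdom :: "('a \<Rightarrow> ereal) \<Rightarrow> 'a set" where
  "effdom g = {x. g x < \<infinity>}"

definition proper_fun :: "('a \<Rightarrow> ereal) \<Rightarrow> bool" where
  "proper_fun g \<longleftrightarrow> (\<forall>x. g x \<noteq> -\<infinity>) \<and> effdom g \<noteq> {}"

definition convex_fun :: "('a::real_vector \<Rightarrow> ereal) \<Rightarrow> bool" where
  "convex_fun g \<longleftrightarrow> (\<forall>x y. \<forall>t\<in>{0<..<1}.
     g (t *\<^sub>R x + (1 - t) *\<^sub>R y) \<le> ereal t * g x + ereal (1 - t) * g y)"

definition lsc_fun :: "('a::topological_space \<Rightarrow> ereal) \<Rightarrow> bool" where
  "lsc_fun g \<longleftrightarrow> (\<forall>x. g x \<le> Liminf (nhds x) g)"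

definition uniformly_convex_fun :: "('a::real_normed_vector \<Rightarrow> ereal) \<Rightarrow> bool" where
  "uniformly_convex_fun g \<longleftrightarrow> proper_fun g \<and>
     (\<exists>\<phi> :: real \<Rightarrow> ereal.
        mono_on {0..} \<phi> \<and> (\<forall>s\<ge>0. 0 \<le> \<phi> s \<and> (\<phi> s = 0 \<longleftrightarrow> s = 0)) \<and>
        (\<forall>x\<in>effdom g. \<forall>y\<in>effdom g. \<forall>t\<in>{0<..<1}.
           g (t *\<^sub>R x + (1 - t) *\<^sub>R y) + ereal (t * (1 - t)) * \<phi> (norm (x - y))
             \<le> ereal t * g x + ereal (1 - t) * g y))"

text \<open>\<open>-\<close> on sets is the set difference, hence a separate name for \<open>D - E\<close>.\<close>

definition minkowski_diff :: "'a::real_vector set \<Rightarrow> 'a set \<Rightarrow> 'a set" where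
  "minkowski_diff D E = {d - e | d e. d \<in> D \<and> e \<in> E}"

definition sri :: "'a::real_normed_vector set \<Rightarrow> 'a set" where
  "sri D = {x \<in> D. cone hull ((\<lambda>d. d - x) ` D) = closure (span ((\<lambda>d. d - x) ` D))}"

text \<open>The proximity operator, on the Hilbert space \<open>S\<close> (a closed subspace), of the restrictions of
  \<open>g\<close> and \<open>M\<close> to \<open>S\<close>.\<close>

definition prox_on :: "'a::real_inner set \<Rightarrow> ('a \<Rightarrow> 'a) \<Rightarrow> ('a \<Rightarrow> ereal) \<Rightarrow> 'a \<Rightarrow> 'a" where
  "prox_on S M g x =
     (THE p. is_arg_min (\<lambda>\<xi>. ereal (1/2 * ((x - \<xi>) \<bullet> M (x - \<xi>))) + g \<xi>) (\<lambda>\<xi>. \<xi> \<in> S) p)"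

definition argmin_set :: "('a \<Rightarrow> ereal) \<Rightarrow> 'a set" where
  "argmin_set F = {x. is_arg_min F (\<lambda>_. True) x}"

definition weakly_converges :: "(nat \<Rightarrow> 'a::real_inner) \<Rightarrow> 'a \<Rightarrow> bool" where
  "weakly_converges x l \<longleftrightarrow> (\<forall>y. (\<lambda>k. x k \<bullet> y) \<longlonglongrightarrow> l \<bullet> y)"

end

theory Submission
  imports Defs
begin

text \<open>Put \<open>M i = \<Gamma>\<inverse> W i\<close>, which is selfadjoint and strongly positive on \<open>H i\<close>. In the product of the \<open>H i\<close>
  with inner product \<open>Q z z' = \<Sum>i. M i (z i) \<bullet> z' i\<close>, the unrelaxed error-free step minus the identity,
  \<open>e z\<close>, satisfies \<open>- Q (z - z') (e z - e z') \<ge> (1 - \<kappa>/4) \<parallel>e z - e z'\<parallel>\<^sup>2\<close> with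
  \<open>\<kappa> = \<parallel>sqrt L \<Gamma> sqrt L\<parallel>\<close>: add the monotonicity inequalities of the subdifferentials of \<open>g i\<close> and \<open>h\<close> and
  the Baillon--Haddad inequality of \<open>f\<close>. Hence \<open>z\<close> is quasi-Fejer monotone with respect to the fixed points
  and \<open>e z\<close> tends to 0. The monotonicity gaps to a fixed point then tend to 0, which gives strong
  convergence under uniform convexity, and the weak cluster points of the iterates are fixed points because a family of
  subgradients is weakly closed once the sum of its pairings converges; Opial's argument makes them unique.
  Fixed points exist because, by the Attouch--Brezis theorem, the qualification conditions split
  the optimality condition of a minimizer into one subgradient for each function. Weak compactness and weak cluster points
  are phrased with filters on the index set instead of subsequences.\<close>

section \<open>Lower semicontinuous convex functions and proximity operators\<close>

text \<open>One minimization lemma supplies the existence results: it yields proximal points, and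
  these in turn yield the Riesz representation, projections and inverses of strongly positive
  operators. The preconditioners are tied together by commutation: \<open>M i\<close> applied to
  \<open>\<Gamma> v\<close> is \<open>W i v\<close>, and since the \<open>W i\<close> sum to the
  identity, the gradient reappears intact after summation over \<open>i\<close>. The margin
  \<open>1 - \<kappa>/4\<close> is what remains after Young's inequality splits the cross term
  between gradient difference and residual; the other half is paid by the monotonicity gap of the
  gradient. Twice this margin, \<open>2 - \<kappa>/2\<close>, is the upper bound on the relaxation.
  The obstacle at the limit is that proximity operators and gradients are nonlinear while
  convergence is only weak. For a single function, the pairing of subgradient and point is not known
  to tend to the pairing of the weak limits. For the whole family it is, because the subgradients
  cancel up to the residual, which vanishes strongly. Weak compactness rests on Tychonoff's theorem,
  which delivers cluster points of filters rather than subsequences.\<close>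

lemma lsc_fun_iff:
  "lsc_fun F \<longleftrightarrow> (\<forall>x. \<forall>r<F x. \<forall>\<^sub>F y in nhds x. r < F y)"
  unfolding lsc_fun_def le_Liminf_iff by blast

lemma lsc_fun_add:
  fixes F G :: "'a::topological_space \<Rightarrow> ereal"
  assumes "lsc_fun F" "lsc_fun G" and nF: "\<And>x. F x \<noteq> -\<infinity>" and nG: "\<And>x. G x \<noteq> -\<infinity>"
  shows "lsc_fun (\<lambda>x. F x + G x)"
  unfolding lsc_fun_iff
proof (intro allI impI)
  fix x r assume r: "r < F x + G x"
  \<comment> \<open>A strict lower bound of the sum splits into strict lower bounds of the terms. If
    one term is infinite, any bound of the other will do and the infinite term absorbs the
    deficit.\<close>
  have "\<exists>s t. s < F x \<and> t < G x \<and> r < s + t"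
  proof (cases "F x = \<infinity> \<or> G x = \<infinity>")
    case True
    show ?thesis
    proof (cases r)
      case (real q)
      show ?thesis
      proof (cases "F x = \<infinity>")
        case True
        obtain t where t: "ereal t < G x" using nG[of x] by (metis MInfty_neq_ereal(1) ereal_dense2 ereal_infty_less(2) )
        show ?thesis using True t real by (intro exI[of _ "ereal (q + 1 - t)"] exI[of _ "ereal t"]) auto
      next
        case False
        then have G: "G x = \<infinity>" using \<open>F x = \<infinity> \<or> G x = \<infinity>\<close> by auto
        obtain t where t: "ereal t < F x" using nF[of x] by (metis MInfty_neq_ereal(1) ereal_dense2 ereal_infty_less(2) )
        show ?thesis using G t real by (intro exI[of _ "ereal t"] exI[of _ "ereal (q + 1 - t)"]) auto
      qed
    next
      case PInf then show ?thesis using r by auto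
    next
      case MInf
      obtain t where t: "ereal t < G x" using nG[of x] by (metis MInfty_neq_ereal(1) ereal_dense2 ereal_infty_less(2) )
      obtain s where s: "ereal s < F x" using nF[of x] by (metis MInfty_neq_ereal(1) ereal_dense2 ereal_infty_less(2) )
      show ?thesis using MInf s t by (intro exI[of _ "ereal s"] exI[of _ "ereal t"]) auto
    qed
  next
    case False
    obtain a b where ab: "F x = ereal a" "G x = ereal b"
      using False nF[of x] nG[of x] by (cases "F x"; cases "G x") auto
    obtain q where q: "r < ereal q" "q < a + b" using r ab ereal_dense2[of r "F x + G x"] by auto
    show ?thesis using ab q
      by (intro exI[of _ "ereal (a - (a + b - q)/2)"] exI[of _ "ereal (b - (a + b - q)/2)"])
        (auto simp: field_simps)
  qed
  then obtain s t where st: "s < F x" "t < G x" "r < s + t" by blast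
  have "\<forall>\<^sub>F y in nhds x. s < F y" "\<forall>\<^sub>F y in nhds x. t < G y"
    using assms st by (auto simp: lsc_fun_iff)
  then show "\<forall>\<^sub>F y in nhds x. r < F y + G y"
    by eventually_elim (metis add_mono order.strict_implies_order order_less_le_trans st(3))
qed

lemma lsc_fun_continuous:
  assumes "continuous_on UNIV q"
  shows "lsc_fun (\<lambda>x. ereal (q x))"
  unfolding lsc_fun_iff
proof (intro allI impI)
  fix x r assume "r < ereal (q x)"
  moreover have "((\<lambda>y. ereal (q y)) \<longlongrightarrow> ereal (q x)) (nhds x)"
    using assms by (intro tendsto_ereal) (auto simp: continuous_on_def tendsto_at_iff_tendsto_nhds)
  ultimately show "\<forall>\<^sub>F y in nhds x. r < ereal (q y)" by (simp add: order_tendsto_iff)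
qed

lemma lsc_fun_restrict:
  assumes "lsc_fun F" "closed S"
  shows "lsc_fun (\<lambda>x. if x \<in> S then F x else \<infinity>)"
  unfolding lsc_fun_iff
proof (intro allI impI)
  fix x r assume r: "r < (if x \<in> S then F x else \<infinity>)"
  show "\<forall>\<^sub>F y in nhds x. r < (if y \<in> S then F y else \<infinity>)"
  proof (cases "x \<in> S")
    case True
    then have "\<forall>\<^sub>F y in nhds x. r < F y" using r assms(1) by (auto simp: lsc_fun_iff)
    then show ?thesis by eventually_elim auto
  next
    case False
    then have "\<forall>\<^sub>F y in nhds x. y \<in> - S" using assms(2) by (intro eventually_nhds_in_open) auto
    then show ?thesis by eventually_elim (use r False in auto)
  qed
qed

lemma lsc_fun_compose:
  assumes "lsc_fun F" "continuous_on UNIV q"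
  shows "lsc_fun (\<lambda>x. F (q x))"
  unfolding lsc_fun_iff
proof (intro allI impI)
  fix x r assume "r < F (q x)"
  then have "\<forall>\<^sub>F y in nhds (q x). r < F y" using assms(1) by (auto simp: lsc_fun_iff)
  moreover have "filterlim q (nhds (q x)) (nhds x)"
    using assms(2) by (auto simp: continuous_on_def tendsto_at_iff_tendsto_nhds)
  ultimately show "\<forall>\<^sub>F y in nhds x. r < F (q y)" by (rule eventually_compose_filterlim)
qed

lemma lsc_fun_closed_sublevel:
  assumes "lsc_fun F"
  shows "closed {x. F x \<le> r}"
proof -
  have "open {x. r < F x}"
    by (subst open_subopen) (metis (mono_tags, lifting) assms eventually_nhds lsc_fun_iff mem_Collect_eq subsetI)
  moreover have "{x. F x \<le> r} = - {x. r < F x}" by auto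
  ultimately show ?thesis by (simp add: closed_def)
qed

text \<open>The value at a midpoint is at least the infimum, so two nearly minimal points must be
  close. Every minimizing sequence is therefore Cauchy, and completeness replaces weak
  compactness.\<close>

lemma strongly_midconvex_minimizer:
  fixes F :: "'a::{real_normed_vector, complete_space} \<Rightarrow> ereal"
  assumes lsc: "lsc_fun F" and m: "m > 0"
    and mid: "\<And>x y. F ((1/2) *\<^sub>R (x + y)) + ereal (m * (norm (x - y))\<^sup>2)
                   \<le> ereal (1/2) * F x + ereal (1/2) * F y"
    and lb: "\<And>x. ereal B \<le> F x" and dom: "F x0 < \<infinity>"
  shows "\<exists>p. \<forall>y. F p \<le> F y"
proof -
  define I where "I = (INF x. F x)"
  have I: "ereal B \<le> I" "I \<le> F x0" using lb by (auto simp: I_def INF_greatest INF_lower)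
  then obtain i where i: "I = ereal i" using dom by (cases I) auto
  have low: "ereal i \<le> F y" for y using i by (metis I_def INF_lower UNIV_I)
  have "\<exists>y. F y < ereal (i + inverse (Suc k))" for k
    using i INF_less_iff[of F UNIV "ereal (i + inverse (Suc k))"] by (simp add: I_def)
  then obtain \<xi> where \<xi>: "F (\<xi> k) < ereal (i + inverse (Suc k))" for k by metis
  have dist: "m * (norm (\<xi> j - \<xi> k))\<^sup>2 \<le> inverse (Suc N)" if "N \<le> j" "N \<le> k" for N j k
  proof -
    have "F (\<xi> l) \<le> ereal (i + inverse (Suc N))" if "N \<le> l" for l
    proof -
      have "inverse (real (Suc l)) \<le> inverse (Suc N)" using that by (simp add: le_imp_inverse_le)
      then show ?thesis using \<xi>[of l]
        by (intro order_trans[OF order_less_imp_le[OF \<xi>[of l]]]) simp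
    qed
    from this[OF that(1)] this[OF that(2)] low[of "\<xi> j"] low[of "\<xi> k"]
    obtain a b where ab: "F (\<xi> j) = ereal a" "F (\<xi> k) = ereal b"
      "a \<le> i + inverse (Suc N)" "b \<le> i + inverse (Suc N)"
      by (cases "F (\<xi> j)"; cases "F (\<xi> k)") auto
    have "ereal i + ereal (m * (norm (\<xi> j - \<xi> k))\<^sup>2) \<le> ereal (1/2) * F (\<xi> j) + ereal (1/2) * F (\<xi> k)"
      by (rule order_trans[OF add_right_mono[OF low] mid])
    then show ?thesis using ab by auto
  qed
  have "Cauchy \<xi>"
  proof (rule metric_CauchyI)
    fix e :: real assume e: "e > 0"
    then obtain N where N: "inverse (Suc N) < m * e\<^sup>2"
      using reals_Archimedean[of "m * e\<^sup>2"] m by auto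
    have "dist (\<xi> j) (\<xi> k) < e" if "N \<le> j" "N \<le> k" for j k
    proof -
      have "m * (norm (\<xi> j - \<xi> k))\<^sup>2 < m * e\<^sup>2" using dist[OF that] N by linarith
      then have "(norm (\<xi> j - \<xi> k))\<^sup>2 < e\<^sup>2" using m by simp
      then show ?thesis using e by (simp add: dist_norm power2_less_imp_less)
    qed
    then show "\<exists>M. \<forall>m\<ge>M. \<forall>n\<ge>M. dist (\<xi> m) (\<xi> n) < e" by blast
  qed
  then obtain p where p: "\<xi> \<longlonglongrightarrow> p" using Cauchy_convergent_iff convergent_def by blast
  have "F p \<le> ereal (i + e)" if "e > 0" for e
  proof -
    obtain N where N: "inverse (Suc N) < e" using reals_Archimedean[OF \<open>e > 0\<close>] by auto
    have "F (\<xi> k) \<le> ereal (i + e)" if "k \<ge> N" for k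
    proof -
      have "inverse (real (Suc k)) \<le> inverse (Suc N)" using that by (simp add: le_imp_inverse_le)
      then have "i + inverse (real (Suc k)) \<le> i + e" using N by linarith
      then show ?thesis using \<xi>[of k] by (meson ereal_less_eq(3) less_imp_le order_trans)
    qed
    then have "\<forall>\<^sub>F k in sequentially. \<xi> k \<in> {x. F x \<le> ereal (i + e)}"
      unfolding eventually_sequentially by blast
    then show ?thesis
      using Lim_in_closed_set[OF lsc_fun_closed_sublevel[OF lsc] _ _ p] by auto
  qed
  note le = this
  obtain r where r: "F p = ereal r" using le[OF zero_less_one] low[of p] by (cases "F p") auto
  have "r \<le> i + e" if "e > 0" for e using le[OF that] r by simp
  then have "r \<le> i" by (rule field_le_epsilon)
  then have "F p \<le> ereal i" using r by simp
  then have "F p \<le> F y" for y by (rule order_trans[OF _ low])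
  then show ?thesis by blast
qed

text \<open>Lower semicontinuity keeps \<open>g\<close> above \<open>c - 1\<close> on a small ball
  around \<open>x0\<close>. If \<open>g\<close> fell faster than linearly further out, convexity
  would pull it below \<open>c - 1\<close> inside that ball. Such a cone-shaped minorant serves in
  place of an affine one and requires no separation theorem.\<close>

lemma convex_lsc_minorant:
  fixes g :: "'a::real_normed_vector \<Rightarrow> ereal"
  assumes cv: "convex_fun g" and lsc: "lsc_fun g" and x0: "g x0 = ereal c"
  shows "\<exists>A\<ge>0. \<forall>y. ereal (c - 1 - A * norm (y - x0)) \<le> g y"
proof -
  have "ereal (c - 1) < g x0" using x0 by auto
  then have "\<forall>\<^sub>F y in nhds x0. ereal (c - 1) < g y" using lsc unfolding lsc_fun_iff by blast
  then obtain r where r: "r > 0" "\<And>y. dist y x0 < r \<Longrightarrow> ereal (c - 1) < g y"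
    by (auto simp: eventually_nhds_metric)
  define s where "s = r / 2"
  have s: "s > 0" "s < r" using r by (auto simp: s_def)
  have "ereal (c - 1 - (1/s) * norm (y - x0)) \<le> g y" for y
  proof (cases "norm (y - x0) \<le> s")
    case True
    then have "ereal (c - 1) < g y" using r(2)[of y] s by (simp add: dist_norm)
    moreover have "ereal (c - 1 - (1/s) * norm (y - x0)) \<le> ereal (c - 1)" using s by simp
    ultimately show ?thesis by (meson less_imp_le order_trans)
  next
    case False
    \<comment> \<open>This \<open>t\<close> puts the convex combination of \<open>y\<close> and
      \<open>x0\<close> at distance exactly \<open>s\<close> from \<open>x0\<close>, inside the ball
      of radius \<open>r\<close>.\<close>
    define d t where "d = norm (y - x0)" and "t = s / d"
    have d: "d > 0" "s < d" using False s unfolding d_def by linarith+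
    then have t: "t \<in> {0<..<1}" using s by (auto simp: t_def)
    have eq: "t *\<^sub>R y + (1 - t) *\<^sub>R x0 - x0 = t *\<^sub>R (y - x0)" by (simp add: algebra_simps)
    have "dist (t *\<^sub>R y + (1 - t) *\<^sub>R x0) x0 = s"
      unfolding dist_norm eq using t d s by (auto simp: t_def d_def)
    then have "ereal (c - 1) < g (t *\<^sub>R y + (1 - t) *\<^sub>R x0)" using r(2) s by auto
    also have "\<dots> \<le> ereal t * g y + ereal (1 - t) * g x0" using cv t unfolding convex_fun_def by blast
    finally have 1: "ereal (c - 1) < ereal t * g y + ereal ((1 - t) * c)" using x0 by simp
    show ?thesis
    proof (cases "g y")
      case (real q)
      have "c - 1 < t * q + (1 - t) * c" using 1 real by simp
      then have "t * (c - q) < 1" by (simp add: algebra_simps)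
      then have "c - q < 1 / t" using t by (simp add: field_simps)
      then show ?thesis using real s by (simp add: t_def d_def)
    next
      case PInf then show ?thesis by simp
    next
      case MInf then show ?thesis using 1 t by (simp add: ereal_mult_eq_MInfty)
    qed
  qed
  then show ?thesis using s by (intro exI[of _ "1/s"]) auto
qed

section \<open>Subgradients and the variational inequality of proximal points\<close>

definition subdiff :: "('a::real_inner \<Rightarrow> ereal) \<Rightarrow> 'a \<Rightarrow> 'a set" where
  "subdiff g p = {u. \<bar>g p\<bar> \<noteq> \<infinity> \<and> (\<forall>y. g p + ereal (u \<bullet> (y - p)) \<le> g y)}"

lemma subdiff_monotone:
  assumes "u \<in> subdiff g p" "u' \<in> subdiff g p'"
  shows "0 \<le> (u - u') \<bullet> (p - p')"
proof -
  obtain a b where ab: "g p = ereal a" "g p' = ereal b"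
    using assms unfolding subdiff_def by (cases "g p"; cases "g p'") auto
  have "g p + ereal (u \<bullet> (p' - p)) \<le> g p'" "g p' + ereal (u' \<bullet> (p - p')) \<le> g p"
    using assms by (auto simp: subdiff_def)
  then have "a + u \<bullet> (p' - p) \<le> b" "b + u' \<bullet> (p - p') \<le> a" using ab by auto
  then show ?thesis by (simp add: inner_diff_left inner_diff_right)
qed

text \<open>Along the segment, convexity bounds \<open>g\<close> by its chord; dividing by
  \<open>t\<close> and letting \<open>t\<close> tend to 0 gives the first-order condition. Only a
  one-sided directional derivative of \<open>q\<close> enters, so \<open>q\<close> may be a
  quadratic, a smooth convex function or the negative of one.\<close>

lemma convex_smooth_minimizer:
  fixes g :: "'a::real_normed_vector \<Rightarrow> ereal" and q :: "'a \<Rightarrow> real"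
  assumes cv: "convex_fun g" and fin: "\<bar>g p\<bar> \<noteq> \<infinity>"
    and min: "\<And>t. t \<in> {0<..<1} \<Longrightarrow> ereal (q p) + g p
          \<le> ereal (q (t *\<^sub>R y + (1 - t) *\<^sub>R p)) + g (t *\<^sub>R y + (1 - t) *\<^sub>R p)"
    and D: "((\<lambda>t. (q (t *\<^sub>R y + (1 - t) *\<^sub>R p) - q p) / t) \<longlongrightarrow> D) (at_right 0)"
  shows "g p + ereal (- D) \<le> g y"
proof -
  obtain a where a: "g p = ereal a" using fin by (cases "g p") auto
  show ?thesis
  proof (cases "g y")
    case (real b)
    have "a - b \<le> (q (t *\<^sub>R y + (1 - t) *\<^sub>R p) - q p) / t" if t: "t \<in> {0<..<1}" for t
    proof -
      have "ereal (q p) + g p \<le> ereal (q (t *\<^sub>R y + (1 - t) *\<^sub>R p)) + g (t *\<^sub>R y + (1 - t) *\<^sub>R p)"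
        using min t by blast
      also have "\<dots> \<le> ereal (q (t *\<^sub>R y + (1 - t) *\<^sub>R p)) + (ereal t * g y + ereal (1 - t) * g p)"
        using cv t unfolding convex_fun_def by (intro add_left_mono) blast
      finally have "q p + a \<le> q (t *\<^sub>R y + (1 - t) *\<^sub>R p) + (t * b + (1 - t) * a)" using a real by simp
      then have "t * (a - b) \<le> q (t *\<^sub>R y + (1 - t) *\<^sub>R p) - q p" by (simp add: algebra_simps)
      then show ?thesis using t by (simp add: field_simps)
    qed
    then have "\<forall>\<^sub>F t in at_right 0. a - b \<le> (q (t *\<^sub>R y + (1 - t) *\<^sub>R p) - q p) / t"
      using eventually_at_right_less[of "0::real"]
      by (metis (mono_tags, lifting) eventually_at_rightI less_numeral_extra(1))
    then have "a - b \<le> D" using D by (intro tendsto_lowerbound[OF D]) auto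
    then show ?thesis using a real by simp
  next
    case PInf then show ?thesis by simp
  next
    case MInf
    define t where "t = (1/2 :: real)"
    have "ereal (q p) + g p \<le> ereal (q (t *\<^sub>R y + (1 - t) *\<^sub>R p)) + g (t *\<^sub>R y + (1 - t) *\<^sub>R p)"
      using min[of t] by (auto simp: t_def)
    also have "\<dots> \<le> ereal (q (t *\<^sub>R y + (1 - t) *\<^sub>R p)) + (ereal t * g y + ereal (1 - t) * g p)"
      using cv[unfolded convex_fun_def, rule_format, of t y p] by (intro add_left_mono) (simp add: t_def)
    finally show ?thesis using a MInf by (simp add: t_def)
  qed
qed

lemma prox_exists:
  fixes M :: "'a::{real_inner, complete_space} \<Rightarrow> 'a"
  assumes S: "subspace S" "closed S" and M: "bounded_linear M"
    and m: "m > 0" and pos: "\<And>\<xi>. \<xi> \<in> S \<Longrightarrow> m * (norm \<xi>)\<^sup>2 \<le> \<xi> \<bullet> M \<xi>"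
    and g: "convex_fun g" "proper_fun g" "lsc_fun g"
    and y0: "y0 \<in> S" "g y0 < \<infinity>" and x: "x \<in> S"
  shows "\<exists>p. is_arg_min (\<lambda>\<xi>. ereal (1/2 * ((x - \<xi>) \<bullet> M (x - \<xi>))) + g \<xi>) (\<lambda>\<xi>. \<xi> \<in> S) p"
proof -
  interpret M: bounded_linear M by fact
  define q where "q \<xi> = 1/2 * ((x - \<xi>) \<bullet> M (x - \<xi>))" for \<xi>
  define F where "F \<xi> = (if \<xi> \<in> S then ereal (q \<xi>) + g \<xi> else \<infinity>)" for \<xi>
  have ninf: "g \<xi> \<noteq> -\<infinity>" for \<xi> using g unfolding proper_fun_def by auto
  obtain c where c: "g y0 = ereal c" using y0 ninf[of y0] by (cases "g y0") auto
  obtain A where A: "A \<ge> 0" "\<And>y. ereal (c - 1 - A * norm (y - y0)) \<le> g y"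
    using convex_lsc_minorant[OF g(1,3) c] by blast
  have lsc: "lsc_fun F" unfolding F_def
  proof (intro lsc_fun_restrict lsc_fun_add lsc_fun_continuous g S)
    show "continuous_on UNIV q" unfolding q_def by (intro continuous_intros M.continuous_on)
  qed (use ninf in auto)
  have qpos: "m/2 * (norm (x - \<xi>))\<^sup>2 \<le> q \<xi>" if "\<xi> \<in> S" for \<xi>
    using pos[OF subspace_diff[OF S(1) x that]] by (simp add: q_def)
  \<comment> \<open>The minorant of \<open>g\<close> falls at most linearly with slope
    \<open>A\<close>; completing the square absorbs this into
    \<open>m/2 * (norm (x - \<xi>))\<^sup>2\<close> at the price
    \<open>A\<^sup>2 / (2 * m)\<close>.\<close>
  define B where "B = c - 1 - A * norm (x - y0) - A\<^sup>2 / (2 * m)"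
  have lb: "ereal B \<le> F \<xi>" for \<xi>
  proof (cases "\<xi> \<in> S")
    case True
    have "norm (\<xi> - y0) \<le> norm (x - \<xi>) + norm (x - y0)"
      using norm_triangle_ineq[of "- (x - \<xi>)" "x - y0"] by (simp add: norm_minus_commute)
    then have "A * norm (\<xi> - y0) \<le> A * norm (x - \<xi>) + A * norm (x - y0)"
      using A(1) by (metis distrib_left mult_left_mono)
    moreover have "A * norm (x - \<xi>) \<le> m/2 * (norm (x - \<xi>))\<^sup>2 + A\<^sup>2 / (2 * m)"
    proof -
      have "0 \<le> (m * norm (x - \<xi>) - A)\<^sup>2 / (2 * m)" using m by simp
      then show ?thesis using m by (simp add: power2_eq_square field_simps)
    qed
    ultimately have "B \<le> q \<xi> + (c - 1 - A * norm (\<xi> - y0))" using qpos[OF True] by (simp add: B_def)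
    also have "ereal \<dots> = ereal (q \<xi>) + ereal (c - 1 - A * norm (\<xi> - y0))" by simp
    also have "\<dots> \<le> F \<xi>" using A(2)[of \<xi>] True by (simp add: F_def add_left_mono del: plus_ereal.simps)
    finally show ?thesis by simp
  qed (simp add: F_def)
  \<comment> \<open>The parallelogram identity for the form of \<open>M\<close> leaves a quarter of
    the form at \<open>u - v\<close>; the factor 1/2 in \<open>q\<close> turns this into
    \<open>m/8\<close>.\<close>
  have mid: "F ((1/2) *\<^sub>R (u + v)) + ereal (m/8 * (norm (u - v))\<^sup>2)
                   \<le> ereal (1/2) * F u + ereal (1/2) * F v" for u v
  proof (cases "u \<in> S \<and> v \<in> S")
    case True
    have uvS: "(1/2) *\<^sub>R (u + v) \<in> S" using True S by (simp add: subspace_add subspace_scale)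
    have g1: "g ((1/2) *\<^sub>R (u + v)) \<le> ereal (1/2) * g u + ereal (1/2) * g v"
    proof -
      have "g ((1/2) *\<^sub>R u + (1 - 1/2) *\<^sub>R v) \<le> ereal (1/2) * g u + ereal (1 - 1/2) * g v"
        using g(1)[unfolded convex_fun_def, rule_format, of "1/2" u v] by simp
      then show ?thesis by (simp add: scaleR_add_right)
    qed
    define a b where "a = x - u" and "b = x - v"
    have e1: "x - (1/2) *\<^sub>R (u + v) = (1/2) *\<^sub>R (a + b)"
    proof -
      have "x = (1/2) *\<^sub>R x + (1/2) *\<^sub>R x" by (metis scaleR_half_double scaleR_right_distrib)
      then show ?thesis by (simp add: a_def b_def algebra_simps)
    qed
    have e2: "u - v = b - a" by (simp add: a_def b_def)
    have "m * (norm (b - a))\<^sup>2 \<le> (b - a) \<bullet> M (b - a)"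
      using pos[OF subspace_diff[OF S(1)], of u v] True e2 by simp
    then have q1: "q ((1/2) *\<^sub>R (u + v)) + m/8 * (norm (u - v))\<^sup>2 \<le> 1/2 * q u + 1/2 * q v"
      unfolding q_def e1 e2 a_def[symmetric] b_def[symmetric] M.scaleR M.add M.diff
      by (simp add: inner_add_left inner_add_right inner_diff_left inner_diff_right field_simps)
    show ?thesis
    proof (cases "g u = \<infinity> \<or> g v = \<infinity>")
      case True
      then show ?thesis using \<open>u \<in> S \<and> v \<in> S\<close> ninf[of u] ninf[of v]
        by (cases "g u"; cases "g v") (auto simp: F_def)
    next
      case False
      then obtain gu gv where guv: "g u = ereal gu" "g v = ereal gv"
        using ninf[of u] ninf[of v] by (cases "g u"; cases "g v") auto
      then obtain gm where gm: "g ((1/2) *\<^sub>R (u + v)) = ereal gm" "gm \<le> 1/2 * gu + 1/2 * gv"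
        using g1 ninf[of "(1/2) *\<^sub>R (u + v)"] by (cases "g ((1/2) *\<^sub>R (u + v))") auto
      have "F ((1/2) *\<^sub>R (u + v)) = ereal (q ((1/2) *\<^sub>R (u + v)) + gm)"
        "F u = ereal (q u + gu)" "F v = ereal (q v + gv)"
        using gm uvS guv True by (auto simp: F_def)
      then show ?thesis using gm q1 by (simp add: field_simps)
    qed
  next
    case False
    have "F \<xi> \<noteq> -\<infinity>" for \<xi> using lb[of \<xi>] by auto
    then show ?thesis using False by (cases "F u"; cases "F v") (auto simp: F_def split: if_splits)
  qed
  have "F y0 < \<infinity>" using y0 c by (simp add: F_def)
  then obtain p where p: "\<And>y. F p \<le> F y"
    using strongly_midconvex_minimizer[OF lsc, of "m/8" B y0, OF _ mid lb] m by auto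
  have "p \<in> S" using p[of y0] \<open>F y0 < \<infinity>\<close> by (auto simp: F_def split: if_splits)
  moreover have "ereal (q p) + g p \<le> ereal (q y) + g y" if "y \<in> S" for y
    using p[of y] that \<open>p \<in> S\<close> by (simp add: F_def)
  ultimately have "is_arg_min (\<lambda>\<xi>. ereal (q \<xi>) + g \<xi>) (\<lambda>\<xi>. \<xi> \<in> S) p"
    by (auto simp: is_arg_min_linorder)
  then show ?thesis unfolding q_def by blast
qed

lemma arg_min_prox_subgradient:
  fixes M :: "'a::real_inner \<Rightarrow> 'a"
  assumes S: "subspace S" and M: "bounded_linear M"
    and sym: "\<And>u v. u \<in> S \<Longrightarrow> v \<in> S \<Longrightarrow> M u \<bullet> v = u \<bullet> M v"
    and g: "convex_fun g" "proper_fun g"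
    and y0: "y0 \<in> S" "g y0 < \<infinity>" and x: "x \<in> S"
    and p: "is_arg_min (\<lambda>\<xi>. ereal (1/2 * ((x - \<xi>) \<bullet> M (x - \<xi>))) + g \<xi>) (\<lambda>\<xi>. \<xi> \<in> S) p"
  shows "p \<in> S \<and> \<bar>g p\<bar> \<noteq> \<infinity> \<and> (\<forall>y\<in>S. g p + ereal (M (x - p) \<bullet> (y - p)) \<le> g y)"
proof -
  interpret M: bounded_linear M by fact
  define q where "q \<xi> = 1/2 * ((x - \<xi>) \<bullet> M (x - \<xi>))" for \<xi>
  have pS: "p \<in> S" and min: "\<And>y. y \<in> S \<Longrightarrow> ereal (q p) + g p \<le> ereal (q y) + g y"
    using p by (auto simp: is_arg_min_linorder q_def)
  have "ereal (q p) + g p < \<infinity>" using min[OF y0(1)] y0(2) by (cases "g y0") auto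
  then have fin: "\<bar>g p\<bar> \<noteq> \<infinity>" using g(2) by (cases "g p") (auto simp: proper_fun_def)
  have "g p + ereal (M (x - p) \<bullet> (y - p)) \<le> g y" if y: "y \<in> S" for y
  proof -
    have D: "((\<lambda>t. (q (t *\<^sub>R y + (1 - t) *\<^sub>R p) - q p) / t) \<longlongrightarrow> - (M (x - p) \<bullet> (y - p))) (at_right 0)"
    proof (rule Lim_transform_eventually)
      show "((\<lambda>t. - (M (x - p) \<bullet> (y - p)) + t * (1/2 * ((y - p) \<bullet> M (y - p)))) \<longlongrightarrow> - (M (x - p) \<bullet> (y - p))) (at_right 0)"
        by (rule tendsto_eq_intros refl | simp)+
      have "(y - p) \<bullet> M (x - p) = M (y - p) \<bullet> (x - p)"
        using sym[of "y - p" "x - p"] S y pS x by (simp add: subspace_diff)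
      then have s: "(x - p) \<bullet> M (y - p) = M (x - p) \<bullet> (y - p)" by (simp add: inner_commute)
      have "x - (t *\<^sub>R y + (1 - t) *\<^sub>R p) = (x - p) - t *\<^sub>R (y - p)" for t by (simp add: algebra_simps)
      moreover have "1/2 * ((a - t *\<^sub>R d) \<bullet> M (a - t *\<^sub>R d)) - 1/2 * (a \<bullet> M a)
          = t * (- (M a \<bullet> d) + t * (1/2 * (d \<bullet> M d)))" if "a \<bullet> M d = M a \<bullet> d" for a d t
        using that inner_commute[of d "M a"] by (simp add: M.diff M.scaleR inner_diff_left inner_diff_right algebra_simps)
      ultimately have "q (t *\<^sub>R y + (1 - t) *\<^sub>R p) - q p = t * (- (M (x - p) \<bullet> (y - p)) + t * (1/2 * ((y - p) \<bullet> M (y - p))))" for t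
        unfolding q_def using s by metis
      then show "\<forall>\<^sub>F t in at_right 0. - (M (x - p) \<bullet> (y - p)) + t * (1/2 * ((y - p) \<bullet> M (y - p))) = (q (t *\<^sub>R y + (1 - t) *\<^sub>R p) - q p) / t"
        by (intro eventually_mono[OF eventually_at_right_less[of "0::real"]]) simp
    qed
    have "t *\<^sub>R y + (1 - t) *\<^sub>R p \<in> S" for t using S y pS by (simp add: subspace_add subspace_scale)
    then show ?thesis using convex_smooth_minimizer[OF g(1) fin min D] by simp
  qed
  then show ?thesis using pS fin by blast
qed

text \<open>Adding the subgradient inequalities of two minimizers makes the form of \<open>M\<close>
  nonpositive at their difference, so the minimizer is unique and the \<open>THE\<close> in
  \<open>prox_on\<close> denotes. From here on proximal points are handled only through this
  inequality.\<close>

lemma prox_on_subgradient: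
  fixes M :: "'a::{real_inner, complete_space} \<Rightarrow> 'a"
  assumes S: "subspace S" "closed S" and M: "bounded_linear M"
    and sym: "\<And>u v. u \<in> S \<Longrightarrow> v \<in> S \<Longrightarrow> M u \<bullet> v = u \<bullet> M v"
    and m: "m > 0" and pos: "\<And>\<xi>. \<xi> \<in> S \<Longrightarrow> m * (norm \<xi>)\<^sup>2 \<le> \<xi> \<bullet> M \<xi>"
    and g: "convex_fun g" "proper_fun g" "lsc_fun g"
    and y0: "y0 \<in> S" "g y0 < \<infinity>" and x: "x \<in> S"
  defines "p \<equiv> prox_on S M g x"
  shows "p \<in> S" "\<bar>g p\<bar> \<noteq> \<infinity>" "\<And>y. y \<in> S \<Longrightarrow> g p + ereal (M (x - p) \<bullet> (y - p)) \<le> g y"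
proof -
  let ?A = "is_arg_min (\<lambda>\<xi>. ereal (1/2 * ((x - \<xi>) \<bullet> M (x - \<xi>))) + g \<xi>) (\<lambda>\<xi>. \<xi> \<in> S)"
  interpret M: bounded_linear M by fact
  have sub: "p \<in> S \<and> \<bar>g p\<bar> \<noteq> \<infinity> \<and> (\<forall>y\<in>S. g p + ereal (M (x - p) \<bullet> (y - p)) \<le> g y)"
    if "?A p" for p by (rule arg_min_prox_subgradient[OF S(1) M sym g(1,2) y0 x that])
  have uniq: "p = p'" if P: "?A p" "?A p'" for p p'
  proof -
    note s1 = sub[OF P(1)] and s2 = sub[OF P(2)]
    obtain a b where ab: "g p = ereal a" "g p' = ereal b"
      using s1 s2 by (cases "g p"; cases "g p'") auto
    have "a + M (x - p) \<bullet> (p' - p) \<le> b" "b + M (x - p') \<bullet> (p - p') \<le> a"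
      using s1 s2 ab by fastforce+
    then have "(p - p') \<bullet> M (p - p') \<le> 0"
      by (simp add: M.diff inner_diff_left inner_diff_right inner_commute)
    moreover have "m * (norm (p - p'))\<^sup>2 \<le> (p - p') \<bullet> M (p - p')"
      using pos s1 s2 S by (simp add: subspace_diff)
    ultimately have "m * (norm (p - p'))\<^sup>2 \<le> 0" by linarith
    then show ?thesis using m by (simp add: mult_le_0_iff)
  qed
  obtain p' where p': "?A p'" using prox_exists[OF S M m pos g y0 x] by blast
  have "?A p" unfolding p_def prox_on_def using p' uniq by (intro theI[of ?A p']) auto
  from sub[OF this] show "p \<in> S" "\<bar>g p\<bar> \<noteq> \<infinity>" "\<And>y. y \<in> S \<Longrightarrow> g p + ereal (M (x - p) \<bullet> (y - p)) \<le> g y"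
    by auto
qed

section \<open>Hilbert space: projections, inverses, weak compactness\<close>

lemma convex_fun_linear: "convex_fun (\<lambda>y::'a::real_inner. ereal (u \<bullet> y))"
  by (auto simp: convex_fun_def inner_add_right algebra_simps)

lemma convex_fun_add:
  assumes "convex_fun F" "convex_fun G" "\<And>x. F x \<noteq> -\<infinity>" "\<And>x. G x \<noteq> -\<infinity>"
  shows "convex_fun (\<lambda>x. F x + G x)"
  unfolding convex_fun_def
proof (intro allI ballI)
  fix x y :: 'a and t :: real assume t: "t \<in> {0<..<1}"
  have "F (t *\<^sub>R x + (1 - t) *\<^sub>R y) + G (t *\<^sub>R x + (1 - t) *\<^sub>R y)
    \<le> (ereal t * F x + ereal (1 - t) * F y) + (ereal t * G x + ereal (1 - t) * G y)"
    using assms t unfolding convex_fun_def by (intro add_mono) blast+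
  also have "\<dots> = ereal t * (F x + G x) + ereal (1 - t) * (F y + G y)"
    using assms(3)[of x] assms(3)[of y] assms(4)[of x] assms(4)[of y] t
    by (cases "F x"; cases "F y"; cases "G x"; cases "G y") (auto simp: algebra_simps)
  finally show "F (t *\<^sub>R x + (1 - t) *\<^sub>R y) + G (t *\<^sub>R x + (1 - t) *\<^sub>R y)
    \<le> ereal t * (F x + G x) + ereal (1 - t) * (F y + G y)" .
qed

text \<open>The representing vector is the minimizer of half the squared norm minus
  \<open>\<phi>\<close>. Its variational inequality bounds \<open>\<phi>\<close> by the inner
  product with it, and testing with \<open>d\<close> and \<open>- d\<close> gives equality.\<close>

lemma Riesz_representation:
  fixes \<phi> :: "'a::{real_inner, complete_space} \<Rightarrow> real"
  assumes "bounded_linear \<phi>"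
  shows "\<exists>u. \<forall>y. \<phi> y = u \<bullet> y"
proof -
  interpret bounded_linear \<phi> by fact
  define p where "p = prox_on UNIV (\<lambda>x. x) (\<lambda>y. ereal (- \<phi> y)) 0"
  have g: "convex_fun (\<lambda>y. ereal (- \<phi> y))" "proper_fun (\<lambda>y. ereal (- \<phi> y))" "lsc_fun (\<lambda>y. ereal (- \<phi> y))"
    by (auto simp: convex_fun_def proper_fun_def effdom_def add diff scaleR algebra_simps
        intro!: lsc_fun_continuous continuous_intros continuous_on)
  have "ereal (- \<phi> p) + ereal ((0 - p) \<bullet> (y - p)) \<le> ereal (- \<phi> y)" for y
    unfolding p_def
    by (rule prox_on_subgradient[where m = 1 and ?y0.0 = 0])
      (use g in \<open>auto simp: power2_norm_eq_inner bounded_linear_ident\<close>)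
  then have le: "\<phi> d \<le> p \<bullet> d" for d
    using add[of p d] by (metis (no_types, lifting) add_diff_cancel_left' add_le_cancel_left diff_0
        ereal_less_eq(3) inner_minus_left minus_diff_eq plus_ereal.simps(1)
        diff_le_eq le_diff_eq neg_le_iff_le minus_add_distrib add.commute uminus_add_conv_diff)
  have "\<phi> d = p \<bullet> d" for d using le[of d] le[of "- d"] by (simp add: neg)
  then show ?thesis by blast
qed

text \<open>The projection is the proximal point of the indicator function of \<open>C\<close>, and
  the subgradient inequality becomes the obtuse angle condition.\<close>

lemma convex_projection:
  fixes C :: "'a::{real_inner, complete_space} set"
  assumes "convex C" "closed C" "C \<noteq> {}"
  shows "\<exists>p\<in>C. \<forall>y\<in>C. (x - p) \<bullet> (y - p) \<le> 0"
proof -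
  define g :: "'a \<Rightarrow> ereal" where "g y = (if y \<in> C then 0 else \<infinity>)" for y
  obtain y0 where y0: "y0 \<in> C" using assms by blast
  define p where "p = prox_on UNIV (\<lambda>x. x) g x"
  have c: "convex_fun g" using convexD_alt[OF assms(1)]
    by (auto simp: convex_fun_def g_def add.commute)
  have pr: "proper_fun g" using y0 by (auto simp: proper_fun_def g_def effdom_def split: if_splits)
  have l: "lsc_fun g" unfolding g_def using lsc_fun_restrict[OF lsc_fun_continuous[OF continuous_on_const] assms(2), of 0]
    by (simp only: zero_ereal_def)
  have y1: "g y0 < \<infinity>" using y0 by (simp add: g_def)
  have b: "bounded_linear (\<lambda>x::'a. x)" by (rule bounded_linear_ident)
  note pp = prox_on_subgradient[OF subspace_UNIV closed_UNIV b _ zero_less_one _ c pr l UNIV_I y1 UNIV_I, where x = x, folded p_def]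
  have "\<bar>g p\<bar> \<noteq> \<infinity>" by (rule pp(2)) (auto simp: power2_norm_eq_inner)
  then have "p \<in> C" by (auto simp: g_def split: if_splits)
  moreover have "(x - p) \<bullet> (y - p) \<le> 0" if "y \<in> C" for y
  proof -
    have "g p + ereal ((x - p) \<bullet> (y - p)) \<le> g y" using pp(3)[of y] by (simp add: power2_norm_eq_inner)
    then show ?thesis using \<open>p \<in> C\<close> that by (simp add: g_def zero_ereal_def)
  qed
  ultimately show ?thesis by blast
qed

lemma orth_proj_exists:
  fixes S :: "'a::{real_inner, complete_space} set"
  assumes "subspace S" "closed S"
  shows "orth_proj S x \<in> S \<and> (\<forall>y\<in>S. (x - orth_proj S x) \<bullet> y = 0)"
proof -
  have oc: "v \<in> S\<^sup>\<bottom> \<longleftrightarrow> (\<forall>y\<in>S. v \<bullet> y = 0)" for v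
    by (auto simp: orthogonal_comp_def orthogonal_def inner_commute)
  obtain p where p: "p \<in> S" "\<forall>y\<in>S. (x - p) \<bullet> (y - p) \<le> 0"
    using convex_projection[of S x] assms subspace_imp_convex subspace_0 by blast
  have le: "(x - p) \<bullet> y \<le> 0" if "y \<in> S" for y
    using p(2)[rule_format, of "p + y"] p(1) that assms by (simp add: subspace_add)
  have p0: "p \<in> S \<and> x - p \<in> S\<^sup>\<bottom>"
    using p(1) le le[of "- y" for y] assms(1) by (force simp: oc subspace_neg intro: antisym)
  have "q = p" if "q \<in> S \<and> x - q \<in> S\<^sup>\<bottom>" for q
  proof -
    have "q - p \<in> S" using that p assms by (simp add: subspace_diff)
    then have "(x - p) \<bullet> (q - p) = 0" "(x - q) \<bullet> (q - p) = 0" using that p0 by (auto simp: oc)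
    then have "(q - p) \<bullet> (q - p) = 0" by (simp add: inner_diff_left)
    then show ?thesis by simp
  qed
  with p0 have "orth_proj S x \<in> S \<and> x - orth_proj S x \<in> S\<^sup>\<bottom>"
    unfolding orth_proj_def by (intro theI[of "\<lambda>p. p \<in> S \<and> x - p \<in> S\<^sup>\<bottom>"])
  then show ?thesis by (simp add: oc)
qed

context
  fixes S :: "'a::{real_inner, complete_space} set"
  assumes S: "subspace S" "closed S"
begin

lemma orth_proj_in: "orth_proj S x \<in> S"
  and orth_proj_orth: "y \<in> S \<Longrightarrow> orth_proj S x \<bullet> y = x \<bullet> y"
  using orth_proj_exists[OF S, of x] by (auto simp: inner_diff_left)

lemma orth_proj_unique:
  assumes "p \<in> S" "\<And>y. y \<in> S \<Longrightarrow> p \<bullet> y = x \<bullet> y"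
  shows "orth_proj S x = p"
proof -
  have "orth_proj S x - p \<in> S" using assms S orth_proj_in by (simp add: subspace_diff)
  then have "(orth_proj S x - p) \<bullet> (orth_proj S x - p) = 0"
    using assms orth_proj_orth by (simp add: inner_diff_left)
  then show ?thesis by simp
qed

lemma orth_proj_add: "orth_proj S (x + y) = orth_proj S x + orth_proj S y"
  by (rule orth_proj_unique) (auto simp: orth_proj_in orth_proj_orth S subspace_add inner_add_left)

lemma orth_proj_diff: "orth_proj S (x - y) = orth_proj S x - orth_proj S y"
  by (rule orth_proj_unique) (auto simp: orth_proj_in orth_proj_orth S subspace_diff inner_diff_left)

lemma orth_proj_scaleR: "orth_proj S (c *\<^sub>R x) = c *\<^sub>R orth_proj S x"
  by (rule orth_proj_unique) (auto simp: orth_proj_in orth_proj_orth S subspace_scale)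

lemma orth_proj_selfadjoint: "orth_proj S x \<bullet> y = x \<bullet> orth_proj S y"
  by (metis orth_proj_in orth_proj_orth inner_commute)

lemma norm_orth_proj_le: "norm (orth_proj S x) \<le> norm x"
proof -
  have "(norm (orth_proj S x))\<^sup>2 = x \<bullet> orth_proj S x"
    by (simp add: power2_norm_eq_inner orth_proj_orth orth_proj_in)
  also have "\<dots> \<le> norm x * norm (orth_proj S x)" by (rule norm_cauchy_schwarz)
  finally show ?thesis by (cases "orth_proj S x = 0") (auto simp: power2_eq_square)
qed

lemma bounded_linear_orth_proj: "bounded_linear (orth_proj S)"
  by (rule bounded_linear_intro[where K = 1]) (auto simp: orth_proj_add orth_proj_scaleR norm_orth_proj_le)

end

text \<open>The solution minimizes half the form of \<open>M\<close> minus the pairing with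
  \<open>b\<close> over \<open>S\<close>. Since \<open>M\<close> leaves \<open>S\<close> invariant,
  \<open>p + (b - M p)\<close> is an admissible test point, and there the inequality says that
  \<open>b - M p\<close> has norm 0.\<close>

lemma spos_op_on_surj:
  fixes M :: "'a::{real_inner, complete_space} \<Rightarrow>\<^sub>L 'a"
  assumes S: "subspace S" "closed S" and M: "spos_op_on S M" and b: "b \<in> S"
  shows "\<exists>p\<in>S. M p = b"
proof -
  define g where "g y = ereal ((- b) \<bullet> y)" for y
  have g: "convex_fun g" "proper_fun g" "lsc_fun g"
    unfolding g_def by (auto simp: convex_fun_linear[of "- b", simplified] proper_fun_def effdom_def
        intro!: lsc_fun_continuous continuous_intros)
  obtain m where m: "m > 0" "\<And>\<xi>. \<xi> \<in> S \<Longrightarrow> m * (norm \<xi>)\<^sup>2 \<le> \<xi> \<bullet> M \<xi>"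
    using M by (auto simp: spos_op_on_def inner_commute)
  have sym: "\<And>u v. u \<in> S \<Longrightarrow> v \<in> S \<Longrightarrow> M u \<bullet> v = u \<bullet> M v" and inv: "\<And>u. u \<in> S \<Longrightarrow> M u \<in> S"
    using M by (auto simp: spos_op_on_def pos_op_on_def)
  define p where "p = prox_on S M g 0"
  have g0: "g 0 < \<infinity>" by (simp add: g_def)
  note pp = prox_on_subgradient[OF S blinfun.bounded_linear_right sym m g subspace_0[OF S(1)] g0 subspace_0[OF S(1)], folded p_def]
  have pS: "p \<in> S" using pp(1) by blast
  have "g p + ereal (M (0 - p) \<bullet> (y - p)) \<le> g y" if "y \<in> S" for y using pp(3) that by blast
  from this[of "p + (b - M p)"] have "(b - M p) \<bullet> (b - M p) \<le> 0"
    using pS b inv[OF pS] S by (simp add: g_def subspace_add subspace_diff blinfun.minus_right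
      inner_add_left inner_add_right inner_diff_left inner_diff_right inner_commute)
  then have "M p = b" by (metis eq_iff_diff_eq_0 inner_ge_zero inner_eq_zero_iff order_antisym)
  then show ?thesis using pS by blast
qed

lemma spos_op_inverse:
  fixes M :: "'a::{real_inner, complete_space} \<Rightarrow>\<^sub>L 'a"
  assumes M: "spos_op_on UNIV M"
  obtains G :: "'a \<Rightarrow>\<^sub>L 'a" where "inv (blinfun_apply M) = blinfun_apply G"
    "\<And>x. G (M x) = x" "\<And>x. M (G x) = x" "spos_op_on UNIV G"
proof -
  obtain m where m: "m > 0" "\<And>\<xi>. m * (norm \<xi>)\<^sup>2 \<le> M \<xi> \<bullet> \<xi>"
    using M by (auto simp: spos_op_on_def)
  have sym: "M u \<bullet> v = u \<bullet> M v" for u v using M by (auto simp: spos_op_on_def pos_op_on_def)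
  have bd: "m * norm x \<le> norm (M x)" for x
  proof (cases "x = 0")
    case False
    have "m * (norm x * norm x) \<le> norm (M x) * norm x"
      using m(2)[of x] norm_cauchy_schwarz[of "M x" x] by (simp add: power2_eq_square)
    then show ?thesis using False by (simp add: mult.assoc[symmetric])
  qed simp
  have inj: "inj (blinfun_apply M)"
  proof (rule injI)
    fix x y assume "M x = M y"
    then have "m * norm (x - y) \<le> 0" using bd[of "x - y"] by (simp add: blinfun.diff_right)
    then show "x = y" using m(1) by (simp add: mult_le_0_iff)
  qed
  have surj: "surj (blinfun_apply M)"
    using spos_op_on_surj[OF subspace_UNIV closed_UNIV M] by (metis UNIV_I surj_def)
  define G where "G = inv (blinfun_apply M)"
  have GM: "G (M x) = x" and MG: "M (G x) = x" for x
    using inj surj by (auto simp: G_def surj_f_inv_f)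
  have "bounded_linear G"
  proof (rule bounded_linear_intro[where K = "1/m"])
    show "G (x + y) = G x + G y" for x y by (metis GM MG blinfun.add_right)
    show "G (c *\<^sub>R x) = c *\<^sub>R G x" for c x by (metis GM MG blinfun.scaleR_right)
    show "norm (G x) \<le> norm x * (1/m)" for x using bd[of "G x"] m(1) by (simp add: MG field_simps)
  qed
  then have Gb: "blinfun_apply (Blinfun G) = G" by (rule bounded_linear_Blinfun_apply)
  \<comment> \<open>The added 1 keeps \<open>c\<close> positive even if \<open>M = 0\<close>, which
    happens on the trivial space. Since \<open>norm x \<le> c * norm (G x)\<close>, the positivity
    constant of the inverse is \<open>m / c\<^sup>2\<close>.\<close>
  define c where "c = norm M + 1"
  have c: "c > 0" by (simp add: c_def add_nonneg_pos)
  have spos: "m / c\<^sup>2 * (norm x)\<^sup>2 \<le> G x \<bullet> x" for x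
  proof -
    have "norm x \<le> c * norm (G x)"
      using norm_blinfun[of M "G x"] MG[of x] by (simp only: c_def distrib_right mult_1 add_increasing2 norm_ge_zero)
    then have "(norm x)\<^sup>2 \<le> c\<^sup>2 * (norm (G x))\<^sup>2" by (metis norm_ge_zero power_mono power_mult_distrib)
    then have "m / c\<^sup>2 * (norm x)\<^sup>2 \<le> m * (norm (G x))\<^sup>2" using m(1) c by (simp add: field_simps)
    also have "\<dots> \<le> G x \<bullet> x" using m(2)[of "G x"] by (simp add: MG inner_commute)
    finally show ?thesis .
  qed
  have "G x \<bullet> y = x \<bullet> G y" for x y by (metis MG sym)
  moreover have "0 \<le> G x \<bullet> x" for x using spos[of x] m c by (meson divide_nonneg_pos less_imp_le mult_nonneg_nonneg order_trans zero_le_power2 zero_less_power)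
  ultimately have "spos_op_on UNIV (Blinfun G)"
    unfolding spos_op_on_def pos_op_on_def Gb using spos m c by (auto intro!: exI[of _ "m/c\<^sup>2"])
  then show ?thesis using that[of "Blinfun G"] Gb GM MG by (simp add: G_def)
qed

lemma gradient_eq:
  fixes f :: "'a::{real_inner, complete_space} \<Rightarrow> real"
  assumes "f differentiable (at y)"
  shows "GDERIV f y :> gradient f y"
proof -
  obtain f' where f': "(f has_derivative f') (at y)" using assms by (auto simp: differentiable_def)
  obtain u where "\<forall>d. f' d = u \<bullet> d" using Riesz_representation has_derivative_bounded_linear[OF f'] by blast
  then have "f' = (\<lambda>d. d \<bullet> u)" by (auto simp: inner_commute)
  then have u: "GDERIV f y :> u" using f' by (simp add: gderiv_def)
  have "w = u" if "GDERIV f y :> w" for w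
  proof -
    have "(\<lambda>h. h \<bullet> w) = (\<lambda>h. h \<bullet> u)"
      using that u unfolding gderiv_def by (rule has_derivative_unique)
    then have "(w - u) \<bullet> w = (w - u) \<bullet> u" by metis
    then have "(w - u) \<bullet> (w - u) = 0" by (simp add: inner_diff_right)
    then show ?thesis by simp
  qed
  with u show ?thesis unfolding gradient_def by (intro theI[of "\<lambda>D. GDERIV f y :> D"])
qed

section \<open>Weak limits and weak compactness along filters\<close>

definition wlim :: "('k \<Rightarrow> 'a::real_inner) \<Rightarrow> 'a \<Rightarrow> 'k filter \<Rightarrow> bool" where
  "wlim v l F \<longleftrightarrow> (\<forall>y. ((\<lambda>k. v k \<bullet> y) \<longlongrightarrow> l \<bullet> y) F)"

text \<open>Each \<open>k\<close> is sent to all its inner products, a point in a product of compact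
  intervals, so Tychonoff provides a cluster point for all \<open>j\<close> at once. The limiting
  functionals inherit linearity and the bound \<open>B j\<close>, and Riesz turns them into
  vectors.\<close>

lemma weak_compactness:
  fixes v :: "'j \<Rightarrow> 'k \<Rightarrow> 'a::{real_inner, complete_space}"
  assumes F: "F \<noteq> bot" and B: "\<And>j k. norm (v j k) \<le> B j"
  shows "\<exists>F' l. F' \<le> F \<and> F' \<noteq> bot \<and> (\<forall>j. wlim (v j) (l j) F')"
proof -
  define \<Phi> where "\<Phi> k = (\<lambda>(j, y). v j k \<bullet> y)" for k
  define K :: "('j \<times> 'a \<Rightarrow> real) set" where "K = (\<Pi>\<^sub>E (j, y) \<in> UNIV. cball 0 (B j * norm y))"
  have "compact K"
  proof -
    have "compactin (product_topology (\<lambda>_. euclidean) UNIV) K"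
      unfolding K_def compactin_PiE by (auto simp: compactin_euclidean_iff)
    then show ?thesis by (simp add: euclidean_product_topology compactin_euclidean_iff)
  qed
  have "\<Phi> k \<in> K" for k
  proof -
    have "\<bar>v j k \<bullet> y\<bar> \<le> B j * norm y" for j y
      using Cauchy_Schwarz_ineq2[of "v j k" y] B[of j k] by (meson mult_right_mono norm_ge_zero order_trans)
    then show ?thesis by (auto simp: K_def \<Phi>_def)
  qed
  then have "eventually (\<lambda>l. l \<in> K) (filtermap \<Phi> F)" by (simp add: eventually_filtermap)
  moreover have "filtermap \<Phi> F \<noteq> bot" using F by (simp add: filtermap_bot_iff)
  ultimately obtain l0 where l0: "inf (nhds l0) (filtermap \<Phi> F) \<noteq> bot"
    using \<open>compact K\<close> unfolding compact_filter by blast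
  \<comment> \<open>\<open>F\<close> refined by the preimages of the neighbourhoods of
    \<open>l0\<close>; it is not trivial because \<open>l0\<close> is a cluster point of the image
    filter.\<close>
  define F' where "F' = inf F (filtercomap \<Phi> (nhds l0))"
  have "F' \<noteq> bot"
  proof
    assume "F' = bot"
    then have "eventually (\<lambda>_. False) F'" by simp
    then obtain P Q where PQ: "eventually P F" "eventually Q (nhds l0)" "\<And>k. P k \<Longrightarrow> \<not> Q (\<Phi> k)"
      unfolding F'_def eventually_inf eventually_filtercomap by blast
    then have "eventually (\<lambda>y. \<not> Q y) (filtermap \<Phi> F)"
      by (auto simp: eventually_filtermap elim: eventually_mono)
    then have "eventually (\<lambda>_. False) (inf (nhds l0) (filtermap \<Phi> F))"
      unfolding eventually_inf using PQ(2) by blast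
    then show False using l0 by (simp add: eventually_False)
  qed
  have lim: "(\<Phi> \<longlongrightarrow> l0) F'"
    unfolding F'_def by (rule filterlim_mono[OF filterlim_filtercomap]) auto
  have comp: "((\<lambda>k. v j k \<bullet> y) \<longlongrightarrow> l0 (j, y)) F'" for j y
  proof -
    have "continuous_on UNIV (\<lambda>l :: 'j \<times> 'a \<Rightarrow> real. l (j, y))" by (rule continuous_on_product_coordinates)
    then have "((\<lambda>k. \<Phi> k (j, y)) \<longlongrightarrow> l0 (j, y)) F'"
      using lim by (rule continuous_on_tendsto_compose) auto
    then show ?thesis by (simp add: \<Phi>_def)
  qed
  have "\<exists>u. \<forall>y. l0 (j, y) = u \<bullet> y" for j
  proof (rule Riesz_representation, rule bounded_linear_intro[where K = "B j"])
    fix x y and c :: real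
    show "l0 (j, x + y) = l0 (j, x) + l0 (j, y)"
      by (rule tendsto_unique[OF \<open>F' \<noteq> bot\<close> comp]) (auto simp: inner_add_right intro!: tendsto_intros comp)
    show "l0 (j, c *\<^sub>R x) = c *\<^sub>R l0 (j, x)"
      by (rule tendsto_unique[OF \<open>F' \<noteq> bot\<close> comp]) (auto intro!: tendsto_intros comp)
    have "\<bar>v j k \<bullet> x\<bar> \<le> norm x * B j" for k
      using Cauchy_Schwarz_ineq2[of "v j k" x] B[of j k]
      by (metis mult.commute mult_left_mono norm_ge_zero order_trans)
    then have "\<bar>l0 (j, x)\<bar> \<le> norm x * B j"
      by (intro tendsto_upperbound[OF tendsto_rabs[OF comp]] \<open>F' \<noteq> bot\<close>) auto
    then show "norm (l0 (j, x)) \<le> norm x * B j" by simp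
  qed
  then obtain l where "\<And>j y. l0 (j, y) = l j \<bullet> y" by metis
  then have "\<forall>j. wlim (v j) (l j) F'" using comp by (simp add: wlim_def)
  then show ?thesis using \<open>F' \<noteq> bot\<close> by (intro exI[of _ F']) (auto simp: F'_def)
qed

text \<open>If \<open>l\<close> were outside \<open>C\<close>, the functional of
  \<open>l - p\<close> would separate it from \<open>C\<close>, where \<open>p\<close> is its
  projection. Membership is asked only frequently, which is exactly the negation that the argument
  for \<open>weak_lsc\<close> produces.\<close>

lemma wlim_closed_convex:
  fixes C :: "'a::{real_inner, complete_space} set"
  assumes C: "convex C" "closed C" and v: "wlim v l F" and ev: "frequently (\<lambda>k. v k \<in> C) F"
  shows "l \<in> C"
proof -
  have "C \<noteq> {}" using ev by (auto simp: frequently_def)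
  then obtain p where p: "p \<in> C" "\<And>y. y \<in> C \<Longrightarrow> (l - p) \<bullet> (y - p) \<le> 0"
    using convex_projection[OF C, of l] by blast
  have "((\<lambda>k. v k \<bullet> (l - p)) \<longlongrightarrow> l \<bullet> (l - p)) F" using v by (simp add: wlim_def)
  then have lim: "((\<lambda>k. v k \<bullet> (l - p) - p \<bullet> (l - p)) \<longlongrightarrow> l \<bullet> (l - p) - p \<bullet> (l - p)) F"
    by (rule tendsto_diff[OF _ tendsto_const])
  have "(l - p) \<bullet> (l - p) \<le> 0"
  proof (rule ccontr)
    assume "\<not> ?thesis"
    then have "\<forall>\<^sub>F k in F. 0 < v k \<bullet> (l - p) - p \<bullet> (l - p)"
      by (intro order_tendstoD(1)[OF lim]) (simp add: inner_diff_left)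
    then obtain k where "v k \<in> C" "0 < v k \<bullet> (l - p) - p \<bullet> (l - p)"
      using ev frequently_ex[OF frequently_eventually_conj[OF ev]] by blast
    then show False using p(2)[of "v k"] by (simp add: inner_diff_left[symmetric] inner_commute)
  qed
  then have "l = p" by (metis eq_iff_diff_eq_0 inner_ge_zero inner_eq_zero_iff order_antisym)
  then show ?thesis using p by simp
qed

lemma convex_fun_sublevel:
  assumes "convex_fun g"
  shows "convex {y. g y \<le> ereal r}"
  unfolding convex_alt
proof (intro ballI allI impI, elim conjE)
  fix x y and u :: real
  assume xy: "x \<in> {y. g y \<le> ereal r}" "y \<in> {y. g y \<le> ereal r}" and u: "0 \<le> u" "u \<le> 1"
  show "(1 - u) *\<^sub>R x + u *\<^sub>R y \<in> {y. g y \<le> ereal r}"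
  proof (cases "u = 0 \<or> u = 1")
    case False
    then have "1 - u \<in> {0<..<1}" using u by auto
    then have "g ((1 - u) *\<^sub>R x + (1 - (1 - u)) *\<^sub>R y) \<le> ereal (1 - u) * g x + ereal (1 - (1 - u)) * g y"
      using assms unfolding convex_fun_def by blast
    also have "\<dots> \<le> ereal (1 - u) * ereal r + ereal (1 - (1 - u)) * ereal r"
      using xy u by (intro add_mono ereal_mult_left_mono) auto
    finally show ?thesis by (simp add: algebra_simps)
  qed (use xy in auto)
qed

lemma weak_lsc:
  fixes g :: "'a::{real_inner, complete_space} \<Rightarrow> ereal"
  assumes "convex_fun g" "lsc_fun g" "wlim v l F" "ereal r < g l"
  shows "\<forall>\<^sub>F k in F. ereal r < g (v k)"
proof (rule ccontr)
  assume "\<not> ?thesis"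
  then have "frequently (\<lambda>k. v k \<in> {y. g y \<le> ereal r}) F" by (simp add: frequently_def not_le)
  then have "l \<in> {y. g y \<le> ereal r}"
    using wlim_closed_convex[OF convex_fun_sublevel[OF assms(1)] lsc_fun_closed_sublevel[OF assms(2)] assms(3)] by blast
  then show False using assms(4) by auto
qed

section \<open>The Attouch--Brezis sum rule\<close>

text \<open>Gliding hump: along a series with ratio 1/3, each new term dominates all later ones.\<close>

lemma uniform_boundedness:
  fixes v :: "nat \<Rightarrow> 'a::{real_inner, complete_space}"
  assumes bd: "\<And>y. \<exists>B. \<forall>k. \<bar>v k \<bullet> y\<bar> \<le> B"
  shows "\<exists>B. \<forall>k. norm (v k) \<le> B"
proof (rule ccontr)
  assume "\<not> ?thesis"
  \<comment> \<open>The factor \<open>2 * 3 ^ Suc n\<close> makes up for the length of hump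
    \<open>n\<close> and for the half of it that later humps may destroy; \<open>Suc n\<close>
    survives.\<close>
  then have "\<exists>k. norm (v k) > 2 * 3 ^ Suc n * real (Suc n)" for n by (meson not_le)
  then obtain K where K: "\<And>n. norm (v (K n)) > 2 * 3 ^ Suc n * real (Suc n)" by metis
  define u where "u n = v (K n)" for n
  have upos: "norm (u n) > 0" for n
    using K[of n] by (smt (verit) mult_nonneg_nonneg of_nat_0_le_iff u_def zero_le_power)
  define d where "d n = ((1/3) ^ Suc n / norm (u n)) *\<^sub>R u n" for n
  have nd: "norm (d n) = (1/3) ^ Suc n" for n using upos[of n] by (simp add: d_def)
  \<comment> \<open>The sign of each hump follows the sign of \<open>u n \<bullet> s n\<close>, so
    the new contribution to the pairing with \<open>u n\<close> is never cancelled.\<close>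
  define s where "s = rec_nat (0::'a) (\<lambda>n x. if u n \<bullet> x \<ge> 0 then x + d n else x - d n)"
  have s: "s (Suc n) = (if u n \<bullet> s n \<ge> 0 then s n + d n else s n - d n)" for n by (simp add: s_def)
  have ud: "u n \<bullet> d n = (1/3) ^ Suc n * norm (u n)" for n
    using upos[of n] by (simp add: d_def dot_square_norm power2_eq_square)
  have big: "(1/3) ^ Suc n * norm (u n) \<le> \<bar>u n \<bullet> s (Suc n)\<bar>" for n
  proof -
    have "e \<le> \<bar>u n \<bullet> s (Suc n)\<bar>" if "u n \<bullet> d n = e" "0 \<le> e" for e
      using that by (auto simp: s inner_add_right inner_diff_right)
    from this[OF ud] show ?thesis by simp
  qed
  have step: "norm (s (n + j) - s n) \<le> 1/2 * (1/3) ^ n * (1 - (1/3) ^ j)" for n j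
  proof (induction j)
    case (Suc j)
    have "norm (s (n + Suc j) - s (n + j)) = (1/3) ^ Suc (n + j)"
      using nd[of "n + j"] by (simp add: s)
    moreover have "norm (s (n + Suc j) - s n) \<le> norm (s (n + Suc j) - s (n + j)) + norm (s (n + j) - s n)"
      by (metis diff_add_cancel add_diff_eq norm_triangle_ineq)
    moreover have "(1/3::real) ^ Suc (n + j) + 1/2 * (1/3) ^ n * (1 - (1/3) ^ j) = 1/2 * (1/3) ^ n * (1 - (1/3) ^ Suc j)"
      by (simp add: power_add field_simps)
    ultimately show ?case using Suc.IH by linarith
  qed simp
  have step': "norm (s (n + j) - s n) \<le> 1/2 * (1/3) ^ n" for n j
  proof -
    have "1/2 * (1/3::real) ^ n * (1 - (1/3) ^ j) \<le> 1/2 * (1/3) ^ n * 1"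
      by (intro mult_left_mono) auto
    then show ?thesis using step[of n j] by linarith
  qed
  have "Cauchy s"
  proof (rule metric_CauchyI)
    fix e :: real assume e: "e > 0"
    then obtain N where N: "(1/3::real) ^ N < e" using real_arch_pow_inv[of e "1/3"] by auto
    have le: "norm (s m - s N) \<le> 1/2 * (1/3) ^ N" if "m \<ge> N" for m using step'[of N "m - N"] that by simp
    have "dist (s m) (s n) < e" if "m \<ge> N" "n \<ge> N" for m n
      using le[OF that(1)] le[OF that(2)] N norm_triangle_ineq4[of "s m - s N" "s n - s N"] by (simp add: dist_norm)
    then show "\<exists>M. \<forall>m\<ge>M. \<forall>n\<ge>M. dist (s m) (s n) < e" by blast
  qed
  then obtain l where l: "s \<longlonglongrightarrow> l" using Cauchy_convergent_iff convergent_def by blast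
  have tail: "norm (l - s n) \<le> 1/2 * (1/3) ^ n" for n
  proof (rule tendsto_upperbound)
    show "(\<lambda>j. norm (s (j + n) - s n)) \<longlonglongrightarrow> norm (l - s n)"
      by (intro tendsto_intros LIMSEQ_ignore_initial_segment l)
    show "\<forall>\<^sub>F j in sequentially. norm (s (j + n) - s n) \<le> 1/2 * (1/3) ^ n"
      using step'[of n] by (simp add: add.commute)
  qed auto
  have "real (Suc n) \<le> \<bar>v (K n) \<bullet> l\<bar>" for n
  proof -
    have "\<bar>u n \<bullet> (l - s (Suc n))\<bar> \<le> norm (u n) * (1/2 * (1/3) ^ Suc n)"
      by (rule order_trans[OF Cauchy_Schwarz_ineq2]) (intro mult_left_mono tail norm_ge_zero)
    then have "1/2 * (1/3) ^ Suc n * norm (u n) \<le> \<bar>u n \<bullet> l\<bar>"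
      using big[of n] by (simp only: inner_diff_right) (simp add: algebra_simps abs_if split: if_splits)
    moreover have "1/2 * (1/3) ^ Suc n * norm (u n) \<ge> 1/2 * (1/3) ^ Suc n * (2 * 3 ^ Suc n * real (Suc n))"
      using K[of n] by (intro mult_left_mono) (auto simp: u_def)
    moreover have "1/2 * (1/3::real) ^ Suc n * (2 * 3 ^ Suc n * real (Suc n)) = real (Suc n)"
      by (simp add: power_divide field_simps)
    ultimately show ?thesis unfolding u_def by linarith
  qed
  moreover obtain B where B: "\<forall>k. \<bar>v k \<bullet> l\<bar> \<le> B" using bd by blast
  ultimately have "real (Suc n) \<le> B" for n by (meson order_trans)
  then show False by (meson not_le reals_Archimedean2 lessI less_le_trans of_nat_less_iff order_less_trans)
qed

lemma wlim_add: "wlim v l F \<Longrightarrow> wlim v' l' F \<Longrightarrow> wlim (\<lambda>k. v k + v' k) (l + l') F"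
  unfolding wlim_def by (auto simp: inner_add_left intro: tendsto_add)

lemma wlim_diff: "wlim v l F \<Longrightarrow> wlim v' l' F \<Longrightarrow> wlim (\<lambda>k. v k - v' k) (l - l') F"
  unfolding wlim_def by (auto simp: inner_diff_left intro: tendsto_diff)

lemma wlim_scaleR: "wlim v l F \<Longrightarrow> wlim (\<lambda>k. c *\<^sub>R v k) (c *\<^sub>R l) F"
  unfolding wlim_def by (auto intro: tendsto_mult_left)

lemma wlim_sum: "(\<And>i. i \<in> I \<Longrightarrow> wlim (v i) (l i) F) \<Longrightarrow> wlim (\<lambda>k. \<Sum>i\<in>I. v i k) (\<Sum>i\<in>I. l i) F"
  unfolding wlim_def by (auto simp: inner_sum_left intro: tendsto_sum)

lemma wlim_selfadjoint:
  assumes "\<And>x y. M x \<bullet> y = x \<bullet> M y" "wlim v l F"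
  shows "wlim (\<lambda>k. M (v k)) (M l) F"
  using assms unfolding wlim_def by auto

lemma wlim_strong: "(v \<longlongrightarrow> l) F \<Longrightarrow> wlim v l F"
  unfolding wlim_def by (auto intro!: tendsto_inner)

lemma wlim_unique:
  assumes "F \<noteq> bot" "wlim v l F" "wlim v l' F"
  shows "l = l'"
proof -
  have "l \<bullet> (l - l') = l' \<bullet> (l - l')" using assms unfolding wlim_def by (meson tendsto_unique)
  then have "(l - l') \<bullet> (l - l') = 0" by (simp add: inner_diff_left)
  then show ?thesis by simp
qed

text \<open>When the subgradient inequalities at arbitrary test points are added, the points and
  subgradients that both vary occur only in the sum of the pairings, whose limit is given; the
  function values are controlled from below by weak lower semicontinuity. Moving one test point and
  leaving the others at the weak limits isolates a single function.\<close>

lemma subdiff_weak_closed: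
  fixes G :: "'j \<Rightarrow> 'a::{real_inner, complete_space} \<Rightarrow> ereal"
  assumes fin: "finite J" and F: "F \<noteq> bot"
    and G: "\<And>j. j \<in> J \<Longrightarrow> convex_fun (G j) \<and> proper_fun (G j) \<and> lsc_fun (G j)"
    and U: "\<And>j k. j \<in> J \<Longrightarrow> U j k \<in> subdiff (G j) (P j k)"
    and P: "\<And>j. j \<in> J \<Longrightarrow> wlim (P j) (X j) F"
    and V: "\<And>j. j \<in> J \<Longrightarrow> wlim (U j) (V j) F"
    and S: "((\<lambda>k. \<Sum>j\<in>J. U j k \<bullet> P j k) \<longlongrightarrow> (\<Sum>j\<in>J. V j \<bullet> X j)) F"
    and j: "j \<in> J"
  shows "V j \<in> subdiff (G j) (X j)"
proof -
  \<comment> \<open>The reals \<open>r j\<close> stand for the values at the weak limits, which are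
    not yet known to be finite.\<close>
  have key: "(\<Sum>j\<in>J. r j) + (\<Sum>j\<in>J. V j \<bullet> y j) - (\<Sum>j\<in>J. V j \<bullet> X j) \<le> (\<Sum>j\<in>J. c j)"
    if r: "\<And>j. j \<in> J \<Longrightarrow> ereal (r j) < G j (X j)" and c: "\<And>j. j \<in> J \<Longrightarrow> G j (y j) = ereal (c j)"
    for r y c
  proof (rule tendsto_upperbound)
    show "((\<lambda>k. (\<Sum>j\<in>J. r j) + (\<Sum>j\<in>J. U j k \<bullet> y j) - (\<Sum>j\<in>J. U j k \<bullet> P j k))
        \<longlongrightarrow> (\<Sum>j\<in>J. r j) + (\<Sum>j\<in>J. V j \<bullet> y j) - (\<Sum>j\<in>J. V j \<bullet> X j)) F"
      using V by (intro tendsto_diff tendsto_add tendsto_sum tendsto_const S) (auto simp: wlim_def)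
    have "\<forall>\<^sub>F k in F. \<forall>j\<in>J. ereal (r j) < G j (P j k)"
      using G P r by (intro eventually_ball_finite fin ballI weak_lsc[of "G j" for j]) auto
    then show "\<forall>\<^sub>F k in F. (\<Sum>j\<in>J. r j) + (\<Sum>j\<in>J. U j k \<bullet> y j) - (\<Sum>j\<in>J. U j k \<bullet> P j k) \<le> (\<Sum>j\<in>J. c j)"
    proof eventually_elim
      case (elim k)
      have "r j + U j k \<bullet> y j - U j k \<bullet> P j k \<le> c j" if "j \<in> J" for j
      proof -
        have "\<bar>G j (P j k)\<bar> \<noteq> \<infinity>" "G j (P j k) + ereal (U j k \<bullet> (y j - P j k)) \<le> ereal (c j)"
          using U[OF that, of k] c[OF that] unfolding subdiff_def by (auto dest: spec[of _ "y j"])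
        then show ?thesis using elim that by (cases "G j (P j k)") (force simp: inner_diff_right)+
      qed
      then have "(\<Sum>j\<in>J. r j + U j k \<bullet> y j - U j k \<bullet> P j k) \<le> (\<Sum>j\<in>J. c j)" by (rule sum_mono)
      then show ?case by (simp add: sum.distrib sum_subtractf)
    qed
  qed (use F in auto)
  have ninf: "G j x \<noteq> -\<infinity>" if "j \<in> J" for j x using G[OF that] by (auto simp: proper_fun_def)
  have "\<exists>y c. G j y = ereal c" if "j \<in> J" for j
  proof -
    from G[OF that] obtain y where "G j y < \<infinity>" by (auto simp: proper_fun_def effdom_def)
    then show ?thesis using ninf[OF that, of y] by (cases "G j y") auto
  qed
  then obtain y c where yc: "\<And>j. j \<in> J \<Longrightarrow> G j (y j) = ereal (c j)" by metis
  have "\<exists>r. ereal r < G j (X j)" if "j \<in> J" for j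
    using ninf[OF that, of "X j"] by (cases "G j (X j)") (auto intro: lt_ex)
  then obtain r where r: "\<And>j. j \<in> J \<Longrightarrow> ereal (r j) < G j (X j)" by metis
  have "\<exists>a. G i (X i) = ereal a" if i: "i \<in> J" for i
  proof (cases "G i (X i)")
    case PInf
    \<comment> \<open>If \<open>G i (X i)\<close> were infinite, any real could replace
      \<open>r i\<close>; this one violates \<open>key\<close> by 1.\<close>
    define R where "R = (\<Sum>j\<in>J. c j) - ((\<Sum>j\<in>J-{i}. r j) + (\<Sum>j\<in>J. V j \<bullet> y j) - (\<Sum>j\<in>J. V j \<bullet> X j)) + 1"
    have "(\<Sum>j\<in>J. (r(i := R)) j) + (\<Sum>j\<in>J. V j \<bullet> y j) - (\<Sum>j\<in>J. V j \<bullet> X j) \<le> (\<Sum>j\<in>J. c j)"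
      by (rule key) (use r yc PInf in auto)
    moreover have "(\<Sum>j\<in>J. (r(i := R)) j) = R + (\<Sum>j\<in>J-{i}. r j)"
      using sum.remove[OF fin i, of "r(i := R)"] by simp
    ultimately show ?thesis by (simp add: R_def)
  qed (use ninf[OF i] in auto)
  then obtain a where a: "\<And>i. i \<in> J \<Longrightarrow> G i (X i) = ereal (a i)" by metis
  have "G j (X j) + ereal (V j \<bullet> (y0 - X j)) \<le> G j y0" for y0
  proof (cases "G j y0")
    case (real c0)
    have "a j + V j \<bullet> (y0 - X j) \<le> c0 + e" if e: "e > 0" for e
    proof -
      \<comment> \<open>Each value is lowered by \<open>e'\<close> to get strict lower bounds; over
        all of \<open>J\<close> this costs at most \<open>e\<close>.\<close>
      define e' where "e' = e / (card J + 1)"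
      have e': "e' > 0" "card J * e' \<le> e" using e by (auto simp: e'_def field_simps)
      have "(\<Sum>i\<in>J. a i - e') + (\<Sum>i\<in>J. V i \<bullet> (X(j := y0)) i) - (\<Sum>i\<in>J. V i \<bullet> X i) \<le> (\<Sum>i\<in>J. (a(j := c0)) i)"
        by (rule key) (use a real e' in auto)
      moreover have "(\<Sum>i\<in>J. V i \<bullet> (X(j := y0)) i) = V j \<bullet> y0 + (\<Sum>i\<in>J-{j}. V i \<bullet> X i)"
        "(\<Sum>i\<in>J. V i \<bullet> X i) = V j \<bullet> X j + (\<Sum>i\<in>J-{j}. V i \<bullet> X i)"
        "(\<Sum>i\<in>J. (a(j := c0)) i) = c0 + (\<Sum>i\<in>J-{j}. a i)"
        "(\<Sum>i\<in>J. a i - e') = a j + (\<Sum>i\<in>J-{j}. a i) - card J * e'"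
        using sum.remove[OF fin j, of "\<lambda>i. V i \<bullet> (X(j := y0)) i"] sum.remove[OF fin j, of "\<lambda>i. V i \<bullet> X i"]
          sum.remove[OF fin j, of "a(j := c0)"] sum.remove[OF fin j, of a] by (simp_all add: sum_subtractf)
      ultimately show ?thesis using e' by (simp add: inner_diff_right)
    qed
    then have "a j + V j \<bullet> (y0 - X j) \<le> c0" by (rule field_le_epsilon)
    then show ?thesis using a[OF j] real by simp
  qed (use ninf[OF j] in auto)
  then show ?thesis using a[OF j] by (simp add: subdiff_def)
qed

lemma subspace_closure:
  fixes S :: "'a::real_normed_vector set"
  assumes S: "subspace S"
  shows "subspace (closure S)"
  unfolding subspace_def
proof (intro conjI ballI allI)
  show "0 \<in> closure S" using S closure_subset subspace_0 by blast
next
  fix x y assume "x \<in> closure S" "y \<in> closure S"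
  then obtain s t where "\<And>n. s n \<in> S" "s \<longlonglongrightarrow> x" "\<And>n. t n \<in> S" "t \<longlonglongrightarrow> y"
    unfolding closure_sequential by blast
  then show "x + y \<in> closure S" unfolding closure_sequential
    by (intro exI[of _ "\<lambda>n. s n + t n"]) (auto intro: subspace_add[OF S] tendsto_add)
next
  fix c and x assume "x \<in> closure S"
  then obtain s where "\<And>n. s n \<in> S" "s \<longlonglongrightarrow> x" unfolding closure_sequential by blast
  then show "c *\<^sub>R x \<in> closure S" unfolding closure_sequential
    by (intro exI[of _ "\<lambda>n. c *\<^sub>R s n"]) (auto intro: subspace_scale[OF S] tendsto_scaleR)
qed

lemma subdiffI:
  fixes g :: "'a::real_inner \<Rightarrow> ereal"
  assumes "\<bar>g x\<bar> \<noteq> \<infinity>" "\<And>y c. g y = ereal c \<Longrightarrow> g x + ereal (u \<bullet> (y - x)) \<le> g y" "\<And>y. g y \<noteq> -\<infinity>"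
  shows "u \<in> subdiff g x"
  unfolding subdiff_def
proof (intro CollectI conjI allI assms(1))
  fix y show "g x + ereal (u \<bullet> (y - x)) \<le> g y" using assms(2,3)[of y] by (cases "g y") auto
qed

text \<open>The penalized problems in two variables have multipliers \<open>v k\<close>, and the qualification condition
  makes these pointwise bounded on the closed span of the domain difference.\<close>

lemma Attouch_Brezis:
  fixes g h :: "'a::{real_inner, complete_space} \<Rightarrow> ereal"
  assumes g: "convex_fun g" "proper_fun g" "lsc_fun g"
    and h: "convex_fun h" "proper_fun h" "lsc_fun h"
    and w: "w \<in> subdiff (\<lambda>y. g y + h y) x"
    and sri: "0 \<in> sri (minkowski_diff (effdom h) (effdom g))"
  shows "\<exists>q. w - q \<in> subdiff g x \<and> q \<in> subdiff h x"
proof -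
  have ng: "g y \<noteq> -\<infinity>" and nh: "h y \<noteq> -\<infinity>" for y using g h by (auto simp: proper_fun_def)
  obtain gx hx where gx: "g x = ereal gx" and hx: "h x = ereal hx"
    using w ng[of x] nh[of x] unfolding subdiff_def by (cases "g x"; cases "h x") auto
  have wsub: "gx + hx + w \<bullet> (y - x) \<le> a + b" if "g y = ereal a" "h y = ereal b" for y a b
    using w that gx hx unfolding subdiff_def by (auto dest!: spec[of _ y])
  obtain A1 where A1: "A1 \<ge> 0" "\<And>y. ereal (gx - 1 - A1 * norm (y - x)) \<le> g y"
    using convex_lsc_minorant[OF g(1,3) gx] by blast
  obtain A2 where A2: "A2 \<ge> 0" "\<And>y. ereal (hx - 1 - A2 * norm (y - x)) \<le> h y"
    using convex_lsc_minorant[OF h(1,3) hx] by blast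
  define V where "V = closure (span (minkowski_diff (effdom h) (effdom g)))"
  have V: "subspace V" "closed V" by (auto simp: V_def subspace_closure subspace_span)
  have Vcone: "V = cone hull (minkowski_diff (effdom h) (effdom g))"
    using sri by (simp add: sri_def V_def)
  \<comment> \<open>The variable is doubled: \<open>g\<close> and \<open>h\<close> act on separate
    copies, and the tilt by \<open>w\<close> makes \<open>x\<close> a minimizer on the
    diagonal.\<close>
  define G :: "'a \<times> 'a \<Rightarrow> ereal" where "G p = (g (fst p) + ereal (- w \<bullet> fst p)) + h (snd p)" for p
  have cg: "convex_fun (\<lambda>p::'a\<times>'a. g (fst p))" and ch: "convex_fun (\<lambda>p::'a\<times>'a. h (snd p))"
    and cw: "convex_fun (\<lambda>p::'a\<times>'a. ereal (- w \<bullet> fst p))"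
    using g h convex_fun_linear[of "- w"] by (auto simp: convex_fun_def)
  have cG: "convex_fun G" unfolding G_def
    by (intro convex_fun_add cg ch cw) (use ng nh in auto)
  have lG: "lsc_fun G" unfolding G_def
    by (intro lsc_fun_add lsc_fun_compose[OF g(3)] lsc_fun_compose[OF h(3)] lsc_fun_continuous continuous_intros)
      (use ng nh in auto)
  have pG: "proper_fun G" "G (x, x) < \<infinity>"
  proof -
    show "G (x, x) < \<infinity>" by (simp add: G_def gx hx)
    then show "proper_fun G" using ng nh unfolding proper_fun_def effdom_def by (auto simp: G_def)
  qed
  have "\<exists>s t. (\<exists>a. g s = ereal a) \<and> (\<exists>b. h t = ereal b) \<and>
    (\<forall>y' y. G (s, t) + ereal ((x - s - N *\<^sub>R (s - t)) \<bullet> (y' - s) + (N *\<^sub>R (s - t)) \<bullet> (y - t)) \<le> G (y', y))"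
    if N: "N \<ge> 1" for N :: real
  proof -
    \<comment> \<open>Its form at \<open>(a, b)\<close> is the squared norm of \<open>a\<close> plus
      \<open>N\<close> times that of \<open>a - b\<close>. The proximal step at
      \<open>(x, x)\<close> thus anchors the first copy at \<open>x\<close> and penalizes the
      disagreement of the two copies.\<close>
    define M :: "'a \<times> 'a \<Rightarrow> 'a \<times> 'a" where "M p = (fst p + N *\<^sub>R (fst p - snd p), N *\<^sub>R (snd p - fst p))" for p
    have M: "bounded_linear M" unfolding M_def by (intro bounded_linear_intros)
    have sym: "M p \<bullet> q = p \<bullet> M q" for p q
      by (simp add: M_def inner_prod_def algebra_simps inner_commute)
    \<comment> \<open>For \<open>N = 1\<close>, three times the form exceeds
      \<open>(norm p)\<^sup>2\<close> by the squared norms of \<open>2 *\<^sub>R a - b\<close> and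
      \<open>a - b\<close>.\<close>
    have pos: "1/3 * (norm p)\<^sup>2 \<le> p \<bullet> M p" for p :: "'a \<times> 'a"
    proof -
      obtain a b where p: "p = (a, b)" by (cases p)
      have e1: "p \<bullet> M p = a \<bullet> a + N * ((a - b) \<bullet> (a - b))"
        by (simp add: p M_def inner_prod_def algebra_simps inner_commute)
      have "(2 *\<^sub>R a - b) \<bullet> (2 *\<^sub>R a - b) \<ge> 0" "(a - b) \<bullet> (a - b) \<ge> 0" by simp_all
      moreover have "(norm p)\<^sup>2 = a \<bullet> a + b \<bullet> b" by (simp add: p norm_Pair power2_norm_eq_inner)
      moreover have "N * ((a - b) \<bullet> (a - b)) \<ge> 1 * ((a - b) \<bullet> (a - b))" using N by (intro mult_right_mono) auto
      ultimately show ?thesis unfolding e1 by (simp add: algebra_simps inner_commute)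
    qed
    note pp = prox_on_subgradient[OF subspace_UNIV closed_UNIV M sym _ pos cG pG(1) lG UNIV_I pG(2) UNIV_I, where x = "(x, x)", simplified]
    obtain s t where st: "prox_on UNIV M G (x, x) = (s, t)" by (cases "prox_on UNIV M G (x, x)")
    have fin: "\<bar>G (s, t)\<bar> \<noteq> \<infinity>" and sub: "G (s, t) + ereal (M ((x, x) - (s, t)) \<bullet> (y - (s, t))) \<le> G y" for y
      using pp st by auto
    have "M ((x, x) - (s, t)) \<bullet> ((y', y) - (s, t)) = (x - s - N *\<^sub>R (s - t)) \<bullet> (y' - s) + (N *\<^sub>R (s - t)) \<bullet> (y - t)" for y' y
      by (simp add: M_def inner_prod_def algebra_simps)
    moreover have "(\<exists>a. g s = ereal a) \<and> (\<exists>b. h t = ereal b)"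
      using fin ng[of s] nh[of t] by (cases "g s"; cases "h t") (auto simp: G_def)
    ultimately show ?thesis using sub by metis
  qed
  then have "\<forall>k::nat. \<exists>s t a b. g s = ereal a \<and> h t = ereal b \<and>
    (\<forall>y' y. G (s, t) + ereal ((x - s - real (Suc k) *\<^sub>R (s - t)) \<bullet> (y' - s) + (real (Suc k) *\<^sub>R (s - t)) \<bullet> (y - t)) \<le> G (y', y))"
    by (metis le_add1 of_nat_1 of_nat_le_iff plus_1_eq_Suc)
  then obtain s t a b where ga: "\<And>k. g (s k) = ereal (a k)" and hb: "\<And>k. h (t k) = ereal (b k)"
    and sub: "\<And>k y' y. G (s k, t k) + ereal ((x - s k - real (Suc k) *\<^sub>R (s k - t k)) \<bullet> (y' - s k)
        + (real (Suc k) *\<^sub>R (s k - t k)) \<bullet> (y - t k)) \<le> G (y', y)" by metis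
  define v where "v k = real (Suc k) *\<^sub>R (s k - t k)" for k
  have opt: "a k - w \<bullet> s k + b k + (x - s k) \<bullet> (y' - s k) + v k \<bullet> (y - y')
      + real (Suc k) * (norm (s k - t k))\<^sup>2 \<le> \<alpha> - w \<bullet> y' + \<beta>"
    if "g y' = ereal \<alpha>" "h y = ereal \<beta>" for k y' y \<alpha> \<beta>
  proof -
    have "a k - w \<bullet> s k + b k + ((x - s k - v k) \<bullet> (y' - s k) + v k \<bullet> (y - t k)) \<le> \<alpha> - w \<bullet> y' + \<beta>"
      using sub[of k y' y] that ga[of k] hb[of k] by (simp add: G_def v_def)
    moreover have "v k \<bullet> (s k - t k) = real (Suc k) * (norm (s k - t k))\<^sup>2"
      by (simp add: v_def power2_norm_eq_inner)
    ultimately show ?thesis by (simp add: inner_diff_left inner_diff_right)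
  qed
  have opt_x: "a k + b k - w \<bullet> (s k - x) + (norm (s k - x))\<^sup>2
      + real (Suc k) * (norm (s k - t k))\<^sup>2 \<le> gx + hx" for k
    using opt[OF gx hx, of k] by (simp add: power2_norm_eq_inner inner_diff_left inner_diff_right)
  define C where "C = A1 + A2 + norm w"
  have C: "C \<ge> 0" using A1 A2 by (simp add: C_def)
  have ab_lb: "gx + hx - 2 - (A1 + A2) * norm (s k - x) - A2 * norm (s k - t k) \<le> a k + b k" for k
  proof -
    have "gx - 1 - A1 * norm (s k - x) \<le> a k" "hx - 1 - A2 * norm (t k - x) \<le> b k"
      using A1(2)[of "s k"] A2(2)[of "t k"] ga hb by auto
    moreover have "A2 * norm (t k - x) \<le> A2 * (norm (s k - x) + norm (s k - t k))"
      using norm_triangle_ineq4[of "s k - x" "s k - t k"] A2(1) by (intro mult_left_mono) auto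
    ultimately show ?thesis by (simp add: algebra_simps)
  qed
  have quad: "(norm (s k - x))\<^sup>2 + real (Suc k) * (norm (s k - t k))\<^sup>2
      \<le> 2 + C * norm (s k - x) + C * norm (s k - t k)" for k
  proof -
    have "w \<bullet> (s k - x) \<le> norm w * norm (s k - x)" by (rule norm_cauchy_schwarz)
    moreover have "A2 * norm (s k - t k) \<le> C * norm (s k - t k)"
      using A1(1) by (intro mult_right_mono) (auto simp: C_def)
    ultimately show ?thesis using opt_x[of k] ab_lb[of k] by (simp add: C_def algebra_simps)
  qed
  \<comment> \<open>A radius that \<open>p\<^sup>2 + q\<^sup>2 \<le> 2 + C * p + C * q\<close>
    imposes on both numbers: above it \<open>p * (p - C)\<close> is too large, while
    \<open>q * (q - C)\<close> is at least \<open>- C\<^sup>2 / 4\<close>.\<close>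
  define R where "R = 2 + 2 * C"
  have R: "norm (s k - x) \<le> R" "norm (s k - t k) \<le> R" for k
  proof -
    let ?p = "norm (s k - x)" and ?q = "norm (s k - t k)"
    have "1 * ?q\<^sup>2 \<le> real (Suc k) * ?q\<^sup>2" by (intro mult_right_mono) auto
    then have le: "?p\<^sup>2 + ?q\<^sup>2 \<le> 2 + C * ?p + C * ?q" using quad[of k] by linarith
    have *: "p \<le> R" if "p\<^sup>2 + q\<^sup>2 \<le> 2 + C * p + C * q" for p q :: real
    proof (rule ccontr)
      assume "\<not> p \<le> R"
      then have "(2 + 2 * C) * (2 + C) \<le> p * (p - C)" using C by (intro mult_mono) (auto simp: R_def)
      moreover have "0 \<le> (q - C/2)\<^sup>2" by simp
      moreover obtain D where "C * C = D" "0 \<le> D" by simp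
      ultimately show False using that C by (simp add: power2_eq_square algebra_simps)
    qed
    show "?p \<le> R" "?q \<le> R" using *[of ?p ?q] *[of ?q ?p] le by (simp_all add: algebra_simps)
  qed
  define R' where "R' = 2 + C * R + C * R"
  have st0: "(\<lambda>k. s k - t k) \<longlonglongrightarrow> 0"
  proof -
    have "(norm (s k - t k))\<^sup>2 \<le> R' * inverse (real (Suc k))" for k
    proof -
      have "real (Suc k) * (norm (s k - t k))\<^sup>2 \<le> R'"
        using quad[of k] mult_left_mono[OF R(1)[of k] C] mult_left_mono[OF R(2)[of k] C]
          zero_le_power2[of "norm (s k - x)"] unfolding R'_def by linarith
      then show ?thesis by (simp add: field_simps)
    qed
    note le = this
    have "(\<lambda>k. (norm (s k - t k))\<^sup>2) \<longlonglongrightarrow> 0"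
    proof (rule tendsto_sandwich[OF _ _ tendsto_const])
      show "(\<lambda>k. R' * inverse (real (Suc k))) \<longlonglongrightarrow> 0"
        using LIMSEQ_inverse_real_of_nat by (rule tendsto_mult_right_zero)
    qed (use le in \<open>simp_all only: zero_le_power2 eventually_True\<close>)
    then have "(\<lambda>k. sqrt ((norm (s k - t k))\<^sup>2)) \<longlonglongrightarrow> sqrt 0" by (rule tendsto_real_sqrt)
    then show ?thesis by (simp add: tendsto_norm_zero_iff)
  qed
  \<comment> \<open>By the qualification condition \<open>d\<close> is a nonnegative multiple of a
    difference of domain points, and \<open>opt\<close> at these points bounds its pairing with
    \<open>v k\<close> from above. As \<open>V\<close> is a subspace, \<open>- d\<close> supplies
    the lower bound.\<close>
  have v_bd: "\<exists>B. \<forall>k. v k \<bullet> d \<le> B" if d: "d \<in> V" for d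
  proof -
    obtain c y' y where c: "c \<ge> 0" "d = c *\<^sub>R (y - y')" "h y < \<infinity>" "g y' < \<infinity>"
      using d unfolding Vcone cone_hull_expl minkowski_diff_def effdom_def by blast
    then obtain \<alpha> \<beta> where ab: "g y' = ereal \<alpha>" "h y = ereal \<beta>"
      using ng[of y'] nh[of y] by (cases "g y'"; cases "h y") auto
    define B where "B = \<alpha> - w \<bullet> y' + \<beta> - (gx + hx - 2 - (A1 + A2) * R - A2 * R) + (norm w * (norm x + R)) + R * (norm (y' - x) + R)"
    have "v k \<bullet> (y - y') \<le> B" for k
    proof -
      have "(A1 + A2) * norm (s k - x) \<le> (A1 + A2) * R" "A2 * norm (s k - t k) \<le> A2 * R"
        using R A1(1) A2(1) by (auto intro: mult_left_mono)
      moreover have "w \<bullet> s k \<le> norm w * (norm x + R)"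
        using R(1)[of k] norm_triangle_ineq[of "s k - x" x]
        by (intro order_trans[OF norm_cauchy_schwarz] mult_left_mono) auto
      moreover have "- ((x - s k) \<bullet> (y' - s k)) \<le> R * (norm (y' - x) + R)"
      proof -
        have "norm (s k - x) * norm (y' - s k) \<le> R * (norm (y' - x) + R)"
          using R(1)[of k] norm_triangle_ineq4[of "y' - x" "s k - x"] by (intro mult_mono) (auto intro: order_trans[OF norm_ge_zero])
        then show ?thesis using norm_cauchy_schwarz[of "s k - x" "y' - s k"] by (simp add: inner_diff_left)
      qed
      moreover have "0 \<le> real (Suc k) * (norm (s k - t k))\<^sup>2" by simp
      ultimately show ?thesis using opt[OF ab, of k] ab_lb[of k] unfolding B_def by linarith
    qed
    then have "v k \<bullet> d \<le> c * B" for k using c by (simp add: mult_left_mono)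
    then show ?thesis by blast
  qed
  \<comment> \<open>The multipliers are controlled only on \<open>V\<close>. Projecting them there
    loses nothing, since they are only paired with differences of domain points, which lie in
    \<open>V\<close>.\<close>
  define q where "q k = orth_proj V (v k)" for k
  have qv: "q k \<bullet> d = v k \<bullet> d" if "d \<in> V" for k d
    using orth_proj_orth[OF V that] by (simp add: q_def)
  have "\<exists>B. \<forall>k. \<bar>q k \<bullet> y\<bar> \<le> B" for y
  proof -
    define d where "d = orth_proj V y"
    have dV: "d \<in> V" "- d \<in> V" using orth_proj_in[OF V] V by (auto simp: d_def subspace_neg)
    have e: "q k \<bullet> y = v k \<bullet> d" for k
      using orth_proj_selfadjoint[OF V] by (simp add: q_def d_def)
    obtain B1 B2 where "\<And>k. v k \<bullet> d \<le> B1" "\<And>k. v k \<bullet> (- d) \<le> B2" using v_bd dV by metis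
    then have "\<bar>q k \<bullet> y\<bar> \<le> max B1 B2" for k unfolding e by (smt (verit) inner_minus_right)
    then show ?thesis by blast
  qed
  then obtain B where B: "\<And>k. norm (q k) \<le> B" using uniform_boundedness by blast
  have "norm (s k) \<le> norm x + R" for k using R(1)[of k] norm_triangle_ineq[of "s k - x" x] by simp
  \<comment> \<open>A boolean index treats \<open>q\<close> and \<open>s\<close> as one family, so
    that both converge weakly along the same filter.\<close>
  then have bd: "norm ((if j then q k else s k)) \<le> (if j then B else norm x + R)" for j k using B by simp
  obtain F' l where F': "F' \<le> sequentially" "F' \<noteq> bot" and l: "\<And>j. wlim (\<lambda>k. if j then q k else s k) (l j) F'"
    using weak_compactness[OF sequentially_bot, of "\<lambda>j k. if j then q k else s k", OF bd] by blast
  define q\<^sub>0 s\<^sub>0 where "q\<^sub>0 = l True" and "s\<^sub>0 = l False"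
  have wq: "wlim q q\<^sub>0 F'" and ws: "wlim s s\<^sub>0 F'" using l[of True] l[of False] by (auto simp: q\<^sub>0_def s\<^sub>0_def)
  have wt: "wlim t s\<^sub>0 F'"
    using wlim_diff[OF ws wlim_strong[OF tendsto_mono[OF F'(1) st0]]] by simp
  have wss: "((\<lambda>k. w \<bullet> (s k - x)) \<longlongrightarrow> w \<bullet> (s\<^sub>0 - x)) F'"
    using ws unfolding wlim_def inner_diff_right inner_commute[of w] by (intro tendsto_diff tendsto_const) blast
  have low: "\<forall>\<^sub>F k in F'. r1 < a k \<and> r2 < b k" if "ereal r1 < g s\<^sub>0" "ereal r2 < h s\<^sub>0" for r1 r2
    using weak_lsc[OF g(1,3) ws that(1)] weak_lsc[OF h(1,3) wt that(2)] by eventually_elim (simp add: ga hb)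
  have low2: "r1 + r2 - w \<bullet> (s\<^sub>0 - x) \<le> gx + hx" if "ereal r1 < g s\<^sub>0" "ereal r2 < h s\<^sub>0" for r1 r2
  proof (rule tendsto_upperbound)
    show "((\<lambda>k. r1 + r2 - w \<bullet> (s k - x)) \<longlongrightarrow> r1 + r2 - w \<bullet> (s\<^sub>0 - x)) F'" by (intro tendsto_intros wss)
    show "\<forall>\<^sub>F k in F'. r1 + r2 - w \<bullet> (s k - x) \<le> gx + hx"
      using low[OF that]
    proof eventually_elim
      case (elim k)
      have "0 \<le> (norm (s k - x))\<^sup>2" "0 \<le> real (Suc k) * (norm (s k - t k))\<^sup>2" by simp_all
      then show ?case using elim opt_x[of k] by linarith
    qed
  qed (use F' in auto)
  obtain r1 r2 where r12: "ereal r1 < g s\<^sub>0" "ereal r2 < h s\<^sub>0"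
    using ng[of s\<^sub>0] nh[of s\<^sub>0] by (metis MInfty_neq_ereal(1) ereal_dense2 ereal_infty_less(2))
  have "g s\<^sub>0 \<noteq> \<infinity>"
    using low2[of "gx + hx + w \<bullet> (s\<^sub>0 - x) - r2 + 1" r2] r12 by auto
  moreover have "h s\<^sub>0 \<noteq> \<infinity>"
    using low2[of r1 "gx + hx + w \<bullet> (s\<^sub>0 - x) - r1 + 1"] r12 by auto
  ultimately obtain gs hs where gs: "g s\<^sub>0 = ereal gs" and hs: "h s\<^sub>0 = ereal hs"
    using ng[of s\<^sub>0] nh[of s\<^sub>0] by (cases "g s\<^sub>0"; cases "h s\<^sub>0") auto
  have ge: "gx + hx + w \<bullet> (s\<^sub>0 - x) \<le> gs + hs" by (rule wsub[OF gs hs])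
  \<comment> \<open>Weak lower semicontinuity and the subgradient \<open>w\<close> show that the
    limit point has energy at least that of \<open>x\<close>, and \<open>opt_x\<close> then leaves
    no room for the anchoring term. Strong convergence is needed to drop
    \<open>(x - s k) \<bullet> (y' - s k)\<close> in the limit.\<close>
  have strong: "((\<lambda>k. (norm (s k - x))\<^sup>2) \<longlongrightarrow> 0) F'"
  proof (rule tendstoI)
    fix e :: real assume e: "e > 0"
    have l1: "\<forall>\<^sub>F k in F'. gs - e/4 < a k \<and> hs - e/4 < b k" by (rule low) (use gs hs e in auto)
    have "\<forall>\<^sub>F k in F'. w \<bullet> (s k - x) < w \<bullet> (s\<^sub>0 - x) + e/4"
      using e by (intro order_tendstoD(2)[OF wss]) auto
    with l1 show "\<forall>\<^sub>F k in F'. dist ((norm (s k - x))\<^sup>2) 0 < e"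
    proof eventually_elim
      case (elim k)
      have "0 \<le> real (Suc k) * (norm (s k - t k))\<^sup>2" by simp
      then have "(norm (s k - x))\<^sup>2 < e" using elim opt_x[of k] ge e by linarith
      then show ?case by (simp add: dist_real_def)
    qed
  qed
  have "((\<lambda>k. sqrt ((norm (s k - x))\<^sup>2)) \<longlongrightarrow> sqrt 0) F'" using strong by (rule tendsto_real_sqrt)
  then have "((\<lambda>k. s k - x) \<longlongrightarrow> 0) F'" by (simp add: tendsto_norm_zero_iff)
  then have sx: "(s \<longlongrightarrow> x) F'" by (simp add: LIM_zero_iff)
  have "s\<^sub>0 = x" using wlim_unique[OF F'(2) ws wlim_strong[OF sx]] .
  \<comment> \<open>Both subgradient inequalities at once: \<open>y' = x\<close> gives the one of
    \<open>h\<close>, and \<open>y = x\<close> the one of \<open>g\<close>.\<close>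
  have main: "gx + hx - w \<bullet> x + q\<^sub>0 \<bullet> (y - y') \<le> \<alpha> - w \<bullet> y' + \<beta>"
    if ab: "g y' = ereal \<alpha>" "h y = ereal \<beta>" for y y' \<alpha> \<beta>
  proof (rule field_le_epsilon)
    fix e :: real assume e: "e > 0"
    have "y - y' \<in> V" unfolding Vcone
      using ab by (intro hull_inc) (force simp: minkowski_diff_def effdom_def simp del: less_ereal.simps)
    note qd = qv[OF this]
    have "(gx - e/2) + (hx - e/2) - w \<bullet> x + 0 + q\<^sub>0 \<bullet> (y - y') \<le> \<alpha> - w \<bullet> y' + \<beta>"
    proof (rule tendsto_upperbound)
      have "((\<lambda>k. (x - s k) \<bullet> (y' - s k)) \<longlongrightarrow> (x - x) \<bullet> (y' - x)) F'" by (intro tendsto_intros sx)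
      moreover have "((\<lambda>k. q k \<bullet> (y - y')) \<longlongrightarrow> q\<^sub>0 \<bullet> (y - y')) F'" using wq by (simp add: wlim_def)
      ultimately show "((\<lambda>k. (gx - e/2) + (hx - e/2) - w \<bullet> s k + (x - s k) \<bullet> (y' - s k) + q k \<bullet> (y - y'))
          \<longlongrightarrow> (gx - e/2) + (hx - e/2) - w \<bullet> x + 0 + q\<^sub>0 \<bullet> (y - y')) F'"
        by (intro tendsto_add tendsto_diff[OF tendsto_const tendsto_inner[OF tendsto_const sx]]) simp_all
      have "\<forall>\<^sub>F k in F'. gx - e/2 < a k \<and> hx - e/2 < b k" by (rule low) (use gx hx e \<open>s\<^sub>0 = x\<close> in auto)
      then show "\<forall>\<^sub>F k in F'. (gx - e/2) + (hx - e/2) - w \<bullet> s k + (x - s k) \<bullet> (y' - s k) + q k \<bullet> (y - y')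
          \<le> \<alpha> - w \<bullet> y' + \<beta>"
      proof eventually_elim
        case (elim k)
        have "0 \<le> real (Suc k) * (norm (s k - t k))\<^sup>2" by simp
        then show ?case using elim opt[OF ab, of k] unfolding qd by linarith
      qed
    qed (use F' in auto)
    then show "gx + hx - w \<bullet> x + q\<^sub>0 \<bullet> (y - y') \<le> \<alpha> - w \<bullet> y' + \<beta> + e" by linarith
  qed
  have "q\<^sub>0 \<in> subdiff h x"
    by (rule subdiffI) (use hx nh main[OF gx] in auto)
  moreover have "w - q\<^sub>0 \<in> subdiff g x"
  proof (rule subdiffI)
    fix y c assume "g y = ereal c"
    from main[OF this hx] show "g x + ereal ((w - q\<^sub>0) \<bullet> (y - x)) \<le> g y"
      by (simp add: \<open>g y = ereal c\<close> gx inner_diff_left inner_diff_right)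
  qed (use gx ng in auto)
  ultimately show ?thesis by blast
qed

section \<open>Positive operators, square roots, cocoercive gradients\<close>

lemma pos_op_Cauchy_Schwarz:
  assumes M: "pos_op_on UNIV M"
  shows "\<bar>M x \<bullet> y\<bar> \<le> norm_wrt M x * norm_wrt M y"
proof -
  have sym: "M u \<bullet> v = u \<bullet> M v" and pos: "0 \<le> M u \<bullet> u" for u v
    using M by (auto simp: pos_op_on_def)
  define a b c where "a = M x \<bullet> x" and "b = M x \<bullet> y" and "c = M y \<bullet> y"
  have b': "M y \<bullet> x = b" using sym[of y x] by (simp add: b_def inner_commute)
  have q: "0 \<le> a - 2 * t * b + t\<^sup>2 * c" for t
    using pos[of "x - t *\<^sub>R y"] b'
    by (simp add: a_def b_def c_def blinfun.diff_right blinfun.scaleR_right inner_diff_left inner_diff_right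
        power2_eq_square algebra_simps)
  have "b\<^sup>2 \<le> a * c"
  proof (cases "c = 0")
    case True
    have "b = 0"
    proof (rule ccontr)
      assume "b \<noteq> 0"
      \<comment> \<open>At this \<open>t\<close> the quadratic, which is linear here, takes the
        value -1.\<close>
      then show False using q[of "(a + 1) / (2 * b)"] True by (simp add: field_simps)
    qed
    then show ?thesis using True by simp
  next
    case False
    then have "c > 0" using pos[of y] by (simp add: c_def less_le)
    then show ?thesis using q[of "b / c"] by (simp add: field_simps power2_eq_square)
  qed
  then have "sqrt (b\<^sup>2) \<le> sqrt (a * c)" by (rule real_sqrt_le_mono)
  then show ?thesis by (simp add: norm_wrt_def a_def b_def c_def real_sqrt_mult)
qed

lemma norm_wrt_nonneg: "pos_op_on UNIV M \<Longrightarrow> 0 \<le> norm_wrt M x"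
  by (auto simp: norm_wrt_def pos_op_on_def)

lemma norm_wrt_power2: "pos_op_on UNIV M \<Longrightarrow> (norm_wrt M x)\<^sup>2 = M x \<bullet> x"
  by (auto simp: norm_wrt_def pos_op_on_def)

lemma norm_wrt_triangle:
  assumes M: "pos_op_on UNIV M"
  shows "norm_wrt M (x + y) \<le> norm_wrt M x + norm_wrt M y"
proof (rule power2_le_imp_le)
  have "M y \<bullet> x = M x \<bullet> y" using M by (simp add: pos_op_on_def inner_commute)
  then have "(norm_wrt M (x + y))\<^sup>2 = M x \<bullet> x + 2 * (M x \<bullet> y) + M y \<bullet> y"
    by (simp add: norm_wrt_power2[OF M] blinfun.add_right inner_add_left inner_add_right)
  also have "\<dots> \<le> (norm_wrt M x + norm_wrt M y)\<^sup>2"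
    using pos_op_Cauchy_Schwarz[OF M, of x y] by (simp add: power2_sum norm_wrt_power2[OF M])
  finally show "(norm_wrt M (x + y))\<^sup>2 \<le> (norm_wrt M x + norm_wrt M y)\<^sup>2" .
qed (simp add: norm_wrt_nonneg[OF M])

lemma norm_wrt_scaleR:
  assumes M: "pos_op_on UNIV M"
  shows "norm_wrt M (c *\<^sub>R x) = \<bar>c\<bar> * norm_wrt M x"
  by (simp add: norm_wrt_def blinfun.scaleR_right real_sqrt_mult mult.assoc[symmetric])

lemma norm_wrt_le:
  assumes M: "pos_op_on UNIV M"
  shows "norm_wrt M x \<le> sqrt (norm M) * norm x"
proof -
  have "M x \<bullet> x \<le> norm M * norm x * norm x"
    by (rule order_trans[OF norm_cauchy_schwarz]) (intro mult_right_mono norm_blinfun norm_ge_zero)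
  then have "norm_wrt M x \<le> sqrt (norm M * (norm x)\<^sup>2)" by (simp add: norm_wrt_def power2_eq_square mult.assoc)
  then show ?thesis by (simp add: real_sqrt_mult)
qed

text \<open>For a positive operator the form controls the norm: apply the Cauchy--Schwarz inequality
  of the form to \<open>x\<close> and \<open>B x\<close>.\<close>

lemma pos_op_norm_le:
  assumes B: "pos_op_on UNIV B" and r: "r \<ge> 0" "\<And>x. B x \<bullet> x \<le> r * (norm x)\<^sup>2"
  shows "norm B \<le> r"
proof (rule norm_blinfun_bound[OF r(1)])
  fix x
  have le: "norm_wrt B x \<le> sqrt r * norm x" for x
  proof -
    have "norm_wrt B x \<le> sqrt (r * (norm x)\<^sup>2)" using r(2) by (simp add: norm_wrt_def)
    then show ?thesis by (simp add: real_sqrt_mult)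
  qed
  have "norm (B x) * norm (B x) = B x \<bullet> B x" by (simp add: dot_square_norm power2_eq_square)
  also have "\<dots> \<le> norm_wrt B x * norm_wrt B (B x)" using pos_op_Cauchy_Schwarz[OF B, of x "B x"] by linarith
  also have "\<dots> \<le> (sqrt r * norm x) * (sqrt r * norm (B x))"
    using r by (intro mult_mono le norm_wrt_nonneg[OF B]) auto
  also have "\<dots> = (r * norm x) * norm (B x)" using r by simp
  finally show "norm (B x) \<le> r * norm x"
    using r(1) by (cases "B x = 0") (auto simp: mult_le_cancel_right)
qed

text \<open>With \<open>B = I - L/c\<close> of norm below 1, the square root is \<open>sqrt c (I - Y)\<close> where \<open>Y\<close> is the fixed
  point of the contraction \<open>Y \<mapsto> (B + Y\<^sup>2)/2\<close>.\<close>

lemma spos_sqrt_exists: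
  fixes L :: "'a::{real_inner, complete_space} \<Rightarrow>\<^sub>L 'a"
  assumes L: "spos_op_on UNIV L"
  shows "\<exists>R. spos_op_on UNIV R \<and> R o\<^sub>L R = L \<and>
    (\<forall>T :: 'a \<Rightarrow>\<^sub>L 'a. (\<forall>x. T (L x) = L (T x)) \<longrightarrow> (\<forall>x. T (R x) = R (T x)))"
proof -
  obtain m0 where m0: "m0 > 0" "\<And>x. m0 * (norm x)\<^sup>2 \<le> L x \<bullet> x" using L by (auto simp: spos_op_on_def)
  have symL: "L u \<bullet> v = u \<bullet> L v" for u v
    using L by (auto simp: spos_op_on_def pos_op_on_def)
  define c where "c = norm L + 1"
  \<comment> \<open>\<open>r\<close> bounds the form of \<open>B\<close>. The minimum keeps it
    nonnegative on the trivial space, where \<open>m0\<close> may exceed \<open>c\<close>.\<close>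
  define r where "r = 1 - min m0 c / c"
  have c: "c > 0" by (simp add: c_def add_nonneg_pos)
  have r: "0 \<le> r" "r < 1" using c m0 by (auto simp: r_def min_def field_simps)
  define B where "B = id_blinfun - (1/c) *\<^sub>R L"
  have Bx: "B x = x - (1/c) *\<^sub>R L x" for x by (simp add: B_def blinfun.diff_left blinfun.scaleR_left)
  have LB: "L x \<bullet> x \<le> c * (norm x)\<^sup>2" for x
  proof -
    have "L x \<bullet> x \<le> norm L * norm x * norm x"
      by (rule order_trans[OF norm_cauchy_schwarz]) (intro mult_right_mono norm_blinfun norm_ge_zero)
    also have "\<dots> \<le> c * (norm x)\<^sup>2" by (simp add: c_def power2_eq_square mult.assoc mult_right_mono)
    finally show ?thesis .
  qed
  have "pos_op_on UNIV B"
    using LB c by (auto simp: pos_op_on_def Bx inner_diff_left inner_diff_right symL power2_norm_eq_inner field_simps)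
  moreover have "B x \<bullet> x \<le> r * (norm x)\<^sup>2" for x
  proof -
    have "min m0 c * (norm x)\<^sup>2 \<le> L x \<bullet> x" using m0(2)[of x] by (meson min.cobounded1 mult_right_mono order_trans zero_le_power2)
    then show ?thesis using c by (simp add: Bx r_def inner_diff_left power2_norm_eq_inner field_simps)
  qed
  ultimately have nB: "norm B \<le> r" using pos_op_norm_le r(1) by blast
  have symB: "B u \<bullet> v = u \<bullet> B v" for u v using \<open>pos_op_on UNIV B\<close> by (auto simp: pos_op_on_def)
  \<comment> \<open>Picard iterates of the contraction, started at 0. They are polynomials in
    \<open>B\<close>, so symmetry and commutation with \<open>T\<close> hold for each of them and
    pass to the pointwise limit.\<close>
  define Y where "Y = rec_nat (0 :: 'a \<Rightarrow>\<^sub>L 'a) (\<lambda>k y. (1/2) *\<^sub>R (B + (y o\<^sub>L y)))"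
  have Y0: "Y 0 = 0" and YS: "Y (Suc k) = (1/2) *\<^sub>R (B + (Y k o\<^sub>L Y k))" for k by (simp_all add: Y_def)
  have YSx: "Y (Suc k) x = (1/2) *\<^sub>R (B x + Y k (Y k x))" for k x
    by (simp add: YS blinfun.scaleR_left blinfun.add_left)
  have nY: "norm (Y k) \<le> r" for k
  proof (induction k)
    case (Suc k)
    have "norm (Y (Suc k)) \<le> 1/2 * (norm B + norm (Y k o\<^sub>L Y k))"
      unfolding YS norm_scaleR by (intro mult_mono norm_triangle_ineq) auto
    also have "norm (Y k o\<^sub>L Y k) \<le> norm (Y k) * norm (Y k)" by (rule norm_blinfun_compose)
    also have "\<dots> \<le> r * 1" using Suc r by (intro mult_mono) auto
    finally show ?case using nB by simp
  qed (use r in \<open>simp add: Y0\<close>)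
  have nYx: "norm (Y k x) \<le> r * norm x" for k x
    by (rule order_trans[OF norm_blinfun]) (intro mult_right_mono nY norm_ge_zero)
  have diff: "norm (Y (Suc k) x - Y k x) \<le> r ^ k * norm x" for k x
  proof -
    have "norm (Y (Suc k) - Y k) \<le> r ^ k"
    proof (induction k)
      case 0 then show ?case using nY[of "Suc 0"] r by (simp add: Y0)
    next
      case (Suc k)
      have "(1/2) *\<^sub>R (B + (A o\<^sub>L A)) - (1/2) *\<^sub>R (B + (C o\<^sub>L C)) = (1/2) *\<^sub>R ((A o\<^sub>L (A - C)) + ((A - C) o\<^sub>L C))" for A C
        by (rule blinfun_eqI) (simp add: blinfun.diff_left blinfun.add_left blinfun.scaleR_left blinfun.diff_right algebra_simps)
      moreover have "Y (Suc (Suc k)) - Y (Suc k)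
          = (1/2) *\<^sub>R (B + (Y (Suc k) o\<^sub>L Y (Suc k))) - (1/2) *\<^sub>R (B + (Y k o\<^sub>L Y k))" by (simp only: YS)
      ultimately have "Y (Suc (Suc k)) - Y (Suc k)
          = (1/2) *\<^sub>R ((Y (Suc k) o\<^sub>L (Y (Suc k) - Y k)) + ((Y (Suc k) - Y k) o\<^sub>L Y k))" by simp
      then have "norm (Y (Suc (Suc k)) - Y (Suc k)) \<le> 1/2 * (norm (Y (Suc k) o\<^sub>L (Y (Suc k) - Y k)) + norm ((Y (Suc k) - Y k) o\<^sub>L Y k))"
        unfolding norm_scaleR by (simp add: norm_triangle_ineq)
      also have "norm (Y (Suc k) o\<^sub>L (Y (Suc k) - Y k)) \<le> r * r ^ k"
        by (rule order_trans[OF norm_blinfun_compose]) (intro mult_mono nY Suc.IH r norm_ge_zero)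
      also have "norm ((Y (Suc k) - Y k) o\<^sub>L Y k) \<le> r ^ k * r"
        by (rule order_trans[OF norm_blinfun_compose]) (intro mult_mono nY Suc.IH zero_le_power r norm_ge_zero)
      finally show ?case by (simp add: field_simps)
    qed
    then have "norm (Y (Suc k) - Y k) * norm x \<le> r ^ k * norm x" by (intro mult_right_mono) auto
    then show ?thesis using norm_blinfun[of "Y (Suc k) - Y k" x] by (simp add: blinfun.diff_left)
  qed
  have "Cauchy (\<lambda>k. Y k x)" for x
  proof -
    have step: "norm (Y (k + j) x - Y k x) \<le> (r ^ k - r ^ (k + j)) / (1 - r) * norm x" for k j
    proof (induction j)
      case (Suc j)
      have "norm (Y (k + Suc j) x - Y k x) \<le> norm (Y (Suc (k + j)) x - Y (k + j) x) + norm (Y (k + j) x - Y k x)"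
        using norm_triangle_ineq[of "Y (Suc (k + j)) x - Y (k + j) x" "Y (k + j) x - Y k x"] by simp
      also have "\<dots> \<le> r ^ (k + j) * norm x + (r ^ k - r ^ (k + j)) / (1 - r) * norm x"
        using diff[of "k + j" x] Suc.IH by linarith
      also have "\<dots> = (r ^ k - r ^ (k + Suc j)) / (1 - r) * norm x" using r by (simp add: field_simps)
      finally show ?case .
    qed simp
    have step': "norm (Y (k + j) x - Y k x) \<le> r ^ k * (norm x / (1 - r))" for k j
    proof -
      have "(r ^ k - r ^ (k + j)) / (1 - r) * norm x \<le> r ^ k / (1 - r) * norm x"
        using r by (intro mult_right_mono divide_right_mono) auto
      then show ?thesis using step[of k j] by simp
    qed
    have lim: "(\<lambda>k. r ^ k * (norm x / (1 - r))) \<longlonglongrightarrow> 0"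
      using r by (intro tendsto_mult_left_zero LIMSEQ_realpow_zero) auto
    show ?thesis
    proof (rule metric_CauchyI)
      fix e :: real assume "e > 0"
      then have "\<forall>\<^sub>F k in sequentially. r ^ k * (norm x / (1 - r)) < e / 2"
        by (intro order_tendstoD(2)[OF lim]) simp
      then obtain N where N: "r ^ N * (norm x / (1 - r)) < e / 2" by (auto simp: eventually_sequentially)
      have le: "norm (Y k x - Y N x) < e / 2" if "k \<ge> N" for k using step'[of N "k - N"] N that
        by (simp only: le_add_diff_inverse)
      have "dist (Y m x) (Y n x) < e" if "m \<ge> N" "n \<ge> N" for m n
        using le[OF that(1)] le[OF that(2)] norm_triangle_ineq4[of "Y m x - Y N x" "Y n x - Y N x"]
        by (simp add: dist_norm)
      then show "\<exists>M. \<forall>m\<ge>M. \<forall>n\<ge>M. dist (Y m x) (Y n x) < e" by blast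
    qed
  qed
  then have "\<exists>l. (\<lambda>k. Y k x) \<longlonglongrightarrow> l" for x using Cauchy_convergent_iff convergent_def by blast
  then obtain y where y: "\<And>x. (\<lambda>k. Y k x) \<longlonglongrightarrow> y x" by metis
  have ny: "norm (y x) \<le> r * norm x" for x
    by (rule tendsto_upperbound[OF tendsto_norm[OF y]]) (auto simp: nYx)
  have "bounded_linear y"
  proof (rule bounded_linear_intro[where K = r])
    show "y (u + v) = y u + y v" for u v
      by (rule LIMSEQ_unique[OF y]) (simp add: blinfun.add_right tendsto_add y)
    show "y (s *\<^sub>R u) = s *\<^sub>R y u" for s u
      by (rule LIMSEQ_unique[OF y]) (simp add: blinfun.scaleR_right tendsto_scaleR y)
    show "norm (y u) \<le> norm u * r" for u using ny[of u] by (simp add: mult.commute)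
  qed
  then have yb: "blinfun_apply (Blinfun y) = y" by (rule bounded_linear_Blinfun_apply)
  \<comment> \<open>Pointwise limits do not respect composition by themselves; the uniform bound
    \<open>r\<close> on the \<open>Y k\<close> makes \<open>Y k (Y k x - y x)\<close>
    vanish.\<close>
  have yeq: "2 *\<^sub>R y x = B x + y (y x)" for x
  proof -
    have "(\<lambda>k. Y k (Y k x - y x)) \<longlonglongrightarrow> 0"
    proof (rule tendsto_norm_zero_cancel, rule tendsto_sandwich[OF _ _ tendsto_const])
      show "(\<lambda>k. r * norm (Y k x - y x)) \<longlonglongrightarrow> 0"
        by (intro tendsto_mult_right_zero tendsto_norm_zero LIM_zero y)
    qed (simp_all add: nYx)
    then have "(\<lambda>k. Y k (Y k x - y x) + Y k (y x)) \<longlonglongrightarrow> 0 + y (y x)" by (intro tendsto_add y)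
    then have "(\<lambda>k. Y k (Y k x)) \<longlonglongrightarrow> y (y x)" by (simp add: blinfun.diff_right)
    then have "(\<lambda>k. Y (Suc k) x) \<longlonglongrightarrow> (1/2) *\<^sub>R (B x + y (y x))"
      unfolding YSx by (intro tendsto_intros)
    then have "y x = (1/2) *\<^sub>R (B x + y (y x))" using LIMSEQ_unique LIMSEQ_Suc[OF y] by blast
    then show ?thesis by (metis scaleR_half_double scaleR_2 scaleR_right_distrib)
  qed
  have symY: "Y k u \<bullet> v = u \<bullet> Y k v" for k u v
    by (induction k arbitrary: u v) (simp_all add: Y0 YSx inner_add_left inner_add_right symB)
  have symy: "y u \<bullet> v = u \<bullet> y v" for u v
    by (rule LIMSEQ_unique[OF tendsto_inner[OF y tendsto_const]])
      (simp add: symY tendsto_inner[OF tendsto_const y])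
  define R where "R = sqrt c *\<^sub>R (id_blinfun - Blinfun y)"
  have Rx: "R x = sqrt c *\<^sub>R (x - y x)" for x by (simp add: R_def blinfun.scaleR_left blinfun.diff_left yb)
  have ydiff: "y (u - v) = y u - y v" for u v using \<open>bounded_linear y\<close> by (simp add: bounded_linear.linear linear_diff)
  have yscale: "y (s *\<^sub>R u) = s *\<^sub>R y u" for s u using \<open>bounded_linear y\<close> by (simp add: bounded_linear.linear linear_scale)
  have RR: "R o\<^sub>L R = L"
  proof (rule blinfun_eqI)
    fix x
    have "R (R x) = c *\<^sub>R (x - 2 *\<^sub>R y x + y (y x))"
      using c by (simp add: Rx yscale ydiff scaleR_2 algebra_simps)
    also have "x - 2 *\<^sub>R y x + y (y x) = (1/c) *\<^sub>R L x" unfolding yeq by (simp add: Bx)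
    finally show "(R o\<^sub>L R) x = L x" using c by simp
  qed
  have spos: "sqrt c * (1 - r) * (norm x)\<^sup>2 \<le> R x \<bullet> x" for x
  proof -
    have "y x \<bullet> x \<le> r * norm x * norm x"
      by (rule order_trans[OF norm_cauchy_schwarz]) (intro mult_right_mono ny norm_ge_zero)
    then have "(1 - r) * (norm x)\<^sup>2 \<le> (x - y x) \<bullet> x"
      by (simp add: inner_diff_left power2_norm_eq_inner dot_square_norm power2_eq_square algebra_simps)
    then show ?thesis using c by (simp add: Rx mult.assoc)
  qed
  have mu: "sqrt c * (1 - r) > 0" using c r by simp
  then have "0 \<le> R x \<bullet> x" for x using spos[of x] by (meson less_imp_le mult_nonneg_nonneg order_trans zero_le_power2)
  then have "spos_op_on UNIV R" using spos mu unfolding spos_op_on_def pos_op_on_def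
    by (auto simp: Rx inner_diff_left inner_diff_right symy)
  moreover have "T (R x) = R (T x)" if T: "\<And>x. T (L x) = L (T x)" for T :: "'a \<Rightarrow>\<^sub>L 'a" and x
  proof -
    have TB: "T (B x) = B (T x)" for x by (simp add: Bx blinfun.diff_right blinfun.scaleR_right T)
    have TY: "T (Y k x) = Y k (T x)" for k x
      by (induction k arbitrary: x) (simp_all add: Y0 YSx blinfun.add_right blinfun.scaleR_right TB)
    have "T (y x) = y (T x)"
      by (rule LIMSEQ_unique[OF blinfun.tendsto[OF tendsto_const y]]) (simp add: TY y)
    then show ?thesis by (simp add: Rx blinfun.diff_right blinfun.scaleR_right)
  qed
  ultimately show ?thesis using RR by blast
qed

text \<open>A second positive root commutes with \<open>L\<close>, its own square, hence with
  \<open>R\<close>. Then \<open>R + R'\<close> annihilates \<open>d = R' x - R x\<close>; both forms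
  are nonnegative at \<open>d\<close> and that of \<open>R\<close> is coercive, so
  \<open>d = 0\<close>.\<close>

lemma op_sqrt_unique_existence:
  fixes L :: "'a::{real_inner, complete_space} \<Rightarrow>\<^sub>L 'a"
  assumes L: "spos_op_on UNIV L"
  shows "spos_op_on UNIV (op_sqrt L) \<and> (\<forall>x. op_sqrt L (op_sqrt L x) = L x) \<and>
    (\<forall>T :: 'a \<Rightarrow>\<^sub>L 'a. (\<forall>x. T (L x) = L (T x)) \<longrightarrow> (\<forall>x. T (op_sqrt L x) = op_sqrt L (T x)))"
proof -
  obtain R where R: "spos_op_on UNIV R" "R o\<^sub>L R = L"
    and comm: "\<forall>T :: 'a \<Rightarrow>\<^sub>L 'a. (\<forall>x. T (L x) = L (T x)) \<longrightarrow> (\<forall>x. T (R x) = R (T x))"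
    using spos_sqrt_exists[OF L] by blast
  have RR: "R (R x) = L x" for x using R(2) by (metis blinfun_apply_blinfun_compose)
  have "R' = R" if R': "pos_op_on UNIV R'" "R' o\<^sub>L R' = L" for R'
  proof (rule blinfun_eqI)
    fix x
    have RR': "R' (R' x) = L x" for x using R'(2) by (metis blinfun_apply_blinfun_compose)
    have cm: "R' (R x) = R (R' x)" for x
      by (rule comm[rule_format]) (simp add: RR'[symmetric])
    define d where "d = R' x - R x"
    have "R d + R' d = 0" by (simp add: d_def blinfun.diff_right RR RR' cm)
    then have "R d \<bullet> d + R' d \<bullet> d = 0" by (metis inner_add_left inner_zero_left)
    moreover have "0 \<le> R' d \<bullet> d" using R'(1) by (auto simp: pos_op_on_def)
    moreover obtain m where "m > 0" "m * (norm d)\<^sup>2 \<le> R d \<bullet> d" using R(1) by (auto simp: spos_op_on_def)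
    ultimately have "m * (norm d)\<^sup>2 \<le> 0" by linarith
    then show "R' x = R x" using \<open>m > 0\<close> by (simp add: mult_le_0_iff d_def)
  qed
  then have eq: "op_sqrt L = R"
    unfolding op_sqrt_def using R by (intro the_equality) (auto simp: spos_op_on_def)
  show ?thesis unfolding eq using R(1) RR comm by blast
qed

lemma
  fixes L T :: "'a::{real_inner, complete_space} \<Rightarrow>\<^sub>L 'a"
  assumes "spos_op_on UNIV L"
  shows op_sqrt_spos: "spos_op_on UNIV (op_sqrt L)"
    and op_sqrt_square: "op_sqrt L (op_sqrt L x) = L x"
    and op_sqrt_commute: "(\<And>x. T (L x) = L (T x)) \<Longrightarrow> T (op_sqrt L x) = op_sqrt L (T x)"
  using op_sqrt_unique_existence[OF assms] by blast+

text \<open>Substitute \<open>u = R y\<close> with \<open>R\<close> the square root of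
  \<open>L\<close>; then the form of the inverse of \<open>L\<close> at \<open>u\<close> is
  \<open>y \<bullet> y\<close>. This is how the norm of the preconditioned product enters the
  cocoercivity of the gradient.\<close>

lemma quadratic_form_bound:
  fixes L Li \<Gamma> :: "'a::{real_inner, complete_space} \<Rightarrow>\<^sub>L 'a"
  assumes L: "spos_op_on UNIV L" and Li: "\<And>x. Li (L x) = x" "\<And>x. L (Li x) = x"
  shows "\<Gamma> u \<bullet> u \<le> norm (op_sqrt L o\<^sub>L \<Gamma> o\<^sub>L op_sqrt L) * (Li u \<bullet> u)"
proof -
  define R where "R = op_sqrt L"
  have R: "spos_op_on UNIV R" and RR: "R (R x) = L x" for x using op_sqrt_spos[OF L] op_sqrt_square[OF L] by (simp_all add: R_def)
  have sym: "R u \<bullet> v = u \<bullet> R v" for u v using R by (auto simp: spos_op_on_def pos_op_on_def)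
  define y where "y = R (Li u)"
  have u: "u = R y" by (simp add: y_def RR Li)
  have "\<Gamma> u \<bullet> u = (R o\<^sub>L \<Gamma> o\<^sub>L R) y \<bullet> y" by (simp add: u sym)
  also have "\<dots> \<le> norm (R o\<^sub>L \<Gamma> o\<^sub>L R) * norm y * norm y"
    by (rule order_trans[OF norm_cauchy_schwarz]) (intro mult_right_mono norm_blinfun norm_ge_zero)
  also have "\<dots> = norm (R o\<^sub>L \<Gamma> o\<^sub>L R) * (y \<bullet> y)" by (simp add: dot_square_norm power2_eq_square)
  also have "y \<bullet> y = Li u \<bullet> R (R (Li u))" by (simp only: y_def sym)
  also have "\<dots> = Li u \<bullet> u" by (simp add: RR Li)
  finally show ?thesis unfolding R_def .
qed

lemma orth_comp_iff: "v \<in> S\<^sup>\<bottom> \<longleftrightarrow> (\<forall>y\<in>S. v \<bullet> y = 0)"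
  by (auto simp: orthogonal_comp_def orthogonal_def inner_commute)

lemma in_subspace_iff:
  fixes S :: "'a::{real_inner, complete_space} set"
  assumes S: "subspace S" "closed S"
  shows "v \<in> S \<longleftrightarrow> (\<forall>y\<in>S\<^sup>\<bottom>. v \<bullet> y = 0)"
proof
  assume *: "\<forall>y\<in>S\<^sup>\<bottom>. v \<bullet> y = 0"
  have o: "v - orth_proj S v \<in> S\<^sup>\<bottom>" by (simp add: orth_comp_iff inner_diff_left orth_proj_orth[OF S])
  have "v \<bullet> (v - orth_proj S v) = 0" using * o by blast
  moreover have "(v - orth_proj S v) \<bullet> orth_proj S v = 0" using o orth_proj_in[OF S] by (simp add: orth_comp_iff)
  ultimately have "(v - orth_proj S v) \<bullet> (v - orth_proj S v) = 0"
    by (simp add: inner_diff_right inner_diff_left inner_commute)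
  then show "v \<in> S" using orth_proj_in[OF S, of v] by simp
qed (auto simp: orth_comp_iff inner_commute)

text \<open>The square root \<open>R\<close> of \<open>G\<close> commutes with \<open>W\<close>, so
  the form of the product at \<open>x\<close> is the form of \<open>W\<close> at \<open>R x\<close>.
  Being symmetric and preserving the kernel of \<open>W\<close>, the complement of \<open>S\<close>,
  \<open>R\<close> also preserves \<open>S\<close>, where \<open>W\<close> is coercive.\<close>

lemma product_spos_on:
  fixes G W :: "'a::{real_inner, complete_space} \<Rightarrow>\<^sub>L 'a"
  assumes S: "subspace S" "closed S" and G: "spos_op_on UNIV G"
    and W: "pos_op_on UNIV W" "spos_op_on S W" "{v. W v = 0} = S\<^sup>\<bottom>"
    and comm: "\<And>x. G (W x) = W (G x)"
  shows "pos_op_on UNIV (G o\<^sub>L W)" "spos_op_on S (G o\<^sub>L W)"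
    "\<And>x. W x \<in> S" "\<And>x. G (W x) \<in> S" "\<And>x. W (orth_proj S x) = W x"
proof -
  have symW: "W u \<bullet> v = u \<bullet> W v" and symG: "G u \<bullet> v = u \<bullet> G v" and posW: "0 \<le> W u \<bullet> u" for u v
    using G W by (auto simp: spos_op_on_def pos_op_on_def)
  have ker: "v \<in> S\<^sup>\<bottom> \<longleftrightarrow> W v = 0" for v using W(3) by blast
  show WS: "W x \<in> S" for x
    unfolding in_subspace_iff[OF S] by (simp add: ker symW)
  show GWS: "G (W x) \<in> S" for x using WS by (simp add: comm)
  show "W (orth_proj S x) = W x" for x
  proof -
    have "x - orth_proj S x \<in> S\<^sup>\<bottom>" by (simp add: orth_comp_iff inner_diff_left orth_proj_orth[OF S])
    then show ?thesis by (simp add: ker blinfun.diff_right)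
  qed
  define R where "R = op_sqrt G"
  have R: "spos_op_on UNIV R" and RR: "R (R x) = G x" for x using op_sqrt_spos[OF G] op_sqrt_square[OF G] by (simp_all add: R_def)
  have RW: "W (R x) = R (W x)" for x unfolding R_def by (rule op_sqrt_commute[OF G]) (simp add: comm)
  have symR: "R u \<bullet> v = u \<bullet> R v" for u v using R by (auto simp: spos_op_on_def pos_op_on_def)
  have form: "(G o\<^sub>L W) x \<bullet> x = W (R x) \<bullet> R x" for x by (simp add: RR[symmetric] RW symR)
  have sym: "(G o\<^sub>L W) u \<bullet> v = u \<bullet> (G o\<^sub>L W) v" for u v by (simp add: symG symW comm)
  show "pos_op_on UNIV (G o\<^sub>L W)" unfolding pos_op_on_def using sym posW by (auto simp: form simp del: blinfun_apply_blinfun_compose)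
  have RS: "R x \<in> S" if "x \<in> S" for x
    unfolding in_subspace_iff[OF S]
  proof
    fix y assume "y \<in> S\<^sup>\<bottom>"
    then have "R y \<in> S\<^sup>\<bottom>" by (simp add: ker RW)
    then have "R y \<bullet> x = 0" using that by (simp add: orth_comp_iff)
    then show "R x \<bullet> y = 0" by (simp add: symR inner_commute[of x])
  qed
  obtain m1 where m1: "m1 > 0" "\<And>x. x \<in> S \<Longrightarrow> m1 * (norm x)\<^sup>2 \<le> W x \<bullet> x" using W(2) by (auto simp: spos_op_on_def)
  obtain m2 where m2: "m2 > 0" "\<And>x. m2 * (norm x)\<^sup>2 \<le> R x \<bullet> x" using R by (auto simp: spos_op_on_def)
  have "m1 * m2\<^sup>2 * (norm x)\<^sup>2 \<le> (G o\<^sub>L W) x \<bullet> x" if "x \<in> S" for x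
  proof -
    have "m2 * norm x * norm x \<le> norm (R x) * norm x"
      using m2(2)[of x] norm_cauchy_schwarz[of "R x" x] by (simp add: power2_eq_square mult.assoc)
    then have "m2 * norm x \<le> norm (R x)" by (cases "x = 0") (auto dest: mult_right_le_imp_le)
    then have "(m2 * norm x)\<^sup>2 \<le> (norm (R x))\<^sup>2" using m2(1) by (intro power_mono) auto
    then have "m1 * (m2 * norm x)\<^sup>2 \<le> m1 * (norm (R x))\<^sup>2" using m1(1) by simp
    also have "\<dots> \<le> (G o\<^sub>L W) x \<bullet> x" unfolding form by (rule m1(2)[OF RS[OF that]])
    finally show ?thesis by (simp add: power_mult_distrib mult.assoc)
  qed
  then show "spos_op_on S (G o\<^sub>L W)" unfolding spos_op_on_def pos_op_on_def
    using sym GWS posW m1 m2 by (auto simp: form simp del: blinfun_apply_blinfun_compose intro!: exI[of _ "m1 * m2\<^sup>2"])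
      (simp add: GWS)
qed

lemma GDERIV_line:
  assumes "\<And>y. GDERIV f y :> D y"
  shows "((\<lambda>t. f (x + t *\<^sub>R d)) has_real_derivative (D (x + t *\<^sub>R d) \<bullet> d)) (at t)"
proof -
  have 1: "((\<lambda>t. x + t *\<^sub>R d) has_derivative (\<lambda>s. s *\<^sub>R d)) (at t)"
    by (auto intro!: derivative_eq_intros)
  have "((\<lambda>t. f (x + t *\<^sub>R d)) has_derivative (\<lambda>s. (s *\<^sub>R d) \<bullet> D (x + t *\<^sub>R d))) (at t)"
    by (rule has_derivative_compose[OF 1 assms[unfolded gderiv_def]])
  then show ?thesis unfolding has_field_derivative_def
    by (rule has_derivative_eq_rhs) (simp add: fun_eq_iff inner_commute)
qed

lemma GDERIV_quotient_right:
  assumes "\<And>y. GDERIV f y :> D y"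
  shows "((\<lambda>t. (f (t *\<^sub>R y + (1 - t) *\<^sub>R p) - f p) / t) \<longlongrightarrow> D p \<bullet> (y - p)) (at_right 0)"
proof -
  have "((\<lambda>t. f (p + t *\<^sub>R (y - p))) has_real_derivative (D p \<bullet> (y - p))) (at 0)"
    using GDERIV_line[OF assms, where x = p and d = "y - p" and t = 0] by simp
  then have "((\<lambda>t. (f (p + t *\<^sub>R (y - p)) - f p) / t) \<longlongrightarrow> D p \<bullet> (y - p)) (at 0)"
    by (simp add: DERIV_def)
  then have "((\<lambda>t. (f (p + t *\<^sub>R (y - p)) - f p) / t) \<longlongrightarrow> D p \<bullet> (y - p)) (at_right 0)"
    by (rule tendsto_within_subset) simp
  moreover have "p + t *\<^sub>R (y - p) = t *\<^sub>R y + (1 - t) *\<^sub>R p" for t by (simp add: algebra_simps)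
  ultimately show ?thesis by simp
qed

lemma convex_fun_real:
  assumes "convex_on UNIV f"
  shows "convex_fun (\<lambda>y. ereal (f y))"
  unfolding convex_fun_def
proof (intro allI ballI)
  fix x y :: 'a and t :: real assume "t \<in> {0<..<1}"
  then have "f (t *\<^sub>R x + (1 - t) *\<^sub>R y) \<le> t * f x + (1 - t) * f y"
    using convex_onD[OF assms, of "1 - t" x y] by (simp add: algebra_simps)
  then show "ereal (f (t *\<^sub>R x + (1 - t) *\<^sub>R y)) \<le> ereal t * ereal (f x) + ereal (1 - t) * ereal (f y)" by simp
qed

text \<open>The first-order condition is applied to \<open>f\<close> with smooth part
  \<open>- f\<close>: their sum vanishes, so every point is a minimizer.\<close>

lemma gradient_in_subdiff:
  assumes cv: "convex_on UNIV f" and D: "\<And>y. GDERIV f y :> D y"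
  shows "D p \<in> subdiff (\<lambda>y. ereal (f y)) p"
proof -
  have "ereal (f p) + ereal (- (- (D p \<bullet> (y - p)))) \<le> ereal (f y)" for y
  proof (rule convex_smooth_minimizer[OF convex_fun_real[OF cv], where q = "\<lambda>y. - f y"])
    have "((\<lambda>t. - ((f (t *\<^sub>R y + (1 - t) *\<^sub>R p) - f p) / t)) \<longlongrightarrow> - (D p \<bullet> (y - p))) (at_right 0)"
      by (intro tendsto_minus GDERIV_quotient_right D)
    then show "((\<lambda>t. (- f (t *\<^sub>R y + (1 - t) *\<^sub>R p) - - f p) / t) \<longlongrightarrow> - (D p \<bullet> (y - p))) (at_right 0)"
      by (simp add: diff_divide_distrib)
  qed auto
  then show ?thesis by (simp add: subdiff_def)
qed

text \<open>The Lipschitz bound gives a quadratic upper model of \<open>f\<close> at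
  \<open>y\<close>, convexity the tangent at \<open>x\<close> as a lower bound. Comparing the two at
  the best point sharpens the tangent inequality by half the wanted term; adding the version with
  \<open>x\<close> and \<open>y\<close> exchanged gives the rest.\<close>

lemma Baillon_Haddad:
  fixes f :: "'a::{real_inner, complete_space} \<Rightarrow> real" and L Li :: "'a \<Rightarrow>\<^sub>L 'a"
  assumes cv: "convex_on UNIV f" and D: "\<And>y. GDERIV f y :> D y"
    and L: "pos_op_on UNIV L" and Li: "\<And>x. L (Li x) = x"
    and lip: "\<And>y y'. norm_wrt L (Li (D y) - Li (D y')) \<le> norm_wrt L (y - y')"
  shows "Li (D x - D y) \<bullet> (D x - D y) \<le> (D x - D y) \<bullet> (x - y)"
proof -
  have descent: "f (x + d) \<le> f x + D x \<bullet> d + 1/2 * (L d \<bullet> d)" for x d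
  proof -
    define \<phi> where "\<phi> t = f (x + t *\<^sub>R d) - t * (D x \<bullet> d) - 1/2 * t\<^sup>2 * (L d \<bullet> d)" for t
    have "\<phi> 1 \<le> \<phi> 0"
    proof (rule DERIV_nonpos_imp_nonincreasing[OF zero_le_one])
      fix t :: real assume t: "0 \<le> t" "t \<le> 1"
      define \<Delta> where "\<Delta> = D (x + t *\<^sub>R d) - D x"
      have "(\<phi> has_real_derivative \<Delta> \<bullet> d - t * (L d \<bullet> d)) (at t)"
        unfolding \<phi>_def \<Delta>_def
        by (rule derivative_eq_intros GDERIV_line[OF D] refl)+ (simp add: inner_diff_left)
      moreover have "\<Delta> \<bullet> d \<le> t * (L d \<bullet> d)"
      proof -
        have "\<Delta> \<bullet> d = L (Li \<Delta>) \<bullet> d" by (simp add: Li)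
        also have "\<dots> \<le> norm_wrt L (Li \<Delta>) * norm_wrt L d" using pos_op_Cauchy_Schwarz[OF L, of "Li \<Delta>" d] by linarith
        also have "\<dots> \<le> norm_wrt L (t *\<^sub>R d) * norm_wrt L d"
          using lip[of "x + t *\<^sub>R d" x] by (intro mult_right_mono norm_wrt_nonneg[OF L]) (simp add: \<Delta>_def blinfun.diff_right)
        also have "\<dots> = t * (L d \<bullet> d)"
          using t by (simp add: norm_wrt_scaleR[OF L] mult.assoc power2_eq_square[symmetric] norm_wrt_power2[OF L])
        finally show ?thesis .
      qed
      ultimately show "\<exists>y. DERIV \<phi> t :> y \<and> y \<le> 0" by (intro exI[of _ "\<Delta> \<bullet> d - t * (L d \<bullet> d)"]) simp
    qed
    then show ?thesis by (simp add: \<phi>_def)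
  qed
  have tangent: "f x + D x \<bullet> (y - x) \<le> f y" for x y
    using gradient_in_subdiff[OF cv D, of x] by (simp add: subdiff_def)
  have key: "f x + D x \<bullet> (y - x) + 1/2 * (Li (D y - D x) \<bullet> (D y - D x)) \<le> f y" for x y
  proof -
    define \<Delta> where "\<Delta> = D y - D x"
    \<comment> \<open>\<open>y - Li \<Delta>\<close> minimizes the upper model at \<open>y\<close>
      minus the tangent at \<open>x\<close>.\<close>
    have "f x + D x \<bullet> ((y + - Li \<Delta>) - x) \<le> f (y + - Li \<Delta>)" by (rule tangent)
    also have "\<dots> \<le> f y + D y \<bullet> (- Li \<Delta>) + 1/2 * (L (- Li \<Delta>) \<bullet> (- Li \<Delta>))" by (rule descent)
    finally have "f x + D x \<bullet> (y - x) + \<Delta> \<bullet> Li \<Delta> \<le> f y + 1/2 * (\<Delta> \<bullet> Li \<Delta>)"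
      by (simp add: blinfun.minus_right Li inner_diff_right \<Delta>_def inner_diff_left)
    then show ?thesis unfolding \<Delta>_def[symmetric] by (simp add: inner_commute)
  qed
  have "Li (D y - D x) \<bullet> (D y - D x) = Li (D x - D y) \<bullet> (D x - D y)"
    by (simp add: blinfun.diff_right inner_diff_left inner_diff_right)
  moreover have "(D x - D y) \<bullet> (x - y) = - (D x \<bullet> (y - x)) - D y \<bullet> (x - y)"
    by (simp add: inner_diff_left inner_diff_right)
  ultimately show ?thesis using key[of x y] key[of y x] by linarith
qed

section \<open>Subgradients of sums; real sequences\<close>

lemma gradient_unique_subdiff:
  assumes D: "\<And>y. GDERIV f y :> D y" and u: "u \<in> subdiff (\<lambda>y. ereal (f y)) p"
  shows "u = D p"
proof -
  have le: "u \<bullet> d \<le> D p \<bullet> d" for d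
  proof (rule tendsto_lowerbound)
    show "((\<lambda>t. (f (t *\<^sub>R (p + d) + (1 - t) *\<^sub>R p) - f p) / t) \<longlongrightarrow> D p \<bullet> d) (at_right 0)"
      using GDERIV_quotient_right[OF D, of "p + d" p] by simp
    have "u \<bullet> d \<le> (f (t *\<^sub>R (p + d) + (1 - t) *\<^sub>R p) - f p) / t" if "t > 0" for t
    proof -
      have "t *\<^sub>R (p + d) + (1 - t) *\<^sub>R p = p + t *\<^sub>R d" by (simp add: algebra_simps)
      moreover have "f p + u \<bullet> (p + t *\<^sub>R d - p) \<le> f (p + t *\<^sub>R d)"
        using u unfolding subdiff_def by (auto dest: spec[of _ "p + t *\<^sub>R d"])
      ultimately show ?thesis using that by (simp add: field_simps)
    qed
    then show "\<forall>\<^sub>F t in at_right 0. u \<bullet> d \<le> (f (t *\<^sub>R (p + d) + (1 - t) *\<^sub>R p) - f p) / t"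
      by (intro eventually_mono[OF eventually_at_right_less[of "0::real"]]) auto
  qed simp
  have "(u - D p) \<bullet> (u - D p) \<le> 0" using le[of "u - D p"] by (simp add: inner_diff_left)
  then show ?thesis by (metis eq_iff_diff_eq_0 inner_ge_zero inner_eq_zero_iff order_antisym)
qed

lemma sum_ereal_not_MInf: "(\<And>i. i \<in> I \<Longrightarrow> (f i :: ereal) \<noteq> -\<infinity>) \<Longrightarrow> (\<Sum>i\<in>I. f i) \<noteq> -\<infinity>"
  by (induction I rule: infinite_finite_induct) auto

lemma convex_lsc_sum:
  fixes g :: "'i \<Rightarrow> 'a::real_inner \<Rightarrow> ereal"
  assumes "finite I" "\<And>i. i \<in> I \<Longrightarrow> convex_fun (g i) \<and> proper_fun (g i) \<and> lsc_fun (g i)"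
  shows "convex_fun (\<lambda>y. \<Sum>i\<in>I. g i y) \<and> lsc_fun (\<lambda>y. \<Sum>i\<in>I. g i y)"
  using assms
proof (induction I rule: finite_induct)
  case empty
  have "lsc_fun (\<lambda>y::'a. ereal 0)" by (intro lsc_fun_continuous continuous_intros)
  then show ?case by (simp add: convex_fun_def zero_ereal_def)
next
  case (insert j I)
  have 1: "g j y \<noteq> -\<infinity>" "(\<Sum>i\<in>I. g i y) \<noteq> -\<infinity>" for y
    using insert.prems by (auto simp: proper_fun_def intro!: sum_ereal_not_MInf)
  show ?case using insert 1 by (auto intro!: convex_fun_add lsc_fun_add)
qed

text \<open>Peel off the last function: the domain of the sum of the earlier ones is the
  intersection of their domains, so the condition for index \<open>Suc n\<close> is the one that the
  two-function rule asks for.\<close>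

lemma subdiff_sum_split:
  fixes g :: "nat \<Rightarrow> 'a::{real_inner, complete_space} \<Rightarrow> ereal"
  assumes "\<And>i. i \<in> {1..n} \<Longrightarrow> convex_fun (g i) \<and> proper_fun (g i) \<and> lsc_fun (g i)"
    and "\<And>i. i \<in> {1..n} \<Longrightarrow> 0 \<in> sri (minkowski_diff (effdom (g i)) (\<Inter>j\<in>{1..<i}. effdom (g j)))"
    and "w \<in> subdiff (\<lambda>y. \<Sum>i=1..n. g i y) x"
  shows "\<exists>u. (\<forall>i\<in>{1..n}. u i \<in> subdiff (g i) x) \<and> w = (\<Sum>i=1..n. u i)"
  using assms
proof (induction n arbitrary: w)
  case 0
  then have "w \<bullet> w \<le> 0" by (auto simp: subdiff_def zero_ereal_def dest: spec[of _ "x + w"])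
  then have "w = 0" by (metis inner_ge_zero inner_eq_zero_iff order_antisym)
  then show ?case by simp
next
  case (Suc n)
  define s where "s y = (\<Sum>i=1..n. g i y)" for y
  have ng: "g i y \<noteq> -\<infinity>" if "i \<in> {1..Suc n}" for i y using Suc.prems(1)[OF that] by (auto simp: proper_fun_def)
  have ns: "s y \<noteq> -\<infinity>" for y unfolding s_def by (intro sum_ereal_not_MInf ng) auto
  have w: "w \<in> subdiff (\<lambda>y. s y + g (Suc n) y) x" using Suc.prems(3) by (simp add: s_def)
  then have "s x < \<infinity>" using ns[of x] ng[of "Suc n" x] by (cases "s x"; cases "g (Suc n) x") (auto simp: subdiff_def)
  then have "proper_fun s" using ns by (auto simp: proper_fun_def effdom_def)
  moreover have "convex_fun s" "lsc_fun s"
    using convex_lsc_sum[of "{1..n}" g] Suc.prems(1) by (simp_all add: s_def[abs_def])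
  moreover have "effdom s = (\<Inter>j\<in>{1..<Suc n}. effdom (g j))"
  proof -
    have "s y < \<infinity> \<longleftrightarrow> (\<forall>j\<in>{1..<Suc n}. g j y < \<infinity>)" for y
      by (auto simp: s_def sum_Pinfty less_top atLeastLessThanSuc_atLeastAtMost top_ereal_def)
    then show ?thesis by (auto simp: effdom_def)
  qed
  then have "0 \<in> sri (minkowski_diff (effdom (g (Suc n))) (effdom s))" using Suc.prems(2)[of "Suc n"] by simp
  ultimately obtain q where q: "w - q \<in> subdiff s x" "q \<in> subdiff (g (Suc n)) x"
    using Attouch_Brezis[of s "g (Suc n)" w x] w Suc.prems(1)[of "Suc n"] by auto
  obtain u where u: "\<forall>i\<in>{1..n}. u i \<in> subdiff (g i) x" "w - q = (\<Sum>i=1..n. u i)"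
    using Suc.IH[of "w - q"] Suc.prems q(1) unfolding s_def by auto
  have "w = (\<Sum>i=1..Suc n. (u(Suc n := q)) i)" using u(2) by (simp add: algebra_simps)
  moreover have "\<forall>i\<in>{1..Suc n}. (u(Suc n := q)) i \<in> subdiff (g i) x" using u(1) q(2) by (auto simp: le_Suc_eq)
  ultimately show ?case by blast
qed

lemma uniformly_convex_strong_convergence:
  assumes uc: "uniformly_convex_fun G" and u: "u \<in> subdiff G p" and U: "\<And>k. U k \<in> subdiff G (P k)"
    and gap: "((\<lambda>k. (U k - u) \<bullet> (P k - p)) \<longlongrightarrow> 0) F"
  shows "(P \<longlongrightarrow> p) F"
proof -
  obtain \<phi> :: "real \<Rightarrow> ereal" where \<phi>: "mono_on {0..} \<phi>" "\<And>s. s \<ge> 0 \<Longrightarrow> 0 \<le> \<phi> s \<and> (\<phi> s = 0 \<longleftrightarrow> s = 0)"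
    and ineq: "\<And>x y t. x \<in> effdom G \<Longrightarrow> y \<in> effdom G \<Longrightarrow> t \<in> {0<..<1} \<Longrightarrow>
      G (t *\<^sub>R x + (1 - t) *\<^sub>R y) + ereal (t * (1 - t)) * \<phi> (norm (x - y)) \<le> ereal t * G x + ereal (1 - t) * G y"
    using uc unfolding uniformly_convex_fun_def by blast
  have le: "\<phi> (norm (P k - p)) \<le> ereal ((U k - u) \<bullet> (P k - p))" for k
  proof -
    obtain a b where ab: "G (P k) = ereal a" "G p = ereal b"
      using u U[of k] unfolding subdiff_def by (cases "G (P k)"; cases "G p") auto
    define m where "m = (1/2) *\<^sub>R P k + (1 - 1/2) *\<^sub>R p"
    have md: "m - P k = (1/2) *\<^sub>R (p - P k)" "m - p = (1/2) *\<^sub>R (P k - p)"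
    proof -
      have "m + m = P k + p" by (simp add: m_def scaleR_add_right[symmetric] scaleR_half_double)
      then show "m - P k = (1/2) *\<^sub>R (p - P k)" "m - p = (1/2) *\<^sub>R (P k - p)"
        by (simp_all add: m_def algebra_simps) (simp_all add: scaleR_add_left[symmetric] scaleR_left_diff_distrib[symmetric])
    qed
    have 1: "G m + ereal (1/2 * (1 - 1/2)) * \<phi> (norm (P k - p)) \<le> ereal (1/2) * G (P k) + ereal (1 - 1/2) * G p"
      unfolding m_def by (rule ineq) (auto simp: effdom_def ab)
    have 2: "ereal a + ereal (U k \<bullet> (m - P k)) \<le> G m" "ereal b + ereal (u \<bullet> (m - p)) \<le> G m"
      using u U[of k] ab unfolding subdiff_def by auto
    have ph: "0 \<le> \<phi> (norm (P k - p))" using \<phi>(2) by simp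
    show ?thesis
    proof (cases "G m")
      case (real c)
      then obtain r where r: "\<phi> (norm (P k - p)) = ereal r"
        using 1 ab ph by (cases "\<phi> (norm (P k - p))") auto
      have "c + 1/4 * r \<le> 1/2 * a + 1/2 * b" using 1 ab real r by simp
      moreover have "a + 1/2 * (U k \<bullet> (p - P k)) \<le> c" "b + 1/2 * (u \<bullet> (P k - p)) \<le> c"
        using 2 real unfolding md by simp_all
      ultimately have "r \<le> - (U k \<bullet> (p - P k)) - u \<bullet> (P k - p)" by linarith
      then show ?thesis using r by (simp add: inner_diff_left inner_diff_right)
    next
      case PInf
      then show ?thesis using 1 ab ph by (cases "\<phi> (norm (P k - p))") auto
    next
      case MInf then show ?thesis using 2 by simp
    qed
  qed
  show ?thesis
  proof (rule tendstoI)
    fix e :: real assume e: "e > 0"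
    have "0 < \<phi> e" using \<phi>(2)[of e] e by (simp add: less_le)
    then obtain r where r: "0 < ereal r" "ereal r < \<phi> e" using ereal_dense2 by blast
    have "\<forall>\<^sub>F k in F. (U k - u) \<bullet> (P k - p) < r" using gap r by (intro order_tendstoD(2)[OF gap]) auto
    then show "\<forall>\<^sub>F k in F. dist (P k) p < e"
    proof eventually_elim
      case (elim k)
      show ?case
      proof (rule ccontr)
        assume "\<not> ?thesis"
        then have "\<phi> e \<le> \<phi> (norm (P k - p))" using e by (intro mono_onD[OF \<phi>(1)]) (auto simp: dist_norm)
        also have "\<dots> \<le> ereal ((U k - u) \<bullet> (P k - p))" by (rule le)
        also have "\<dots> < ereal r" using elim by simp
        finally show False using r by simp
      qed
    qed
  qed
qed

text \<open>Adding the remaining tail of the error series makes the sequence nonincreasing.\<close>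

lemma quasi_Fejer_convergent:
  fixes a r :: "nat \<Rightarrow> real"
  assumes "\<And>k. 0 \<le> a k" "\<And>k. 0 \<le> r k" "summable r" "\<And>k. a (Suc k) \<le> a k + r k"
  shows "convergent a"
proof -
  define b where "b k = a k + (suminf r - (\<Sum>j<k. r j))" for k
  have "decseq b" unfolding decseq_Suc_iff b_def
  proof
    fix k show "a (Suc k) + (suminf r - (\<Sum>j<Suc k. r j)) \<le> a k + (suminf r - (\<Sum>j<k. r j))"
      using assms(4)[of k] by simp
  qed
  moreover have "0 \<le> b k" for k
    using assms(1)[of k] sum_le_suminf[OF assms(3), of "{..<k}"] assms(2) by (simp add: b_def)
  ultimately obtain l where l: "b \<longlonglongrightarrow> l" using decseq_convergent by blast
  have "(\<lambda>k. b k - (suminf r - (\<Sum>j<k. r j))) \<longlonglongrightarrow> l - (suminf r - suminf r)"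
    by (intro tendsto_diff l tendsto_const summable_LIMSEQ assms)
  then show ?thesis unfolding b_def convergent_def by auto
qed

text \<open>Here \<open>a\<close> is the distance to a fixed point, \<open>t\<close> the distance
  after the exact relaxed step, \<open>e\<close> the size of the residual and \<open>r\<close> that
  of the error. The squares telescope, so the weighted sum of the \<open>(e k)\<^sup>2\<close> is
  bounded. As the weights have infinite sum and \<open>e\<close> converges, its limit can only be
  0.\<close>

lemma Krasnoselskii_Mann_real:
  fixes a t e r \<rho> :: "nat \<Rightarrow> real"
  assumes nonneg: "\<And>k. 0 \<le> a k" "\<And>k. 0 \<le> t k" "\<And>k. 0 \<le> e k" "\<And>k. 0 \<le> r k" and r: "summable r"
    and \<rho>: "\<And>k. \<rho> k \<in> {0<..<\<delta>}" and C: "C \<ge> 0"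
    and div: "filterlim (\<lambda>N. \<Sum>k<N. \<rho> k * (\<delta> - \<rho> k)) at_top sequentially"
    and t: "\<And>k. (t k)\<^sup>2 \<le> (a k)\<^sup>2 - \<rho> k * (\<delta> - \<rho> k) * (e k)\<^sup>2"
    and a: "\<And>k. a (Suc k) \<le> t k + r k" and e: "\<And>k. e (Suc k) \<le> e k + C * r k"
  shows "convergent a" "e \<longlonglongrightarrow> 0"
proof -
  have w: "0 \<le> \<rho> k * (\<delta> - \<rho> k)" for k using \<rho>[of k] by simp
  have ta: "t k \<le> a k" for k
  proof (rule power2_le_imp_le)
    show "(t k)\<^sup>2 \<le> (a k)\<^sup>2" using t[of k] mult_nonneg_nonneg[OF w[of k] zero_le_power2[of "e k"]] by linarith
  qed (rule nonneg)
  then have a1: "a (Suc k) \<le> a k + r k" for k using a[of k] by (meson add_right_mono order_trans)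
  show conv: "convergent a" by (rule quasi_Fejer_convergent[OF nonneg(1,4) r a1])
  then obtain A where A: "\<And>k. a k \<le> A" using nonneg(1)
    by (metis convergent_imp_Bseq Bseq_def abs_le_D1 real_norm_def)
  obtain B where B: "\<And>k. r k \<le> B" using convergent_imp_Bseq[OF convergentI[OF summable_LIMSEQ_zero[OF r]]]
    by (metis Bseq_def abs_le_D1 real_norm_def)
  have "convergent e"
    by (rule quasi_Fejer_convergent[where r = "\<lambda>k. C * r k", OF nonneg(3) _ _ e]) (use C nonneg r summable_mult in auto)
  then obtain l where l: "e \<longlonglongrightarrow> l" by (auto simp: convergent_def)
  have "l \<ge> 0" by (rule LIMSEQ_le_const[OF l]) (use nonneg in auto)
  have step: "\<rho> k * (\<delta> - \<rho> k) * (e k)\<^sup>2 \<le> (a k)\<^sup>2 - (a (Suc k))\<^sup>2 + (2 * A + B) * r k" for k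
  proof -
    have "(a (Suc k))\<^sup>2 \<le> (t k + r k)\<^sup>2" using a[of k] nonneg(1) by (intro power_mono) auto
    also have "\<dots> = (t k)\<^sup>2 + (2 * t k + r k) * r k" by (simp add: power2_eq_square algebra_simps)
    also have "(2 * t k + r k) * r k \<le> (2 * A + B) * r k"
      using ta[of k] A[of k] B[of k] nonneg(4) by (intro mult_right_mono) auto
    finally show ?thesis using t[of k] by linarith
  qed
  have bound: "(\<Sum>k<N. \<rho> k * (\<delta> - \<rho> k) * (e k)\<^sup>2) \<le> (a 0)\<^sup>2 + (2 * A + B) * suminf r" for N
  proof -
    have AB: "0 \<le> 2 * A + B" using A[of 0] B[of 0] nonneg(1)[of 0] nonneg(4)[of 0] by linarith
    have "(\<Sum>k<N. \<rho> k * (\<delta> - \<rho> k) * (e k)\<^sup>2) \<le> (\<Sum>k<N. (a k)\<^sup>2 - (a (Suc k))\<^sup>2 + (2 * A + B) * r k)"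
      by (intro sum_mono step)
    also have "\<dots> = (a 0)\<^sup>2 - (a N)\<^sup>2 + (2 * A + B) * (\<Sum>k<N. r k)"
      using sum_lessThan_telescope'[of "\<lambda>k. (a k)\<^sup>2" N] by (simp add: sum.distrib sum_distrib_left)
    also have "\<dots> \<le> (a 0)\<^sup>2 + (2 * A + B) * suminf r"
    proof -
      have "(2 * A + B) * (\<Sum>k<N. r k) \<le> (2 * A + B) * suminf r"
        using nonneg(4) by (intro mult_left_mono[OF sum_le_suminf[OF r] AB]) auto
      then show ?thesis using zero_le_power2[of "a N"] by linarith
    qed
    finally show ?thesis .
  qed
  have "l = 0"
  proof (rule ccontr)
    assume "l \<noteq> 0"
    then have l0: "l > 0" using \<open>l \<ge> 0\<close> by simp
    then obtain N where N: "\<And>k. k \<ge> N \<Longrightarrow> l / 2 < e k"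
      using order_tendstoD(1)[OF l, of "l/2"] by (auto simp: eventually_sequentially)
    define K where "K = (\<Sum>k<N. \<rho> k * (\<delta> - \<rho> k)) + ((a 0)\<^sup>2 + (2 * A + B) * suminf r) / (l/2)\<^sup>2"
    have "(\<Sum>k<n. \<rho> k * (\<delta> - \<rho> k)) \<le> K" if "n \<ge> N" for n
    proof -
      have "(l/2)\<^sup>2 * (\<Sum>k\<in>{N..<n}. \<rho> k * (\<delta> - \<rho> k)) \<le> (\<Sum>k\<in>{N..<n}. \<rho> k * (\<delta> - \<rho> k) * (e k)\<^sup>2)"
        unfolding sum_distrib_left
      proof (rule sum_mono)
        fix k assume "k \<in> {N..<n}"
        then have "(l/2)\<^sup>2 \<le> (e k)\<^sup>2" using N[of k] l0 by (intro power_mono) auto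
        then show "(l/2)\<^sup>2 * (\<rho> k * (\<delta> - \<rho> k)) \<le> \<rho> k * (\<delta> - \<rho> k) * (e k)\<^sup>2"
          using w[of k] by (metis mult.commute mult_left_mono)
      qed
      also have "\<dots> \<le> (\<Sum>k<n. \<rho> k * (\<delta> - \<rho> k) * (e k)\<^sup>2)"
        by (rule sum_mono2) (use w in auto)
      also have "\<dots> \<le> (a 0)\<^sup>2 + (2 * A + B) * suminf r" by (rule bound)
      finally have "(\<Sum>k\<in>{N..<n}. \<rho> k * (\<delta> - \<rho> k)) \<le> ((a 0)\<^sup>2 + (2 * A + B) * suminf r) / (l/2)\<^sup>2"
        using l0 by (simp add: pos_le_divide_eq mult.commute)
      moreover have "(\<Sum>k<n. \<rho> k * (\<delta> - \<rho> k)) = (\<Sum>k<N. \<rho> k * (\<delta> - \<rho> k)) + (\<Sum>k\<in>{N..<n}. \<rho> k * (\<delta> - \<rho> k))"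
        using that by (metis sum.atLeastLessThan_concat lessThan_atLeast0 zero_le)
      ultimately show ?thesis by (simp add: K_def)
    qed
    moreover have "\<forall>\<^sub>F n in sequentially. K < (\<Sum>k<n. \<rho> k * (\<delta> - \<rho> k))"
      using div unfolding filterlim_at_top_dense by blast
    ultimately show False unfolding eventually_sequentially by (meson linorder_not_less max.cobounded1 max.cobounded2)
  qed
  then show "e \<longlonglongrightarrow> 0" using l by simp
qed

section \<open>The splitting operator\<close>

text \<open>\<open>G\<close> is the inverse of \<open>\<Gamma>\<close>, and \<open>L\<close>
  survives only in the constants: \<open>\<kappa>\<close> measures cocoercivity relative to
  \<open>\<Gamma>\<close>, while \<open>\<beta>\<close> is a Lipschitz constant in the original norm
  that serves boundedness and error estimates.\<close>

locale preconditioned_splitting =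
  fixes I :: "nat set" and H :: "nat \<Rightarrow> 'a::{real_inner, complete_space} set"
    and W :: "nat \<Rightarrow> 'a \<Rightarrow>\<^sub>L 'a" and \<Gamma> G :: "'a \<Rightarrow>\<^sub>L 'a"
    and g :: "nat \<Rightarrow> 'a \<Rightarrow> ereal" and h :: "'a \<Rightarrow> ereal" and f :: "'a \<Rightarrow> real" and D :: "'a \<Rightarrow> 'a"
    and \<kappa> \<beta> :: real
  assumes I: "finite I"
    and H: "\<And>i. i \<in> I \<Longrightarrow> subspace (H i)" "\<And>i. i \<in> I \<Longrightarrow> closed (H i)"
    and G\<Gamma>: "\<And>x. G (\<Gamma> x) = x" "\<And>x. \<Gamma> (G x) = x"
    and \<Gamma>_spos: "spos_op_on UNIV \<Gamma>" and G_spos: "spos_op_on UNIV G"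
    and \<Gamma>_H: "\<And>i x. i \<in> I \<Longrightarrow> x \<in> H i \<Longrightarrow> \<Gamma> x \<in> H i"
    and W_pos: "\<And>i. i \<in> I \<Longrightarrow> pos_op_on UNIV (W i)" and W_spos: "\<And>i. i \<in> I \<Longrightarrow> spos_op_on (H i) (W i)"
    and W_ker: "\<And>i. i \<in> I \<Longrightarrow> {v. W i v = 0} = (H i)\<^sup>\<bottom>"
    and W_sum: "\<And>x. (\<Sum>i\<in>I. W i x) = x"
    and GW: "\<And>i x. i \<in> I \<Longrightarrow> G (W i x) = W i (G x)"
    and g: "\<And>i. i \<in> I \<Longrightarrow> convex_fun (g i)" "\<And>i. i \<in> I \<Longrightarrow> proper_fun (g i)" "\<And>i. i \<in> I \<Longrightarrow> lsc_fun (g i)"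
    and g_proj: "\<And>i y. i \<in> I \<Longrightarrow> g i (orth_proj (H i) y) = g i y"
    and h: "convex_fun h" "proper_fun h" "lsc_fun h"
    and f: "convex_on UNIV f" and D: "\<And>y. GDERIV f y :> D y"
    and \<kappa>: "0 \<le> \<kappa>" "\<kappa> < 2"
    and cocoercive: "\<And>x y. \<Gamma> (D x - D y) \<bullet> (D x - D y) \<le> \<kappa> * ((D x - D y) \<bullet> (x - y))"
    and \<beta>: "0 \<le> \<beta>" "\<And>x y. norm (D x - D y) \<le> \<beta> * norm (x - y)"
begin

abbreviation P where "P i \<equiv> orth_proj (H i)"

definition M :: "nat \<Rightarrow> 'a \<Rightarrow> 'a" where "M i = blinfun_apply (G o\<^sub>L W i)"

lemma M_simps: "M i (x + y) = M i x + M i y" "M i (x - y) = M i x - M i y" "M i (c *\<^sub>R x) = c *\<^sub>R M i x" "M i 0 = 0"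
  unfolding M_def by (simp_all add: blinfun.bilinear_simps)

lemma M_eq: "M i x = G (W i x)"
  by (simp add: M_def)

lemma M_bounded_linear: "bounded_linear (M i)"
  unfolding M_def by (rule blinfun.bounded_linear_right)

context
  fixes i assumes i: "i \<in> I"
begin

lemmas Hi = H[OF i]

lemmas product_spos = product_spos_on[OF Hi G_spos W_pos[OF i] W_spos[OF i] W_ker[OF i] GW[OF i]]

lemma M_pos: "pos_op_on UNIV (G o\<^sub>L W i)" and M_spos: "spos_op_on (H i) (G o\<^sub>L W i)"
  and W_in: "W i x \<in> H i" and W_P: "W i (P i x) = W i x"
  using product_spos by blast+

lemma M_in: "M i x \<in> H i" and M_P: "M i (P i x) = M i x"
  using product_spos by (simp_all add: M_eq)

lemma M_sym: "M i x \<bullet> y = x \<bullet> M i y"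
  using M_pos by (auto simp: pos_op_on_def M_def)

lemma in_H_inner_P: "u \<in> H i \<Longrightarrow> u \<bullet> P i y = u \<bullet> y"
  using orth_proj_orth[OF Hi] by (metis inner_commute)

lemma M_\<Gamma>: "M i (\<Gamma> x) = W i x"
  by (simp add: M_eq GW[OF i] G\<Gamma>)

lemma W_sym: "W i x \<bullet> y = x \<bullet> W i y"
  using W_pos[OF i] by (auto simp: pos_op_on_def)

lemma P_in: "P i x \<in> H i"
  by (rule orth_proj_in[OF Hi])

lemma g_ninf: "g i y \<noteq> -\<infinity>"
  using g(2)[OF i] by (auto simp: proper_fun_def)

end

definition T :: "nat \<Rightarrow> 'a \<Rightarrow> 'a" where "T i y = prox_on (H i) (M i) (g i) y"

definition X :: "(nat \<Rightarrow> 'a) \<Rightarrow> 'a" where "X z = prox_on UNIV G h (\<Sum>i\<in>I. W i (z i))"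

definition p :: "(nat \<Rightarrow> 'a) \<Rightarrow> nat \<Rightarrow> 'a" where
  "p z i = T i (2 *\<^sub>R P i (X z) - z i - \<Gamma> (P i (D (X z))))"

text \<open>The proximity operator only sees \<open>H i\<close>. Because \<open>g i\<close> factors
  through the projection and \<open>M i\<close> takes values in \<open>H i\<close>, its variational
  inequality extends to all test points of the space.\<close>

lemma T_subgradient:
  assumes i: "i \<in> I" and y: "y \<in> H i"
  shows "T i y \<in> H i" "M i (y - T i y) \<in> subdiff (g i) (T i y)"
proof -
  obtain m where m: "m > 0" "\<And>\<xi>. \<xi> \<in> H i \<Longrightarrow> m * (norm \<xi>)\<^sup>2 \<le> \<xi> \<bullet> M i \<xi>"
    using M_spos[OF i] by (auto simp: spos_op_on_def inner_commute M_def)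
  obtain y0 where "g i y0 < \<infinity>" using g(2)[OF i] by (auto simp: proper_fun_def effdom_def)
  then have y0: "P i y0 \<in> H i" "g i (P i y0) < \<infinity>" using P_in[OF i] g_proj[OF i] by auto
  note pp = prox_on_subgradient[OF H[OF i] M_bounded_linear M_sym[OF i] m(1) m(2) g[OF i] y0 y, folded T_def]
  show 1: "T i y \<in> H i" by (rule pp(1))
  have "g i (T i y) + ereal (M i (y - T i y) \<bullet> (\<eta> - T i y)) \<le> g i \<eta>" for \<eta>
  proof -
    have "g i (T i y) + ereal (M i (y - T i y) \<bullet> (P i \<eta> - T i y)) \<le> g i (P i \<eta>)"
      using pp(3)[OF _ P_in[OF i]] by blast
    then show ?thesis by (simp add: g_proj[OF i] inner_diff_right in_H_inner_P[OF i M_in[OF i]])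
  qed
  then show "M i (y - T i y) \<in> subdiff (g i) (T i y)" using pp(2) by (simp add: subdiff_def)
qed

lemma T_Lipschitz:
  assumes i: "i \<in> I"
  shows "\<exists>K\<ge>0. \<forall>y\<in>H i. \<forall>y'\<in>H i. norm (T i y - T i y') \<le> K * norm (y - y')"
proof -
  obtain m where m: "m > 0" "\<And>\<xi>. \<xi> \<in> H i \<Longrightarrow> m * (norm \<xi>)\<^sup>2 \<le> \<xi> \<bullet> M i \<xi>"
    using M_spos[OF i] by (auto simp: spos_op_on_def inner_commute M_def)
  have "norm (T i y - T i y') \<le> norm (G o\<^sub>L W i) / m * norm (y - y')" if yy: "y \<in> H i" "y' \<in> H i" for y y'
  proof -
    define d where "d = T i y - T i y'"
    have "0 \<le> (M i (y - T i y) - M i (y' - T i y')) \<bullet> d"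
      unfolding d_def by (rule subdiff_monotone[OF T_subgradient(2)[OF i yy(1)] T_subgradient(2)[OF i yy(2)]])
    then have "d \<bullet> M i d \<le> M i (y - y') \<bullet> d"
      by (simp add: d_def M_simps inner_diff_left inner_diff_right inner_commute)
    moreover have "m * (norm d)\<^sup>2 \<le> d \<bullet> M i d"
      using m(2)[of d] T_subgradient(1)[OF i] yy H[OF i] by (simp add: d_def subspace_diff)
    moreover have "M i (y - y') \<bullet> d \<le> norm (G o\<^sub>L W i) * norm (y - y') * norm d"
      unfolding M_def by (rule order_trans[OF norm_cauchy_schwarz]) (intro mult_right_mono norm_blinfun norm_ge_zero)
    ultimately have "m * norm d * norm d \<le> norm (G o\<^sub>L W i) * norm (y - y') * norm d"
      by (simp add: power2_eq_square mult.assoc)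
    then have "m * norm d \<le> norm (G o\<^sub>L W i) * norm (y - y')"
      by (cases "d = 0") (auto dest: mult_right_le_imp_le)
    then show ?thesis using m(1) by (simp add: d_def field_simps)
  qed
  then show ?thesis using m(1) by (intro exI[of _ "norm (G o\<^sub>L W i) / m"]) auto
qed

lemma X_subgradient: "G ((\<Sum>i\<in>I. W i (z i)) - X z) \<in> subdiff h (X z)"
proof -
  obtain m where m: "m > 0" "\<And>\<xi>. \<xi> \<in> UNIV \<Longrightarrow> m * (norm \<xi>)\<^sup>2 \<le> \<xi> \<bullet> G \<xi>"
    using G_spos by (auto simp: spos_op_on_def inner_commute)
  have sym: "G u \<bullet> v = u \<bullet> G v" for u v using G_spos by (auto simp: spos_op_on_def pos_op_on_def)
  obtain y0 where y0: "h y0 < \<infinity>" using h(2) by (auto simp: proper_fun_def effdom_def)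
  note pp = prox_on_subgradient[OF subspace_UNIV closed_UNIV blinfun.bounded_linear_right sym m(1) m(2) h UNIV_I y0 UNIV_I,
      where x = "\<Sum>i\<in>I. W i (z i)", folded X_def]
  show ?thesis using pp by (simp add: subdiff_def)
qed

lemma X_Lipschitz: "\<exists>K\<ge>0. \<forall>z z'. norm (X z - X z') \<le> K * norm (\<Sum>i\<in>I. W i (z i - z' i))"
proof -
  obtain m where m: "m > 0" "\<And>\<xi>. m * (norm \<xi>)\<^sup>2 \<le> G \<xi> \<bullet> \<xi>" using G_spos by (auto simp: spos_op_on_def)
  have "norm (X z - X z') \<le> norm G / m * norm (\<Sum>i\<in>I. W i (z i - z' i))" for z z'
  proof -
    define d s where "d = X z - X z'" and "s = (\<Sum>i\<in>I. W i (z i - z' i))"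
    have s: "s = (\<Sum>i\<in>I. W i (z i)) - (\<Sum>i\<in>I. W i (z' i))" by (simp add: s_def blinfun.diff_right sum_subtractf)
    have "0 \<le> (G ((\<Sum>i\<in>I. W i (z i)) - X z) - G ((\<Sum>i\<in>I. W i (z' i)) - X z')) \<bullet> d"
      unfolding d_def by (rule subdiff_monotone[OF X_subgradient X_subgradient])
    then have "G d \<bullet> d \<le> G s \<bullet> d" by (simp add: s d_def blinfun.diff_right inner_diff_left)
    moreover have "m * (norm d)\<^sup>2 \<le> G d \<bullet> d" by (rule m(2))
    moreover have "G s \<bullet> d \<le> norm G * norm s * norm d"
      by (rule order_trans[OF norm_cauchy_schwarz]) (intro mult_right_mono norm_blinfun norm_ge_zero)
    ultimately have "m * norm d * norm d \<le> norm G * norm s * norm d"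
      by (simp add: power2_eq_square mult.assoc)
    then have "m * norm d \<le> norm G * norm s"
      by (cases "d = 0") (auto dest: mult_right_le_imp_le)
    then show ?thesis using m(1) by (simp add: d_def s_def field_simps)
  qed
  then show ?thesis using m(1) by (intro exI[of _ "norm G / m"]) auto
qed

text \<open>A state records a point \<open>z\<close> of the product space with the two resolvent steps taken from it;
  it is a fixed point of the algorithm when \<open>q i = P i x\<close> for all \<open>i\<close>.\<close>

definition subgr :: "(nat \<Rightarrow> 'a) \<Rightarrow> 'a \<Rightarrow> (nat \<Rightarrow> 'a) \<Rightarrow> nat \<Rightarrow> 'a" where
  "subgr z x q i = M i (2 *\<^sub>R x - z i - q i) - W i (D x)"

definition subgr_h :: "(nat \<Rightarrow> 'a) \<Rightarrow> 'a \<Rightarrow> 'a" where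
  "subgr_h z x = G ((\<Sum>i\<in>I. W i (z i)) - x)"

definition state :: "(nat \<Rightarrow> 'a) \<Rightarrow> 'a \<Rightarrow> (nat \<Rightarrow> 'a) \<Rightarrow> bool" where
  "state z x q \<longleftrightarrow> (\<forall>i\<in>I. z i \<in> H i \<and> q i \<in> H i \<and> subgr z x q i \<in> subdiff (g i) (q i)) \<and>
     subgr_h z x \<in> subdiff h x"

lemma state_prox:
  assumes "\<And>i. i \<in> I \<Longrightarrow> z i \<in> H i"
  shows "state z (X z) (p z)"
  unfolding state_def
proof (intro conjI ballI)
  fix i assume i: "i \<in> I"
  define y where "y = 2 *\<^sub>R P i (X z) - z i - \<Gamma> (P i (D (X z)))"
  have y: "y \<in> H i" unfolding y_def
    using H[OF i] assms[OF i] \<Gamma>_H[OF i P_in[OF i]] P_in[OF i] by (intro subspace_diff subspace_scale) auto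
  have py: "p z i = T i y" by (simp add: p_def y_def)
  show "z i \<in> H i" "p z i \<in> H i" using assms i T_subgradient(1)[OF i y] py by auto
  \<comment> \<open>\<open>M i\<close> ignores the projection and turns \<open>\<Gamma>\<close> into
    \<open>W i\<close>, so the subgradient is expressed by \<open>z\<close>, \<open>x\<close>,
    \<open>D x\<close> and \<open>q\<close> without either.\<close>
  have "M i (y - T i y) = subgr z (X z) (p z) i"
    unfolding subgr_def py[symmetric] unfolding y_def by (simp add: M_simps M_P[OF i] M_\<Gamma>[OF i] W_P[OF i])
  then show "subgr z (X z) (p z) i \<in> subdiff (g i) (p z i)" using T_subgradient(2)[OF i y] py by simp
next
  show "subgr_h z (X z) \<in> subdiff h (X z)" unfolding subgr_h_def by (rule X_subgradient)
qed

section \<open>The inner product and norm of the product space\<close>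

definition Q :: "(nat \<Rightarrow> 'a) \<Rightarrow> (nat \<Rightarrow> 'a) \<Rightarrow> real" where
  "Q z z' = (\<Sum>i\<in>I. M i (z i) \<bullet> z' i)"

definition nrm :: "(nat \<Rightarrow> 'a) \<Rightarrow> real" where
  "nrm z = L2_set (\<lambda>i. norm_wrt (G o\<^sub>L W i) (z i)) I"

lemma nrm_nonneg: "0 \<le> nrm z"
  by (simp add: nrm_def)

lemma nrm_power2: "(nrm z)\<^sup>2 = Q z z"
proof -
  have "(nrm z)\<^sup>2 = (\<Sum>i\<in>I. (norm_wrt (G o\<^sub>L W i) (z i))\<^sup>2)"
    by (simp add: nrm_def L2_set_def sum_nonneg)
  also have "\<dots> = Q z z"
    unfolding Q_def by (rule sum.cong) (auto simp: norm_wrt_power2[OF M_pos] M_def)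
  finally show ?thesis .
qed

lemma Q_Cauchy_Schwarz: "\<bar>Q z z'\<bar> \<le> nrm z * nrm z'"
proof -
  have "\<bar>Q z z'\<bar> \<le> (\<Sum>i\<in>I. norm_wrt (G o\<^sub>L W i) (z i) * norm_wrt (G o\<^sub>L W i) (z' i))"
    unfolding Q_def M_def by (rule order_trans[OF sum_abs]) (intro sum_mono pos_op_Cauchy_Schwarz M_pos)
  also have "\<dots> = (\<Sum>i\<in>I. \<bar>norm_wrt (G o\<^sub>L W i) (z i)\<bar> * \<bar>norm_wrt (G o\<^sub>L W i) (z' i)\<bar>)"
    by (rule sum.cong) (auto simp: norm_wrt_nonneg[OF M_pos])
  also have "\<dots> \<le> nrm z * nrm z'" unfolding nrm_def by (rule L2_set_mult_ineq)
  finally show ?thesis .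
qed

lemma nrm_triangle: "nrm (\<lambda>i. z i + z' i) \<le> nrm z + nrm z'"
proof -
  have "nrm (\<lambda>i. z i + z' i) \<le> L2_set (\<lambda>i. norm_wrt (G o\<^sub>L W i) (z i) + norm_wrt (G o\<^sub>L W i) (z' i)) I"
    unfolding nrm_def by (intro L2_set_mono norm_wrt_triangle norm_wrt_nonneg M_pos)
  also have "\<dots> \<le> nrm z + nrm z'" unfolding nrm_def by (rule L2_set_triangle_ineq)
  finally show ?thesis .
qed

lemma Q_sym: "Q z z' = Q z' z"
  unfolding Q_def by (rule sum.cong) (auto simp: M_sym inner_commute[of "z _"])

lemma Q_add_left: "Q (\<lambda>i. z i + w i) z' = Q z z' + Q w z'"
  and Q_diff_left: "Q (\<lambda>i. z i - w i) z' = Q z z' - Q w z'"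
  and Q_scaleR_left: "Q (\<lambda>i. c *\<^sub>R z i) z' = c * Q z z'"
  by (simp_all add: Q_def M_simps inner_add_left inner_diff_left sum.distrib sum_subtractf sum_distrib_left)

lemma Q_add_right: "Q z (\<lambda>i. z' i + w i) = Q z z' + Q z w"
  and Q_diff_right: "Q z (\<lambda>i. z' i - w i) = Q z z' - Q z w"
  and Q_scaleR_right: "Q z (\<lambda>i. c *\<^sub>R z' i) = c * Q z z'"
  by (simp_all add: Q_def inner_add_right inner_diff_right sum.distrib sum_subtractf sum_distrib_left)

lemmas Q_bilinear = Q_add_left Q_diff_left Q_scaleR_left Q_add_right Q_diff_right Q_scaleR_right

lemma nrm_scaleR: "nrm (\<lambda>i. c *\<^sub>R z i) = \<bar>c\<bar> * nrm z"
proof (rule power2_eq_imp_eq)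
  show "(nrm (\<lambda>i. c *\<^sub>R z i))\<^sup>2 = (\<bar>c\<bar> * nrm z)\<^sup>2"
    by (simp add: nrm_power2 Q_bilinear power_mult_distrib) (simp add: power2_eq_square)
qed (simp_all add: nrm_nonneg)

text \<open>Together with \<open>nrm_le\<close>, this makes \<open>nrm\<close> equivalent to the
  original norm on the product of the \<open>H i\<close>.\<close>

lemma nrm_component:
  "\<exists>K\<ge>0. \<forall>z. (\<forall>i\<in>I. z i \<in> H i) \<longrightarrow> (\<forall>i\<in>I. norm (z i) \<le> K * nrm z)"
proof -
  have "\<exists>K\<ge>0. \<forall>v\<in>H i. norm v \<le> K * norm_wrt (G o\<^sub>L W i) v" if i: "i \<in> I" for i
  proof -
    obtain m where m: "m > 0" "\<And>v. v \<in> H i \<Longrightarrow> m * (norm v)\<^sup>2 \<le> (G o\<^sub>L W i) v \<bullet> v"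
      using M_spos[OF i] by (auto simp: spos_op_on_def)
    have "norm v \<le> (1 / sqrt m) * norm_wrt (G o\<^sub>L W i) v" if "v \<in> H i" for v
    proof -
      have "sqrt (m * (norm v)\<^sup>2) \<le> norm_wrt (G o\<^sub>L W i) v" unfolding norm_wrt_def using m(2)[OF that] by (rule real_sqrt_le_mono)
      then show ?thesis using m(1) by (simp add: real_sqrt_mult field_simps)
    qed
    then show ?thesis using m(1) by (intro exI[of _ "1 / sqrt m"]) auto
  qed
  then obtain K where K: "\<And>i. i \<in> I \<Longrightarrow> K i \<ge> 0 \<and> (\<forall>v\<in>H i. norm v \<le> K i * norm_wrt (G o\<^sub>L W i) v)" by metis
  have "norm (z i) \<le> (\<Sum>i\<in>I. K i) * nrm z" if z: "\<forall>i\<in>I. z i \<in> H i" and i: "i \<in> I" for z i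
  proof -
    have "norm (z i) \<le> K i * norm_wrt (G o\<^sub>L W i) (z i)" using K[OF i] z i by blast
    also have "\<dots> \<le> (\<Sum>i\<in>I. K i) * nrm z"
    proof (intro mult_mono sum_nonneg norm_wrt_nonneg M_pos i)
      show "K i \<le> (\<Sum>i\<in>I. K i)" by (rule member_le_sum[OF i _ I]) (use K in auto)
      show "norm_wrt (G o\<^sub>L W i) (z i) \<le> nrm z" unfolding nrm_def by (rule member_le_L2_set[OF I i])
    qed (use K in auto)
    finally show ?thesis .
  qed
  then show ?thesis using K by (intro exI[of _ "\<Sum>i\<in>I. K i"]) (auto intro!: sum_nonneg)
qed

lemma nrm_le: "\<exists>K\<ge>0. \<forall>z. nrm z \<le> K * (\<Sum>i\<in>I. norm (z i))"
proof -
  define K where "K = (\<Sum>i\<in>I. sqrt (norm (G o\<^sub>L W i)))"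
  have "nrm z \<le> K * (\<Sum>i\<in>I. norm (z i))" for z
  proof -
    have "nrm z \<le> (\<Sum>i\<in>I. norm_wrt (G o\<^sub>L W i) (z i))"
      unfolding nrm_def by (rule L2_set_le_sum) (simp add: norm_wrt_nonneg[OF M_pos])
    also have "\<dots> \<le> (\<Sum>i\<in>I. K * norm (z i))"
    proof (rule sum_mono)
      fix i assume i: "i \<in> I"
      have "sqrt (norm (G o\<^sub>L W i)) \<le> K" unfolding K_def by (rule member_le_sum[OF i _ I]) auto
      then show "norm_wrt (G o\<^sub>L W i) (z i) \<le> K * norm (z i)"
        by (intro order_trans[OF norm_wrt_le[OF M_pos[OF i]]] mult_right_mono) auto
    qed
    finally show ?thesis by (simp add: sum_distrib_left)
  qed
  moreover have "K \<ge> 0" by (simp add: K_def sum_nonneg)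
  ultimately show ?thesis by blast
qed

definition res :: "'a \<Rightarrow> (nat \<Rightarrow> 'a) \<Rightarrow> nat \<Rightarrow> 'a" where "res x q i = q i - P i x"

lemma sum_M: "(\<Sum>i\<in>I. M i x) = G x"
  by (simp add: M_eq blinfun.sum_right[symmetric] W_sum)

text \<open>All terms in \<open>x - x'\<close> cancel because the \<open>W i\<close> sum to the identity.\<close>

lemma gap_identity:
  assumes "state z x q" "state z' x' q'"
  shows "(\<Sum>i\<in>I. (subgr z x q i - subgr z' x' q' i) \<bullet> (q i - q' i)) + (subgr_h z x - subgr_h z' x') \<bullet> (x - x')
      + (D x - D x') \<bullet> (x - x')
    = - Q (\<lambda>i. z i - z' i) (\<lambda>i. res x q i - res x' q' i)
      - Q (\<lambda>i. res x q i - res x' q' i) (\<lambda>i. res x q i - res x' q' i)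
      - (\<Sum>i\<in>I. W i (D x - D x') \<bullet> (res x q i - res x' q' i))"
proof -
  define A \<Delta> where "A = x - x'" and "\<Delta> = D x - D x'"
  define \<zeta> where "\<zeta> i = z i - z' i" for i
  define \<epsilon> where "\<epsilon> i = res x q i - res x' q' i" for i
  have comp: "(subgr z x q i - subgr z' x' q' i) \<bullet> (q i - q' i)
    = M i A \<bullet> A - M i (\<zeta> i) \<bullet> \<epsilon> i - M i (\<zeta> i) \<bullet> A - M i (\<epsilon> i) \<bullet> \<epsilon> i - W i \<Delta> \<bullet> \<epsilon> i - W i \<Delta> \<bullet> A"
    if i: "i \<in> I" for i
  proof -
    have q: "q i - q' i = \<epsilon> i + P i A" using H[OF i] by (simp add: \<epsilon>_def res_def A_def orth_proj_diff)
    have s: "subgr z x q i - subgr z' x' q' i = 2 *\<^sub>R M i A - M i (\<zeta> i) - M i (q i - q' i) - W i \<Delta>"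
      by (simp add: subgr_def A_def \<zeta>_def \<Delta>_def M_simps blinfun.diff_right algebra_simps)
    have e: "M i (\<epsilon> i) \<bullet> A = M i A \<bullet> \<epsilon> i" by (subst M_sym[OF i]) (rule inner_commute)
    show ?thesis unfolding s unfolding q
      by (simp add: M_simps M_P[OF i] inner_add_left inner_add_right inner_diff_left in_H_inner_P[OF i M_in[OF i]]
          in_H_inner_P[OF i W_in[OF i]] e)
  qed
  have "(subgr_h z x - subgr_h z' x') \<bullet> A = (\<Sum>i\<in>I. M i (\<zeta> i)) \<bullet> A - G A \<bullet> A"
    by (simp add: subgr_h_def M_eq \<zeta>_def A_def blinfun.diff_right blinfun.sum_right sum_subtractf inner_diff_left)
  moreover have "(\<Sum>i\<in>I. M i A \<bullet> A) = G A \<bullet> A" by (simp add: inner_sum_left[symmetric] sum_M)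
  moreover have "(\<Sum>i\<in>I. W i \<Delta> \<bullet> A) = \<Delta> \<bullet> A" by (simp add: inner_sum_left[symmetric] W_sum)
  moreover have "(\<Sum>i\<in>I. (subgr z x q i - subgr z' x' q' i) \<bullet> (q i - q' i))
    = (\<Sum>i\<in>I. M i A \<bullet> A) - Q \<zeta> \<epsilon> - (\<Sum>i\<in>I. M i (\<zeta> i) \<bullet> A) - Q \<epsilon> \<epsilon> - (\<Sum>i\<in>I. W i \<Delta> \<bullet> \<epsilon> i) - (\<Sum>i\<in>I. W i \<Delta> \<bullet> A)"
    by (simp add: comp sum.distrib sum_subtractf Q_def)
  ultimately show ?thesis
    unfolding A_def[symmetric] \<Delta>_def[symmetric] \<zeta>_def[symmetric] \<epsilon>_def[symmetric]
    by (simp add: inner_sum_left)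
qed

lemma gaps_nonneg:
  assumes s: "state z x q" "state z' x' q'"
  shows "i \<in> I \<Longrightarrow> 0 \<le> (subgr z x q i - subgr z' x' q' i) \<bullet> (q i - q' i)"
    and "0 \<le> (subgr_h z x - subgr_h z' x') \<bullet> (x - x')"
    and "0 \<le> (D x - D x') \<bullet> (x - x')"
proof -
  show "i \<in> I \<Longrightarrow> 0 \<le> (subgr z x q i - subgr z' x' q' i) \<bullet> (q i - q' i)"
    using s by (intro subdiff_monotone[of _ "g i"]) (auto simp: state_def)
  show "0 \<le> (subgr_h z x - subgr_h z' x') \<bullet> (x - x')"
    using s by (intro subdiff_monotone[of _ h]) (auto simp: state_def)
  show "0 \<le> (D x - D x') \<bullet> (x - x')"
    by (intro subdiff_monotone[of _ "\<lambda>y. ereal (f y)"] gradient_in_subdiff[OF f D])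
qed

lemma averaged:
  assumes s: "state z x q" "state z' x' q'"
  defines "\<epsilon> \<equiv> \<lambda>i. res x q i - res x' q' i"
  shows "(1 - \<kappa>/4) * (nrm \<epsilon>)\<^sup>2 \<le> - Q (\<lambda>i. z i - z' i) \<epsilon>"
proof -
  define \<Delta> c where "\<Delta> = D x - D x'" and "c = \<Delta> \<bullet> (x - x')"
  define N where "N = nrm (\<lambda>i. \<Gamma> \<Delta>)"
  have "(\<Sum>i\<in>I. W i \<Delta> \<bullet> \<epsilon> i) = Q (\<lambda>i. \<Gamma> \<Delta>) \<epsilon>"
    unfolding Q_def by (rule sum.cong) (auto simp: M_\<Gamma>)
  then have Wle: "- (N * nrm \<epsilon>) \<le> (\<Sum>i\<in>I. W i \<Delta> \<bullet> \<epsilon> i)"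
    using Q_Cauchy_Schwarz[of "\<lambda>i. \<Gamma> \<Delta>" \<epsilon>] by (simp add: N_def)
  have "N\<^sup>2 = (\<Sum>i\<in>I. W i \<Delta> \<bullet> \<Gamma> \<Delta>)"
    unfolding N_def nrm_power2 Q_def by (rule sum.cong) (auto simp: M_\<Gamma>)
  also have "\<dots> = \<Gamma> \<Delta> \<bullet> \<Delta>" by (simp only: inner_sum_left[symmetric] W_sum) (rule inner_commute)
  also have "\<dots> \<le> \<kappa> * c" unfolding \<Delta>_def c_def by (rule cocoercive)
  finally have N: "N\<^sup>2 \<le> \<kappa> * c" .
  have c: "0 \<le> c" unfolding c_def \<Delta>_def by (rule gaps_nonneg(3)[OF s])
  \<comment> \<open>The summand \<open>c\<close> is cancelled by the gradient's own gap in
    \<open>gap_identity\<close>, and \<open>\<kappa>/4\<close> is the loss in the final margin. The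
    case \<open>\<kappa> = 0\<close> is separate because \<open>\<kappa>\<close> is divided
    out.\<close>
  have young: "N * nrm \<epsilon> \<le> c + \<kappa>/4 * (nrm \<epsilon>)\<^sup>2"
  proof (cases "\<kappa> = 0")
    case True then show ?thesis using N c by simp
  next
    case False
    then have k: "\<kappa> > 0" using \<kappa> by simp
    have "0 \<le> (2 * N - \<kappa> * nrm \<epsilon>)\<^sup>2" by simp
    then have "\<kappa> * (4 * (N * nrm \<epsilon>)) \<le> 4 * N\<^sup>2 + \<kappa>\<^sup>2 * (nrm \<epsilon>)\<^sup>2" by (simp add: power2_eq_square algebra_simps)
    also have "\<dots> \<le> \<kappa> * (4 * (c + \<kappa>/4 * (nrm \<epsilon>)\<^sup>2))" using N by (simp add: power2_eq_square algebra_simps)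
    finally show ?thesis using k by simp
  qed
  have "0 \<le> (\<Sum>i\<in>I. (subgr z x q i - subgr z' x' q' i) \<bullet> (q i - q' i))"
    by (intro sum_nonneg gaps_nonneg(1)[OF s])
  then have "c \<le> - Q (\<lambda>i. z i - z' i) \<epsilon> - Q \<epsilon> \<epsilon> - (\<Sum>i\<in>I. W i \<Delta> \<bullet> \<epsilon> i)"
    using gap_identity[OF s] gaps_nonneg(2)[OF s] unfolding c_def \<Delta>_def \<epsilon>_def by linarith
  then show ?thesis using Wle young by (simp add: nrm_power2 algebra_simps)
qed

end

section \<open>Convergence of the iteration\<close>

context preconditioned_splitting
begin

lemma nrm_cong: "(\<And>i. i \<in> I \<Longrightarrow> z i = z' i) \<Longrightarrow> nrm z = nrm z'"
  unfolding nrm_def by (rule L2_set_cong) auto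

lemma res_Lipschitz:
  assumes s: "state z x q" "state z' x' q'"
  shows "nrm (\<lambda>i. res x q i - res x' q' i) \<le> nrm (\<lambda>i. z i - z' i) / (1 - \<kappa>/4)"
proof -
  let ?\<epsilon> = "\<lambda>i. res x q i - res x' q' i" and ?\<zeta> = "\<lambda>i. z i - z' i"
  have "(1 - \<kappa>/4) * nrm ?\<epsilon> * nrm ?\<epsilon> \<le> nrm ?\<zeta> * nrm ?\<epsilon>"
    using averaged[OF s] Q_Cauchy_Schwarz[of ?\<zeta> ?\<epsilon>] by (simp add: power2_eq_square mult.assoc)
  then have "(1 - \<kappa>/4) * nrm ?\<epsilon> \<le> nrm ?\<zeta>"
    using nrm_nonneg[of ?\<epsilon>] nrm_nonneg[of ?\<zeta>] by (cases "nrm ?\<epsilon> = 0") (auto dest: mult_right_le_imp_le)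
  then show ?thesis using \<kappa> by (simp add: field_simps)
qed

text \<open>The residual of a fixed point is 0, so \<open>averaged\<close> bounds the cross term in
  the expanded square; twice its constant is \<open>2 - \<kappa>/2\<close>.\<close>

lemma relaxation_Fejer:
  assumes s: "state z x q" and s0: "state z0 x0 (\<lambda>i. P i x0)" and \<rho>: "\<rho> > 0"
  shows "(nrm (\<lambda>i. z i + \<rho> *\<^sub>R res x q i - z0 i))\<^sup>2
    \<le> (nrm (\<lambda>i. z i - z0 i))\<^sup>2 - \<rho> * (2 - \<kappa>/2 - \<rho>) * (nrm (res x q))\<^sup>2"
proof -
  let ?\<zeta> = "\<lambda>i. z i - z0 i" and ?\<epsilon> = "res x q"
  have av: "(1 - \<kappa>/4) * (nrm ?\<epsilon>)\<^sup>2 \<le> - Q ?\<zeta> ?\<epsilon>"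
    using averaged[OF s s0] by (simp add: res_def[of x0])
  have "(\<lambda>i. z i + \<rho> *\<^sub>R res x q i - z0 i) = (\<lambda>i. ?\<zeta> i + \<rho> *\<^sub>R ?\<epsilon> i)" by auto
  then have "(nrm (\<lambda>i. z i + \<rho> *\<^sub>R res x q i - z0 i))\<^sup>2 = Q (\<lambda>i. ?\<zeta> i + \<rho> *\<^sub>R ?\<epsilon> i) (\<lambda>i. ?\<zeta> i + \<rho> *\<^sub>R ?\<epsilon> i)"
    by (simp only: nrm_power2)
  also have "\<dots> = (nrm ?\<zeta>)\<^sup>2 + 2 * (\<rho> * Q ?\<zeta> ?\<epsilon>) + \<rho> * \<rho> * (nrm ?\<epsilon>)\<^sup>2"
    by (simp only: Q_add_left Q_add_right Q_scaleR_left Q_scaleR_right nrm_power2 Q_sym[of ?\<epsilon> ?\<zeta>])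
  finally have "(nrm (\<lambda>i. z i + \<rho> *\<^sub>R res x q i - z0 i))\<^sup>2 = (nrm ?\<zeta>)\<^sup>2 + 2 * (\<rho> * Q ?\<zeta> ?\<epsilon>) + \<rho> * \<rho> * (nrm ?\<epsilon>)\<^sup>2" .
  moreover have "\<rho> * Q ?\<zeta> ?\<epsilon> \<le> \<rho> * (- ((1 - \<kappa>/4) * (nrm ?\<epsilon>)\<^sup>2))" using av \<rho> by (intro mult_left_mono) auto
  ultimately show ?thesis by (simp add: algebra_simps)
qed

text \<open>Apply \<open>averaged\<close> to two successive states, whose points differ by
  \<open>\<rho>\<close> times the residual. The bound on \<open>\<rho>\<close> lets the quadratic
  term of the residual change be absorbed.\<close>

lemma res_nonincreasing:
  assumes s: "state z x q" and s': "state (\<lambda>i. z i + \<rho> *\<^sub>R res x q i) x' q'" and \<rho>: "0 < \<rho>" "\<rho> \<le> 2 - \<kappa>/2"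
  shows "nrm (res x' q') \<le> nrm (res x q)"
proof (rule power2_le_imp_le)
  let ?e = "res x q" and ?d = "\<lambda>i. res x' q' i - res x q i"
  have "(1 - \<kappa>/4) * (nrm ?d)\<^sup>2 \<le> - (\<rho> * Q ?e ?d)"
    using averaged[OF s' s] by (simp add: Q_scaleR_left)
  then have "\<rho> * (2 * Q ?e ?d) + (2 - \<kappa>/2) * (nrm ?d)\<^sup>2 \<le> 0" by (simp add: algebra_simps)
  moreover have "\<rho> * (nrm ?d)\<^sup>2 \<le> (2 - \<kappa>/2) * (nrm ?d)\<^sup>2" using \<rho> by (intro mult_right_mono) auto
  ultimately have "\<rho> * (2 * Q ?e ?d + (nrm ?d)\<^sup>2) \<le> 0" by (simp only: distrib_left)
  then have le: "2 * Q ?e ?d + (nrm ?d)\<^sup>2 \<le> 0" using \<rho>(1) by (simp add: mult_le_0_iff)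
  have "res x' q' = (\<lambda>i. ?e i + ?d i)" by auto
  then have "(nrm (res x' q'))\<^sup>2 = Q (\<lambda>i. ?e i + ?d i) (\<lambda>i. ?e i + ?d i)" by (metis nrm_power2)
  also have "\<dots> = (nrm ?e)\<^sup>2 + (2 * Q ?e ?d + (nrm ?d)\<^sup>2)"
    by (simp only: Q_add_left Q_add_right nrm_power2 Q_sym[of ?d ?e])
  finally show "(nrm (res x' q'))\<^sup>2 \<le> (nrm (res x q))\<^sup>2" using le by linarith
qed (rule nrm_nonneg)

definition fixed :: "(nat \<Rightarrow> 'a) \<Rightarrow> 'a \<Rightarrow> bool" where
  "fixed z x \<longleftrightarrow> state z x (\<lambda>i. P i x)"

text \<open>The points \<open>z i\<close> are reconstructed from given subgradients by inverting
  \<open>M i\<close> on \<open>H i\<close>.\<close>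

lemma fixed_exists:
  assumes u: "\<And>i. i \<in> I \<Longrightarrow> u i \<in> subdiff (g i) x" and v: "v \<in> subdiff h x"
    and zero: "(\<Sum>i\<in>I. u i) + v + D x = 0"
  shows "\<exists>z. fixed z x"
proof -
  have gP: "u' \<in> subdiff (g i) (P i x)" if "i \<in> I" "u' \<in> H i" "u' \<in> subdiff (g i) x" for i u'
    using that by (auto simp: subdiff_def g_proj inner_diff_right in_H_inner_P)
  have uH: "u i \<in> H i" if i: "i \<in> I" for i
    unfolding in_subspace_iff[OF H[OF i]]
  proof
    fix y assume y: "y \<in> (H i)\<^sup>\<bottom>"
    \<comment> \<open>\<open>g i\<close> is constant in directions orthogonal to \<open>H i\<close>,
      so its subgradients vanish there and belong to \<open>H i\<close>.\<close>
    have "u i \<bullet> w \<le> 0" if w: "w \<in> (H i)\<^sup>\<bottom>" for w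
    proof -
      have "P i (x + w) = P i x"
        using w P_in[OF i] orth_proj_orth[OF H[OF i]]
        by (intro orth_proj_unique[OF H[OF i]]) (auto simp: inner_add_left orth_comp_iff)
      then have "g i (x + w) = g i x" by (metis g_proj[OF i])
      moreover have "g i x + ereal (u i \<bullet> (x + w - x)) \<le> g i (x + w)"
        using u[OF i] unfolding subdiff_def by blast
      moreover have "\<bar>g i x\<bar> \<noteq> \<infinity>" using u[OF i] by (simp add: subdiff_def)
      ultimately show ?thesis by (cases "g i x") auto
    qed
    from this[OF y] this[of "- y"] y show "u i \<bullet> y = 0" by (simp add: orth_comp_iff)
  qed
  have "\<exists>d\<in>H i. M i d = u i + W i (D x)" if i: "i \<in> I" for i
    unfolding M_def using H[OF i] uH[OF i] W_in[OF i]
    by (intro spos_op_on_surj[OF H[OF i] M_spos[OF i]] subspace_add) auto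
  then obtain d where d: "\<And>i. i \<in> I \<Longrightarrow> d i \<in> H i" "\<And>i. i \<in> I \<Longrightarrow> M i (d i) = u i + W i (D x)" by metis
  define z where "z i = P i x - d i" for i
  have zH: "z i \<in> H i" if "i \<in> I" for i using that d(1) P_in H by (simp add: z_def subspace_diff)
  have s: "subgr z x (\<lambda>i. P i x) i = u i" if i: "i \<in> I" for i
    using d(2)[OF i] by (simp add: subgr_def z_def M_simps M_P[OF i] scaleR_2)
  have "subgr_h z x = - (\<Sum>i\<in>I. M i (d i))"
  proof -
    have "subgr_h z x = (\<Sum>i\<in>I. M i (z i)) - (\<Sum>i\<in>I. M i x)"
      by (simp add: subgr_h_def blinfun.diff_right blinfun.sum_right M_eq[symmetric] sum_M)
    also have "\<dots> = (\<Sum>i\<in>I. - M i (d i))"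
      unfolding sum_subtractf[symmetric] by (rule sum.cong) (auto simp: z_def M_simps M_P)
    finally show ?thesis by (simp add: sum_negf)
  qed
  also have "\<dots> = - ((\<Sum>i\<in>I. u i) + D x)" by (simp add: d(2) sum.distrib W_sum)
  also have "\<dots> = v"
  proof -
    have "v + ((\<Sum>i\<in>I. u i) + D x) = 0" using zero by (simp add: algebra_simps)
    then show ?thesis by (simp only: eq_neg_iff_add_eq_0[symmetric])
  qed
  finally have "subgr_h z x = v" .
  then have "fixed z x" unfolding fixed_def state_def using zH s gP[OF _ uH u] P_in v by auto
  then show ?thesis by blast
qed

text \<open>Opial's argument identifies only the components \<open>z i\<close>; strong positivity of
  \<open>G\<close> and monotonicity for \<open>h\<close> transfer this to \<open>x\<close>.\<close>

lemma fixed_unique_x: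
  assumes "fixed z x" "fixed z' x'" "\<And>i. i \<in> I \<Longrightarrow> z i = z' i"
  shows "x = x'"
proof -
  have eq: "(\<Sum>i\<in>I. W i (z i)) = (\<Sum>i\<in>I. W i (z' i))" by (rule sum.cong) (auto simp: assms(3))
  have "0 \<le> (subgr_h z x - subgr_h z' x') \<bullet> (x - x')"
    using assms(1,2) unfolding fixed_def by (rule gaps_nonneg(2))
  then have "G (x - x') \<bullet> (x - x') \<le> 0"
    by (simp add: subgr_h_def eq blinfun.diff_right inner_diff_left)
  moreover obtain m where m: "m > 0" "m * (norm (x - x'))\<^sup>2 \<le> G (x - x') \<bullet> (x - x')"
    using G_spos by (auto simp: spos_op_on_def)
  ultimately have "m * (norm (x - x'))\<^sup>2 \<le> 0" by linarith
  then show ?thesis using m(1) by (simp add: mult_le_0_iff)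
qed

lemma fixed_subgradients_sum:
  "(\<Sum>i\<in>I. subgr z x (\<lambda>i. P i x) i) + subgr_h z x + D x = 0"
proof -
  have "(\<Sum>i\<in>I. subgr z x (\<lambda>i. P i x) i) = (\<Sum>i\<in>I. M i x - M i (z i) - W i (D x))"
    by (rule sum.cong) (auto simp: subgr_def M_simps M_P scaleR_2)
  also have "\<dots> = G x - (\<Sum>i\<in>I. M i (z i)) - D x" by (simp add: sum_subtractf sum_M W_sum)
  finally show ?thesis by (simp add: subgr_h_def blinfun.diff_right blinfun.sum_right M_eq)
qed

end

text \<open>Time is the first index, so that \<open>z k\<close> is a point of the product space. The
  computed point appears as \<open>X (z k) + c k\<close>, separating the exact proximal point from
  its error.\<close>

locale splitting_iteration = preconditioned_splitting +
  fixes z a :: "nat \<Rightarrow> nat \<Rightarrow> 'a" and b c :: "nat \<Rightarrow> 'a" and \<rho> :: "nat \<Rightarrow> real"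
  assumes z0: "\<And>i. i \<in> I \<Longrightarrow> z 0 i \<in> H i" and a_H: "\<And>i k. i \<in> I \<Longrightarrow> a k i \<in> H i"
    and step: "\<And>i k. i \<in> I \<Longrightarrow> z (Suc k) i = z k i + \<rho> k *\<^sub>R
        (T i (2 *\<^sub>R P i (X (z k) + c k) - z k i - \<Gamma> (P i (D (X (z k) + c k) + b k))) + a k i - P i (X (z k) + c k))"
    and \<rho>: "\<And>k. \<rho> k \<in> {0<..<2 - \<kappa>/2}"
    and \<rho>_sum: "filterlim (\<lambda>N. \<Sum>k<N. \<rho> k * (2 - \<kappa>/2 - \<rho> k)) at_top sequentially"
    and b_sum: "summable (\<lambda>k. \<rho> k * norm (b k))" and c_sum: "summable (\<lambda>k. \<rho> k * norm (c k))"
    and a_sum: "\<And>i. i \<in> I \<Longrightarrow> summable (\<lambda>k. \<rho> k * norm (a k i))"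
    and fixed_ex: "\<exists>z x. fixed z x"
begin

definition e :: "nat \<Rightarrow> nat \<Rightarrow> 'a" where "e k = res (X (z k)) (p (z k))"

definition err :: "nat \<Rightarrow> nat \<Rightarrow> 'a" where
  "err k i = T i (2 *\<^sub>R P i (X (z k) + c k) - z k i - \<Gamma> (P i (D (X (z k) + c k) + b k))) + a k i
     - P i (X (z k) + c k) - e k i"

lemma z_step: "i \<in> I \<Longrightarrow> z (Suc k) i = z k i + \<rho> k *\<^sub>R (e k i + err k i)"
  using step[of i k] by (simp add: err_def)

lemma arg_in:
  assumes i: "i \<in> I" and z: "z' \<in> H i"
  shows "2 *\<^sub>R P i x - z' - \<Gamma> (P i y) \<in> H i"
  using H[OF i] z \<Gamma>_H[OF i P_in[OF i]] P_in[OF i] by (intro subspace_diff subspace_scale) auto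

lemma z_in: "i \<in> I \<Longrightarrow> z k i \<in> H i"
proof (induction k)
  case (Suc k)
  note i = \<open>i \<in> I\<close>
  show ?case unfolding step[OF i] using H[OF i]
    by (intro subspace_add subspace_diff subspace_scale T_subgradient(1)[OF i] arg_in i Suc a_H P_in) auto
qed (rule z0)

lemma state_k: "state (z k) (X (z k)) (p (z k))"
  by (rule state_prox) (rule z_in)

lemma e_in: "i \<in> I \<Longrightarrow> e k i \<in> H i"
  using state_k[of k] P_in H unfolding e_def res_def state_def by (auto intro: subspace_diff)

lemma err_bound: "\<exists>K\<ge>0. \<forall>k. \<forall>i\<in>I. norm (err k i) \<le> K * (norm (b k) + norm (c k)) + norm (a k i)"
proof -
  have "\<exists>K\<ge>0. \<forall>y\<in>H i. \<forall>y'\<in>H i. norm (T i y - T i y') \<le> K * norm (y - y')" if "i \<in> I" for i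
    by (rule T_Lipschitz[OF that])
  then obtain K where K: "\<And>i. i \<in> I \<Longrightarrow> K i \<ge> 0"
    "\<And>i y y'. i \<in> I \<Longrightarrow> y \<in> H i \<Longrightarrow> y' \<in> H i \<Longrightarrow> norm (T i y - T i y') \<le> K i * norm (y - y')" by metis
  \<comment> \<open>The 2 stems from the doubled projection of \<open>c k\<close>, the term with
    \<open>\<beta> + 1\<close> from the gradient shift and \<open>b k\<close>, and the last 1 from
    the projection of \<open>c k\<close> that is subtracted.\<close>
  define C where "C i = K i * (2 + norm \<Gamma> * (\<beta> + 1)) + 1" for i
  have C: "C i \<ge> 0" if "i \<in> I" for i using K(1)[OF that] \<beta>(1) by (simp add: C_def)
  have le: "norm (err k i) \<le> C i * (norm (b k) + norm (c k)) + norm (a k i)" if i: "i \<in> I" for k i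
  proof -
    define x where "x = X (z k)"
    define y y' where "y = 2 *\<^sub>R P i (x + c k) - z k i - \<Gamma> (P i (D (x + c k) + b k))"
      and "y' = 2 *\<^sub>R P i x - z k i - \<Gamma> (P i (D x))"
    define s where "s = norm (b k) + norm (c k)"
    have s: "norm (b k) \<le> s" "norm (c k) \<le> s" "0 \<le> s" by (simp_all add: s_def)
    have "y \<in> H i" "y' \<in> H i" unfolding y_def y'_def by (intro arg_in i z_in)+
    then have T: "norm (T i y - T i y') \<le> K i * norm (y - y')" by (rule K(2)[OF i])
    have eq: "y - y' = 2 *\<^sub>R P i (c k) - \<Gamma> (P i ((D (x + c k) - D x) + b k))"
      by (simp add: y_def y'_def orth_proj_add[OF H[OF i]] orth_proj_diff[OF H[OF i]] blinfun.bilinear_simps algebra_simps)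
    have "norm ((D (x + c k) - D x) + b k) \<le> \<beta> * norm (c k) + norm (b k)"
      using \<beta>(2)[of "x + c k" x] by (intro order_trans[OF norm_triangle_ineq]) auto
    also have "\<dots> \<le> \<beta> * s + 1 * s" using \<beta>(1) s by (intro add_mono mult_left_mono) auto
    finally have "norm ((D (x + c k) - D x) + b k) \<le> (\<beta> + 1) * s" by (simp add: algebra_simps)
    then have "norm (P i ((D (x + c k) - D x) + b k)) \<le> (\<beta> + 1) * s"
      using norm_orth_proj_le[OF H[OF i]] order_trans by blast
    then have "norm (\<Gamma> (P i ((D (x + c k) - D x) + b k))) \<le> norm \<Gamma> * ((\<beta> + 1) * s)"
      by (intro order_trans[OF norm_blinfun] mult_left_mono) auto
    moreover have "norm (P i (c k)) \<le> s" using norm_orth_proj_le[OF H[OF i], of "c k"] s(2) by linarith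
    ultimately have "norm (y - y') \<le> (2 + norm \<Gamma> * (\<beta> + 1)) * s"
      unfolding eq by (intro order_trans[OF norm_triangle_ineq4]) (simp add: algebra_simps)
    then have T': "norm (T i y - T i y') \<le> K i * ((2 + norm \<Gamma> * (\<beta> + 1)) * s)"
      using T K(1)[OF i] by (meson mult_left_mono order_trans)
    have "err k i = (T i y - T i y') + a k i - P i (c k)"
      by (simp add: err_def e_def res_def p_def x_def y_def y'_def orth_proj_add[OF H[OF i]])
    then have "norm (err k i) \<le> norm (T i y - T i y') + norm (a k i) + norm (P i (c k))"
      using norm_triangle_ineq4[of "(T i y - T i y') + a k i" "P i (c k)"] norm_triangle_ineq[of "T i y - T i y'" "a k i"]
      by simp
    then show ?thesis using T' \<open>norm (P i (c k)) \<le> s\<close> unfolding C_def s_def[symmetric] by (simp add: algebra_simps)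
  qed
  have "norm (err k i) \<le> (\<Sum>i\<in>I. C i) * (norm (b k) + norm (c k)) + norm (a k i)" if i: "i \<in> I" for k i
  proof -
    have "C i * (norm (b k) + norm (c k)) \<le> (\<Sum>i\<in>I. C i) * (norm (b k) + norm (c k))"
      by (intro mult_right_mono member_le_sum[OF i _ I]) (use C in auto)
    then show ?thesis using le[OF i, of k] by linarith
  qed
  then show ?thesis using C by (intro exI[of _ "\<Sum>i\<in>I. C i"]) (auto intro!: sum_nonneg)
qed

lemma err_summable: "summable (\<lambda>k. \<rho> k * nrm (err k))"
proof -
  obtain K where K: "K \<ge> 0" "\<And>k i. i \<in> I \<Longrightarrow> norm (err k i) \<le> K * (norm (b k) + norm (c k)) + norm (a k i)"
    using err_bound by blast
  obtain K' where K': "K' \<ge> 0" "\<And>z. nrm z \<le> K' * (\<Sum>i\<in>I. norm (z i))" using nrm_le by blast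
  define r where "r k = K' * (\<Sum>i\<in>I. K * (\<rho> k * norm (b k) + \<rho> k * norm (c k)) + \<rho> k * norm (a k i))" for k
  have r: "summable r" unfolding r_def
    by (intro summable_mult summable_sum summable_add b_sum c_sum a_sum)
  have le: "norm (\<rho> k * nrm (err k)) \<le> r k" for k
  proof -
    have \<rho>0: "0 \<le> \<rho> k" using \<rho>[of k] by simp
    have "\<rho> k * nrm (err k) \<le> \<rho> k * (K' * (\<Sum>i\<in>I. K * (norm (b k) + norm (c k)) + norm (a k i)))"
    proof (intro mult_left_mono \<rho>0 order_trans[OF K'(2)] K'(1))
      show "(\<Sum>i\<in>I. norm (err k i)) \<le> (\<Sum>i\<in>I. K * (norm (b k) + norm (c k)) + norm (a k i))"
        by (rule sum_mono) (rule K(2))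
    qed
    also have "\<dots> = r k" unfolding r_def by (simp add: sum_distrib_left algebra_simps)
    finally show ?thesis using \<rho>0 nrm_nonneg[of "err k"] by simp
  qed
  show ?thesis by (rule summable_comparison_test'[OF r le])
qed

lemma convergence_of_distances:
  assumes fx: "fixed z0 x0"
  shows "convergent (\<lambda>k. nrm (\<lambda>i. z k i - z0 i))" "(\<lambda>k. nrm (e k)) \<longlonglongrightarrow> 0"
proof -
  define w where "w k = (\<lambda>i. z k i + \<rho> k *\<^sub>R e k i)" for k
  define t where "t k = nrm (\<lambda>i. w k i - z0 i)" for k
  define r where "r k = \<rho> k * nrm (err k)" for k
  define C where "C = 1 / (1 - \<kappa>/4)"
  have \<rho>0: "0 < \<rho> k" "\<rho> k \<le> 2 - \<kappa>/2" for k using \<rho>[of k] by auto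
  have C: "C \<ge> 0" using \<kappa> by (simp add: C_def)
  have w_state: "state (w k) (X (w k)) (p (w k))" for k
    by (rule state_prox) (use z_in e_in H in \<open>auto simp: w_def intro!: subspace_add subspace_scale\<close>)
  have dist: "nrm (\<lambda>i. z (Suc k) i - w k i) = r k" for k
  proof -
    have "nrm (\<lambda>i. z (Suc k) i - w k i) = nrm (\<lambda>i. \<rho> k *\<^sub>R err k i)"
      by (rule nrm_cong) (simp add: z_step w_def scaleR_add_right)
    then show ?thesis using \<rho>0(1)[of k] by (simp add: nrm_scaleR r_def)
  qed
  have t: "(t k)\<^sup>2 \<le> (nrm (\<lambda>i. z k i - z0 i))\<^sup>2 - \<rho> k * (2 - \<kappa>/2 - \<rho> k) * (nrm (e k))\<^sup>2" for k
    using relaxation_Fejer[OF state_k fx[unfolded fixed_def] \<rho>0(1)] unfolding t_def w_def e_def .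
  have a: "nrm (\<lambda>i. z (Suc k) i - z0 i) \<le> t k + r k" for k
    using nrm_triangle[of "\<lambda>i. w k i - z0 i" "\<lambda>i. z (Suc k) i - w k i"] by (simp add: t_def dist)
  \<comment> \<open>The exact step to \<open>w k\<close> does not increase the residual, and moving
    from \<open>w k\<close> to the actual iterate changes it by at most
    \<open>C * r k\<close>.\<close>
  have e': "nrm (e (Suc k)) \<le> nrm (e k) + C * r k" for k
  proof -
    have "nrm (res (X (w k)) (p (w k))) \<le> nrm (e k)"
      using res_nonincreasing[OF state_k w_state[unfolded w_def e_def] \<rho>0] unfolding e_def w_def .
    moreover have "nrm (\<lambda>i. e (Suc k) i - res (X (w k)) (p (w k)) i) \<le> C * r k"
      using res_Lipschitz[OF state_k[of "Suc k"] w_state[of k]] unfolding dist C_def e_def by simp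
    moreover have "nrm (e (Suc k)) \<le> nrm (res (X (w k)) (p (w k))) + nrm (\<lambda>i. e (Suc k) i - res (X (w k)) (p (w k)) i)"
      using nrm_triangle[of "res (X (w k)) (p (w k))" "\<lambda>i. e (Suc k) i - res (X (w k)) (p (w k)) i"] by simp
    ultimately show ?thesis by linarith
  qed
  have tn: "0 \<le> t k" and rn: "0 \<le> r k" for k using \<rho>0(1)[of k] by (auto simp: t_def r_def nrm_nonneg)
  note km = Krasnoselskii_Mann_real[OF nrm_nonneg tn nrm_nonneg rn err_summable[folded r_def] \<rho> C \<rho>_sum t a e']
  show "convergent (\<lambda>k. nrm (\<lambda>i. z k i - z0 i))" "(\<lambda>k. nrm (e k)) \<longlonglongrightarrow> 0" using km by blast+
qed

lemma e_tendsto: "i \<in> I \<Longrightarrow> (\<lambda>k. e k i) \<longlonglongrightarrow> 0"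
proof -
  assume i: "i \<in> I"
  obtain K where K: "K \<ge> 0" "\<And>z. \<forall>i\<in>I. z i \<in> H i \<Longrightarrow> \<forall>i\<in>I. norm (z i) \<le> K * nrm z" using nrm_component by blast
  have le: "norm (e k i) \<le> K * nrm (e k)" for k using K(2)[of "e k"] e_in i by blast
  obtain z0 x0 where "fixed z0 x0" using fixed_ex by blast
  then have "(\<lambda>k. K * nrm (e k)) \<longlonglongrightarrow> 0" by (intro tendsto_mult_right_zero convergence_of_distances)
  then show "(\<lambda>k. e k i) \<longlonglongrightarrow> 0" by (rule Lim_null_comparison[OF always_eventually[OF allI[OF le]]])
qed

lemma iterates_bounded: "\<exists>B\<ge>0. (\<forall>k. \<forall>i\<in>I. norm (z k i) \<le> B) \<and> (\<forall>k. norm (X (z k)) \<le> B)"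
proof -
  obtain z0 x0 where fx: "fixed z0 x0" using fixed_ex by blast
  obtain K where K: "K \<ge> 0" "\<And>z. \<forall>i\<in>I. z i \<in> H i \<Longrightarrow> \<forall>i\<in>I. norm (z i) \<le> K * nrm z" using nrm_component by blast
  obtain A where A: "\<And>k. nrm (\<lambda>i. z k i - z0 i) \<le> A"
    using convergent_imp_Bseq[OF convergence_of_distances(1)[OF fx]] by (auto simp: Bseq_def nrm_nonneg)
  have A0: "A \<ge> 0" using A[of 0] nrm_nonneg order_trans by blast
  have d: "norm (z k i - z0 i) \<le> K * A" if i: "i \<in> I" for k i
  proof -
    have "\<forall>i\<in>I. z k i - z0 i \<in> H i" using z_in fx H unfolding fixed_def state_def by (auto intro: subspace_diff)
    then have "norm (z k i - z0 i) \<le> K * nrm (\<lambda>i. z k i - z0 i)" using K(2)[of "\<lambda>i. z k i - z0 i"] i by blast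
    then show ?thesis using A[of k] K(1) by (meson mult_left_mono order_trans)
  qed
  obtain K' where K': "K' \<ge> 0" "\<And>z z'. norm (X z - X z') \<le> K' * norm (\<Sum>i\<in>I. W i (z i - z' i))" using X_Lipschitz by blast
  define B1 where "B1 = K * A + (\<Sum>i\<in>I. norm (z0 i))"
  define B2 where "B2 = norm (X z0) + K' * (\<Sum>i\<in>I. norm (W i) * (K * A))"
  have "norm (z k i) \<le> B1" if i: "i \<in> I" for k i
  proof -
    have "norm (z k i) \<le> norm (z k i - z0 i) + norm (z0 i)" using norm_triangle_ineq[of "z k i - z0 i" "z0 i"] by simp
    moreover have "norm (z0 i) \<le> (\<Sum>i\<in>I. norm (z0 i))" by (rule member_le_sum[OF i _ I]) auto
    ultimately show ?thesis using d[OF i, of k] by (simp add: B1_def)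
  qed
  moreover have "norm (X (z k)) \<le> B2" for k
  proof -
    have "norm (\<Sum>i\<in>I. W i (z k i - z0 i)) \<le> (\<Sum>i\<in>I. norm (W i) * (K * A))"
      by (intro sum_norm_le order_trans[OF norm_blinfun] mult_left_mono d) auto
    then have "norm (X (z k) - X z0) \<le> K' * (\<Sum>i\<in>I. norm (W i) * (K * A))"
      using K'(1) by (intro order_trans[OF K'(2)] mult_left_mono) auto
    then show ?thesis using norm_triangle_ineq[of "X (z k) - X z0" "X z0"] by (simp add: B2_def)
  qed
  moreover have "B1 \<ge> 0" "B2 \<ge> 0" using K(1) A0 K'(1) by (auto simp: B1_def B2_def intro!: add_nonneg_nonneg sum_nonneg mult_nonneg_nonneg)
  ultimately show ?thesis by (intro exI[of _ "B1 + B2"]) (auto intro: add_increasing add_increasing2)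
qed

text \<open>In \<open>gap_identity\<close> against a fixed point, every term on the right pairs the
  residual with something bounded, so the sum of the gaps vanishes; being nonnegative, each gap does
  too.\<close>

lemma gaps_tendsto_0:
  assumes fx: "fixed z0 x0"
  shows "i \<in> I \<Longrightarrow> (\<lambda>k. (subgr (z k) (X (z k)) (p (z k)) i - subgr z0 x0 (\<lambda>i. P i x0) i) \<bullet> (p (z k) i - P i x0)) \<longlonglongrightarrow> 0"
    and "(\<lambda>k. (subgr_h (z k) (X (z k)) - subgr_h z0 x0) \<bullet> (X (z k) - x0)) \<longlonglongrightarrow> 0"
    and "(\<lambda>k. (D (X (z k)) - D x0) \<bullet> (X (z k) - x0)) \<longlonglongrightarrow> 0"
proof -
  note s0 = fx[unfolded fixed_def]
  define gi where "gi k i = (subgr (z k) (X (z k)) (p (z k)) i - subgr z0 x0 (\<lambda>i. P i x0) i) \<bullet> (p (z k) i - P i x0)" for k i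
  define gh where "gh k = (subgr_h (z k) (X (z k)) - subgr_h z0 x0) \<bullet> (X (z k) - x0)" for k
  define gf where "gf k = (D (X (z k)) - D x0) \<bullet> (X (z k) - x0)" for k
  define S where "S k = (\<Sum>i\<in>I. gi k i) + gh k + gf k" for k
  obtain B where B: "B \<ge> 0" "\<And>k. norm (X (z k)) \<le> B" using iterates_bounded by blast
  have S: "S k = - Q (\<lambda>i. z k i - z0 i) (e k) - Q (e k) (e k) - (\<Sum>i\<in>I. W i (D (X (z k)) - D x0) \<bullet> e k i)" for k
    using gap_identity[OF state_k[of k] s0] unfolding S_def gi_def gh_def gf_def e_def by (simp add: res_def[of x0])
  have "(\<lambda>k. Q (\<lambda>i. z k i - z0 i) (e k)) \<longlonglongrightarrow> 0"
  proof (rule Lim_null_comparison)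
    obtain l where "(\<lambda>k. nrm (\<lambda>i. z k i - z0 i)) \<longlonglongrightarrow> l"
      using convergence_of_distances(1)[OF fx] by (auto simp: convergent_def)
    from tendsto_mult[OF this convergence_of_distances(2)[OF fx]]
    show "(\<lambda>k. nrm (\<lambda>i. z k i - z0 i) * nrm (e k)) \<longlonglongrightarrow> 0" by simp
  qed (simp add: Q_Cauchy_Schwarz)
  moreover have "(\<lambda>k. Q (e k) (e k)) \<longlonglongrightarrow> 0"
    using tendsto_power[OF convergence_of_distances(2)[OF fx], of 2] by (simp add: nrm_power2)
  moreover have "(\<lambda>k. \<Sum>i\<in>I. W i (D (X (z k)) - D x0) \<bullet> e k i) \<longlonglongrightarrow> 0"
  proof (rule tendsto_null_sum)
    fix i assume i: "i \<in> I"
    have le: "norm (W i (D (X (z k)) - D x0) \<bullet> e k i) \<le> norm (W i) * (\<beta> * (B + norm x0)) * norm (e k i)" for k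
    proof -
      have "norm (X (z k) - x0) \<le> B + norm x0" using norm_triangle_ineq4[of "X (z k)" x0] B(2)[of k] by linarith
      then have "norm (D (X (z k)) - D x0) \<le> \<beta> * (B + norm x0)"
        using \<beta> by (meson mult_left_mono order_trans)
      then have "norm (W i (D (X (z k)) - D x0)) \<le> norm (W i) * (\<beta> * (B + norm x0))"
        by (intro order_trans[OF norm_blinfun] mult_left_mono) auto
      then have "norm (W i (D (X (z k)) - D x0)) * norm (e k i) \<le> norm (W i) * (\<beta> * (B + norm x0)) * norm (e k i)"
        by (rule mult_right_mono) simp
      then show ?thesis using Cauchy_Schwarz_ineq2 order_trans unfolding real_norm_def by blast
    qed
    show "(\<lambda>k. W i (D (X (z k)) - D x0) \<bullet> e k i) \<longlonglongrightarrow> 0"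
      by (rule Lim_null_comparison[OF always_eventually[OF allI[OF le]]])
        (intro tendsto_mult_right_zero tendsto_norm_zero e_tendsto i)
  qed
  ultimately have "(\<lambda>k. - Q (\<lambda>i. z k i - z0 i) (e k) - Q (e k) (e k) - (\<Sum>i\<in>I. W i (D (X (z k)) - D x0) \<bullet> e k i)) \<longlonglongrightarrow> - 0 - 0 - 0"
    by (intro tendsto_diff tendsto_minus)
  then have S0: "S \<longlonglongrightarrow> 0" unfolding S[abs_def] by simp
  have n: "i \<in> I \<Longrightarrow> 0 \<le> gi k i" "0 \<le> gh k" "0 \<le> gf k" for i k
    unfolding gi_def gh_def gf_def by (rule gaps_nonneg[OF state_k s0]; assumption)+
  have lei: "norm (gi k i) \<le> S k" if "i \<in> I" for i k
    using member_le_sum[OF that, of "gi k"] n(1)[OF that, of k] n(2,3)[of k] n(1) I unfolding S_def by fastforce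
  have sn: "0 \<le> (\<Sum>i\<in>I. gi k i)" for k by (intro sum_nonneg n)
  have leh: "norm (gh k) \<le> S k" and lef: "norm (gf k) \<le> S k" for k using sn[of k] n(2,3)[of k] unfolding S_def by auto
  show "i \<in> I \<Longrightarrow> (\<lambda>k. (subgr (z k) (X (z k)) (p (z k)) i - subgr z0 x0 (\<lambda>i. P i x0) i) \<bullet> (p (z k) i - P i x0)) \<longlonglongrightarrow> 0"
    unfolding gi_def[symmetric] by (rule Lim_null_comparison[OF always_eventually[OF allI[OF lei]] S0])
  show "(\<lambda>k. (subgr_h (z k) (X (z k)) - subgr_h z0 x0) \<bullet> (X (z k) - x0)) \<longlonglongrightarrow> 0"
    unfolding gh_def[symmetric] by (rule Lim_null_comparison[OF always_eventually[OF allI[OF leh]] S0])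
  show "(\<lambda>k. (D (X (z k)) - D x0) \<bullet> (X (z k) - x0)) \<longlonglongrightarrow> 0"
    unfolding gf_def[symmetric] by (rule Lim_null_comparison[OF always_eventually[OF allI[OF lef]] S0])
qed

text \<open>Cocoercivity bounds the squared distance of the gradients by the gap of
  \<open>f\<close>. Hence the gradients converge strongly although their arguments need not.\<close>

lemma gradient_tendsto:
  assumes fx: "fixed z0 x0"
  shows "(\<lambda>k. D (X (z k))) \<longlonglongrightarrow> D x0"
proof -
  obtain m where m: "m > 0" "\<And>v. m * (norm v)\<^sup>2 \<le> \<Gamma> v \<bullet> v" using \<Gamma>_spos by (auto simp: spos_op_on_def)
  have le: "norm ((norm (D (X (z k)) - D x0))\<^sup>2) \<le> \<kappa> / m * ((D (X (z k)) - D x0) \<bullet> (X (z k) - x0))" for k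
    using order_trans[OF m(2) cocoercive[of "X (z k)" x0]] m(1) by (simp add: field_simps)
  have "(\<lambda>k. (norm (D (X (z k)) - D x0))\<^sup>2) \<longlonglongrightarrow> 0"
    by (rule Lim_null_comparison[OF always_eventually[OF allI[OF le]]])
      (intro tendsto_mult_right_zero gaps_tendsto_0(3)[OF fx])
  then have "(\<lambda>k. sqrt ((norm (D (X (z k)) - D x0))\<^sup>2)) \<longlonglongrightarrow> sqrt 0" by (rule tendsto_real_sqrt)
  then show ?thesis by (simp add: tendsto_norm_zero_iff LIM_zero_iff)
qed

section \<open>Weak cluster points of the iterates\<close>

definition cluster :: "(nat \<Rightarrow> 'a) \<Rightarrow> 'a \<Rightarrow> nat filter \<Rightarrow> bool" where
  "cluster z1 x1 F \<longleftrightarrow> (\<forall>i\<in>I. wlim (\<lambda>k. z k i) (z1 i) F) \<and> wlim (\<lambda>k. X (z k)) x1 F"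

lemma cluster_fixed:
  assumes F: "F \<le> sequentially" "F \<noteq> bot" and cl: "cluster z1 x1 F"
  shows "fixed z1 x1"
proof -
  obtain z0 x0 where fx: "fixed z0 x0" using fixed_ex by blast
  have wz: "wlim (\<lambda>k. z k i) (z1 i) F" if "i \<in> I" for i using cl that by (auto simp: cluster_def)
  have wx: "wlim (\<lambda>k. X (z k)) x1 F" using cl by (simp add: cluster_def)
  have we: "wlim (\<lambda>k. e k i) 0 F" if "i \<in> I" for i by (intro wlim_strong tendsto_mono[OF F(1)] e_tendsto that)
  have Dlim: "((\<lambda>k. D (X (z k))) \<longlongrightarrow> D x0) F" by (rule tendsto_mono[OF F(1) gradient_tendsto[OF fx]])
  have wp: "wlim (\<lambda>k. p (z k) i) (P i x1) F" if i: "i \<in> I" for i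
  proof -
    have "wlim (\<lambda>k. e k i + P i (X (z k))) (0 + P i x1) F"
      by (intro wlim_add we i wlim_selfadjoint[OF orth_proj_selfadjoint[OF H[OF i]]] wx)
    then show ?thesis by (simp add: e_def res_def)
  qed
  have zH: "z1 i \<in> H i" if i: "i \<in> I" for i
    by (rule wlim_closed_convex[OF subspace_imp_convex[OF H(1)[OF i]] H(2)[OF i] wz[OF i]])
      (use z_in[OF i] F(2) in \<open>simp add: frequently_def\<close>)
  \<comment> \<open>One family holds all functions: \<open>Inl i\<close> stands for
    \<open>g i\<close>, \<open>Inr True\<close> for \<open>h\<close> and \<open>Inr False\<close>
    for \<open>f\<close>.\<close>
  define GG where "GG = case_sum g (\<lambda>t. if t then h else (\<lambda>y. ereal (f y)))"
  define U where "U = case_sum (\<lambda>i k. subgr (z k) (X (z k)) (p (z k)) i)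
      (\<lambda>t k. if t then subgr_h (z k) (X (z k)) else D (X (z k)))"
  define PP where "PP = case_sum (\<lambda>i k. p (z k) i) (\<lambda>t::bool. \<lambda>k. X (z k))"
  define XX where "XX = case_sum (\<lambda>i. P i x1) (\<lambda>t::bool. x1)"
  \<comment> \<open>The limit of the gradients is known as \<open>D x0\<close>, taken at a reference
    fixed point; it is identified with \<open>D x1\<close> only once it is a subgradient of
    \<open>f\<close> at \<open>x1\<close>.\<close>
  define V where "V = case_sum (\<lambda>i. M i (2 *\<^sub>R x1 - z1 i - P i x1) - W i (D x0))
      (\<lambda>t. if t then subgr_h z1 x1 else D x0)"
  define J where "J = I <+> (UNIV :: bool set)"
  have sumJ: "(\<Sum>j\<in>J. \<phi> j) = (\<Sum>i\<in>I. \<phi> (Inl i)) + (\<phi> (Inr True) + \<phi> (Inr False))" for \<phi> :: "nat + bool \<Rightarrow> real"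
    unfolding J_def by (simp add: sum.Plus I UNIV_bool add.commute)
  have sub: "U j k \<in> subdiff (GG j) (PP j k)" if "j \<in> J" for j k
    using that state_k[of k] gradient_in_subdiff[OF f D]
    by (auto simp: J_def U_def GG_def PP_def state_def)
  have cvx: "convex_fun (GG j) \<and> proper_fun (GG j) \<and> lsc_fun (GG j)" if "j \<in> J" for j
  proof -
    have "continuous_on UNIV f"
      using D by (auto simp: gderiv_def intro!: continuous_at_imp_continuous_on dest: has_derivative_continuous)
    then show ?thesis using that g h convex_fun_real[OF f]
      by (auto simp: J_def GG_def proper_fun_def effdom_def intro: lsc_fun_continuous split: if_splits)
  qed
  have wP: "wlim (PP j) (XX j) F" if "j \<in> J" for j
    using that wp wx by (auto simp: J_def PP_def XX_def)
  have wU: "wlim (U j) (V j) F" if "j \<in> J" for j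
  proof -
    have "wlim (\<lambda>k. subgr (z k) (X (z k)) (p (z k)) i) (M i (2 *\<^sub>R x1 - z1 i - P i x1) - W i (D x0)) F" if i: "i \<in> I" for i
      unfolding subgr_def
      by (intro wlim_diff wlim_selfadjoint[OF M_sym[OF i]] wlim_selfadjoint[OF W_sym[OF i]] wlim_scaleR wx wz wp i wlim_strong[OF Dlim])
    moreover have "wlim (\<lambda>k. subgr_h (z k) (X (z k))) (subgr_h z1 x1) F"
    proof -
      have Gsym: "G u \<bullet> v = u \<bullet> G v" for u v using G_spos by (auto simp: spos_op_on_def pos_op_on_def)
      show ?thesis unfolding subgr_h_def
        by (intro wlim_selfadjoint[of G, OF Gsym] wlim_diff wlim_sum wx wlim_selfadjoint[OF W_sym] wz)
    qed
    moreover have "wlim (\<lambda>k. D (X (z k))) (D x0) F" by (rule wlim_strong[OF Dlim])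
    ultimately show ?thesis using that by (auto simp: J_def U_def V_def)
  qed
  have inH: "subgr (z k) (X (z k)) (p (z k)) i \<in> H i" if i: "i \<in> I" for i k
    unfolding subgr_def by (intro subspace_diff H i M_in W_in)
  \<comment> \<open>All subgradients of a state sum to minus the sum of the
    \<open>M i (e k i)\<close>, so only terms containing the residual are left.\<close>
  have "(\<Sum>j\<in>J. U j k \<bullet> PP j k)
      = (\<Sum>i\<in>I. subgr (z k) (X (z k)) (p (z k)) i \<bullet> e k i) - (\<Sum>i\<in>I. M i (e k i) \<bullet> X (z k))" for k
  proof -
    define x where "x = X (z k)"
    define u where "u i = subgr (z k) x (p (z k)) i" for i
    have p: "p (z k) i = e k i + P i x" for i by (simp add: e_def res_def x_def)
    have up: "u i \<bullet> p (z k) i = u i \<bullet> e k i + u i \<bullet> x" if "i \<in> I" for i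
    proof -
      have "u i \<in> H i" unfolding u_def x_def by (rule inH[OF that])
      then show ?thesis by (simp add: p inner_add_right in_H_inner_P[OF that])
    qed
    have "(\<Sum>i\<in>I. u i) + subgr_h (z k) x + D x = - (\<Sum>i\<in>I. M i (e k i))"
    proof -
      have "(\<Sum>i\<in>I. u i) = (\<Sum>i\<in>I. M i x - M i (z k i) - M i (e k i) - W i (D x))"
        unfolding u_def subgr_def p x_def[symmetric]
        by (rule sum.cong) (auto simp: M_simps M_P scaleR_2)
      also have "\<dots> = G x - (\<Sum>i\<in>I. M i (z k i)) - (\<Sum>i\<in>I. M i (e k i)) - D x"
        by (simp add: sum_subtractf sum_M W_sum)
      finally show ?thesis by (simp add: subgr_h_def blinfun.diff_right blinfun.sum_right M_eq)
    qed
    then have "((\<Sum>i\<in>I. u i) + subgr_h (z k) x + D x) \<bullet> x = - (\<Sum>i\<in>I. M i (e k i) \<bullet> x)"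
      by (simp add: inner_sum_left)
    moreover have "(\<Sum>j\<in>J. U j k \<bullet> PP j k) = (\<Sum>i\<in>I. u i \<bullet> e k i + u i \<bullet> x) + (subgr_h (z k) x \<bullet> x + D x \<bullet> x)"
      unfolding sumJ by (simp add: U_def PP_def u_def[symmetric] x_def[symmetric] up)
    ultimately show ?thesis unfolding x_def[symmetric] u_def[symmetric]
      by (simp add: sum.distrib inner_add_left inner_sum_left)
  qed
  moreover have "((\<lambda>k. (\<Sum>i\<in>I. subgr (z k) (X (z k)) (p (z k)) i \<bullet> e k i) - (\<Sum>i\<in>I. M i (e k i) \<bullet> X (z k))) \<longlongrightarrow> 0 - 0) F"
  proof (rule tendsto_mono[OF F(1)], intro tendsto_diff tendsto_null_sum)
    fix i assume i: "i \<in> I"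
    obtain B where B: "B \<ge> 0" "\<And>k i. i \<in> I \<Longrightarrow> norm (z k i) \<le> B" "\<And>k. norm (X (z k)) \<le> B" using iterates_bounded by blast
    obtain B' where B': "\<And>k. norm (e k i) \<le> B'"
      using convergent_imp_Bseq[OF convergentI[OF e_tendsto[OF i]]] by (auto simp: Bseq_def)
    obtain B'' where B'': "\<And>k. norm (D (X (z k))) \<le> B''"
      using convergent_imp_Bseq[OF convergentI[OF gradient_tendsto[OF fx]]] by (auto simp: Bseq_def)
    define C where "C = norm (G o\<^sub>L W i) * (2 * B + B + (B' + B)) + norm (W i) * B''"
    have sb: "norm (subgr (z k) (X (z k)) (p (z k)) i) \<le> C" for k
    proof -
      have "norm (P i (X (z k))) \<le> B" using norm_orth_proj_le[OF H[OF i], of "X (z k)"] B(3)[of k] by linarith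
      then have pb: "norm (p (z k) i) \<le> B' + B"
        using norm_triangle_ineq[of "e k i" "P i (X (z k))"] B'[of k] by (simp add: e_def res_def)
      have "norm (2 *\<^sub>R X (z k) - z k i - p (z k) i) \<le> norm (2 *\<^sub>R X (z k)) + norm (z k i) + norm (p (z k) i)"
        by (meson norm_triangle_ineq4 add_right_mono order_trans)
      also have "\<dots> \<le> 2 * B + B + (B' + B)" using B(2)[OF i, of k] B(3)[of k] pb by (intro add_mono) auto
      finally have "norm (M i (2 *\<^sub>R X (z k) - z k i - p (z k) i)) \<le> norm (G o\<^sub>L W i) * (2 * B + B + (B' + B))"
        unfolding M_def by (intro order_trans[OF norm_blinfun] mult_left_mono) auto
      moreover have "norm (W i (D (X (z k)))) \<le> norm (W i) * B''"
        by (intro order_trans[OF norm_blinfun] mult_left_mono B'') auto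
      ultimately show ?thesis unfolding subgr_def C_def by (intro order_trans[OF norm_triangle_ineq4] add_mono)
    qed
    have le1: "norm (subgr (z k) (X (z k)) (p (z k)) i \<bullet> e k i) \<le> C * norm (e k i)" for k
      using order_trans[OF Cauchy_Schwarz_ineq2 mult_right_mono[OF sb norm_ge_zero]] by simp
    show "(\<lambda>k. subgr (z k) (X (z k)) (p (z k)) i \<bullet> e k i) \<longlonglongrightarrow> 0"
      by (rule Lim_null_comparison[OF always_eventually[OF allI[OF le1]]])
        (intro tendsto_mult_right_zero tendsto_norm_zero e_tendsto i)
    have le2: "norm (M i (e k i) \<bullet> X (z k)) \<le> norm (G o\<^sub>L W i) * norm (e k i) * B" for k
    proof -
      have "norm (M i (e k i)) * norm (X (z k)) \<le> norm (G o\<^sub>L W i) * norm (e k i) * B"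
        unfolding M_def by (intro mult_mono norm_blinfun B(3)) auto
      then show ?thesis using order_trans[OF Cauchy_Schwarz_ineq2] by simp
    qed
    show "(\<lambda>k. M i (e k i) \<bullet> X (z k)) \<longlonglongrightarrow> 0"
      by (rule Lim_null_comparison[OF always_eventually[OF allI[OF le2]]])
        (intro tendsto_mult_left_zero tendsto_mult_right_zero tendsto_norm_zero e_tendsto i)
  qed
  ultimately have lim0: "((\<lambda>k. \<Sum>j\<in>J. U j k \<bullet> PP j k) \<longlongrightarrow> 0) F" by simp
  have "(\<Sum>j\<in>J. V j \<bullet> XX j) = 0"
  proof -
    define u where "u i = M i (2 *\<^sub>R x1 - z1 i - P i x1) - W i (D x0)" for i
    have uH: "u i \<in> H i" if "i \<in> I" for i unfolding u_def by (intro subspace_diff H that M_in W_in)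
    have "(\<Sum>i\<in>I. u i) = (\<Sum>i\<in>I. M i x1 - M i (z1 i) - W i (D x0))"
      unfolding u_def by (rule sum.cong) (auto simp: M_simps M_P scaleR_2)
    also have "\<dots> = G x1 - (\<Sum>i\<in>I. M i (z1 i)) - D x0" by (simp add: sum_subtractf sum_M W_sum)
    finally have "(\<Sum>i\<in>I. u i) + (subgr_h z1 x1 + D x0) = 0"
      by (simp add: subgr_h_def blinfun.diff_right blinfun.sum_right M_eq)
    then have "((\<Sum>i\<in>I. u i) + (subgr_h z1 x1 + D x0)) \<bullet> x1 = 0" by simp
    moreover have "(\<Sum>i\<in>I. u i \<bullet> P i x1) = (\<Sum>i\<in>I. u i \<bullet> x1)"
      by (rule sum.cong) (auto simp: in_H_inner_P uH)
    ultimately show ?thesis unfolding sumJ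
      by (simp add: V_def XX_def u_def[symmetric] inner_add_left inner_sum_left)
  qed
  then have lim: "((\<lambda>k. \<Sum>j\<in>J. U j k \<bullet> PP j k) \<longlongrightarrow> (\<Sum>j\<in>J. V j \<bullet> XX j)) F" using lim0 by simp
  have J: "finite J" by (simp add: J_def I)
  have VV: "V j \<in> subdiff (GG j) (XX j)" if "j \<in> J" for j
    by (rule subdiff_weak_closed[OF J F(2) cvx sub wP wU lim that])
  have jb: "Inr t \<in> J" "i \<in> I \<Longrightarrow> Inl i \<in> J" for t i by (auto simp: J_def)
  have "D x0 \<in> subdiff (\<lambda>y. ereal (f y)) x1" using VV[of "Inr False"] jb by (simp add: V_def GG_def XX_def)
  then have "D x0 = D x1" by (rule gradient_unique_subdiff[OF D])
  then have "subgr z1 x1 (\<lambda>i. P i x1) i \<in> subdiff (g i) (P i x1)" if "i \<in> I" for i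
    using VV[of "Inl i"] jb that by (simp add: V_def GG_def XX_def subgr_def)
  moreover have "subgr_h z1 x1 \<in> subdiff h x1" using VV[of "Inr True"] jb by (simp add: V_def GG_def XX_def)
  ultimately show ?thesis unfolding fixed_def state_def using zH P_in by blast
qed

lemma cluster_exists:
  assumes F: "F \<noteq> bot"
  shows "\<exists>F' z1 x1. F' \<le> F \<and> F' \<noteq> bot \<and> cluster z1 x1 F'"
proof -
  obtain B where B: "B \<ge> 0" "\<And>k i. i \<in> I \<Longrightarrow> norm (z k i) \<le> B" "\<And>k. norm (X (z k)) \<le> B" using iterates_bounded by blast
  define v where "v j k = (case j of None \<Rightarrow> X (z k) | Some i \<Rightarrow> if i \<in> I then z k i else 0)" for j k
  have bd: "norm (v j k) \<le> B" for j k using B by (simp add: v_def split: option.split)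
  obtain F' l where F': "F' \<le> F" "F' \<noteq> bot" "\<forall>j. wlim (v j) (l j) F'"
    using weak_compactness[of F v "\<lambda>_. B", OF F bd] by blast
  have "wlim (\<lambda>k. z k i) (l (Some i)) F'" if "i \<in> I" for i
    using F'(3)[rule_format, of "Some i"] that by (simp add: v_def[abs_def])
  moreover have "wlim (\<lambda>k. X (z k)) (l None) F'"
    using F'(3)[rule_format, of None] by (simp add: v_def[abs_def])
  ultimately have "cluster (\<lambda>i. l (Some i)) (l None) F'" by (simp add: cluster_def)
  then show ?thesis using F' by blast
qed

text \<open>Opial's argument: both squared distances converge, so \<open>Q (z k) (z1 - z2)\<close> has the same limit along
  both filters.\<close>

lemma cluster_unique:
  assumes F1: "F1 \<le> sequentially" "F1 \<noteq> bot" "cluster z1 x1 F1"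
    and F2: "F2 \<le> sequentially" "F2 \<noteq> bot" "cluster z2 x2 F2"
  shows "x1 = x2"
proof -
  note fx1 = cluster_fixed[OF F1] and fx2 = cluster_fixed[OF F2]
  let ?d = "\<lambda>i. z1 i - z2 i"
  obtain l1 l2 where "(\<lambda>k. nrm (\<lambda>i. z k i - z1 i)) \<longlonglongrightarrow> l1" "(\<lambda>k. nrm (\<lambda>i. z k i - z2 i)) \<longlonglongrightarrow> l2"
    using convergence_of_distances(1)[OF fx1] convergence_of_distances(1)[OF fx2] by (auto simp: convergent_def)
  then have lim: "(\<lambda>k. (nrm (\<lambda>i. z k i - z2 i))\<^sup>2 - (nrm (\<lambda>i. z k i - z1 i))\<^sup>2) \<longlonglongrightarrow> l2\<^sup>2 - l1\<^sup>2"
    by (intro tendsto_diff tendsto_power)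
  have eq: "(nrm (\<lambda>i. z k i - z2 i))\<^sup>2 - (nrm (\<lambda>i. z k i - z1 i))\<^sup>2 = 2 * Q (z k) ?d + (Q z2 z2 - Q z1 z1)" for k
    using Q_sym[of z1 "z k"] Q_sym[of z2 "z k"]
    by (simp only: nrm_power2 Q_diff_left Q_diff_right) simp
  define l where "l = l2\<^sup>2 - l1\<^sup>2"
  have l: "(\<lambda>k. 2 * Q (z k) ?d + (Q z2 z2 - Q z1 z1)) \<longlonglongrightarrow> l"
    using lim unfolding eq l_def .
  have Ql: "((\<lambda>k. Q (z k) ?d) \<longlongrightarrow> Q w ?d) F" if "cluster w y F" for w y F
    unfolding Q_def
  proof (intro tendsto_sum)
    fix i assume i: "i \<in> I"
    have "wlim (\<lambda>k. M i (z k i)) (M i (w i)) F"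
      using that i by (intro wlim_selfadjoint[OF M_sym[OF i]]) (simp add: cluster_def)
    then show "((\<lambda>k. M i (z k i) \<bullet> ?d i) \<longlongrightarrow> M i (w i) \<bullet> ?d i) F" by (simp add: wlim_def)
  qed
  have "2 * Q w ?d + (Q z2 z2 - Q z1 z1) = l" if "F \<le> sequentially" "F \<noteq> bot" "cluster w y F" for w y F
    by (rule tendsto_unique[OF that(2) tendsto_add[OF tendsto_mult[OF tendsto_const Ql[OF that(3)]] tendsto_const]
          tendsto_mono[OF that(1) l]])
  \<comment> \<open>The common limit gives equal pairings of \<open>z1\<close> and \<open>z2\<close>
    with their difference.\<close>
  from this[OF F1] this[OF F2] have "Q ?d ?d = 0" by (simp add: Q_diff_left[of z1 z2 ?d])
  then have n0: "nrm ?d = 0" by (simp flip: nrm_power2)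
  obtain K where K: "\<And>z. \<forall>i\<in>I. z i \<in> H i \<Longrightarrow> \<forall>i\<in>I. norm (z i) \<le> K * nrm z" using nrm_component by blast
  have "\<forall>i\<in>I. ?d i \<in> H i" using fx1 fx2 H unfolding fixed_def state_def by (auto intro: subspace_diff)
  from K[OF this] have "\<forall>i\<in>I. norm (?d i) \<le> 0" by (simp add: n0)
  then show ?thesis by (intro fixed_unique_x[OF fx1 fx2]) simp
qed

theorem weak_convergence: "\<exists>z0 x0. fixed z0 x0 \<and> wlim (\<lambda>k. X (z k)) x0 sequentially"
proof -
  obtain F1 z1 x1 where F1: "F1 \<le> sequentially" "F1 \<noteq> bot" "cluster z1 x1 F1"
    using cluster_exists[OF sequentially_bot] by blast
  have "wlim (\<lambda>k. X (z k)) x1 sequentially"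
    unfolding wlim_def
  proof (rule allI, rule ccontr)
    fix y assume "\<not> (\<lambda>k. X (z k) \<bullet> y) \<longlonglongrightarrow> x1 \<bullet> y"
    then obtain \<epsilon> where \<epsilon>: "\<epsilon> > 0" "\<not> (\<forall>\<^sub>F k in sequentially. dist (X (z k) \<bullet> y) (x1 \<bullet> y) < \<epsilon>)"
      by (auto simp: tendsto_iff)
    \<comment> \<open>The filter of indices at which closeness to the limit fails. A cluster point
      along it must still be \<open>x1\<close>, which is contradictory.\<close>
    define F where "F = inf sequentially (principal {k. \<not> dist (X (z k) \<bullet> y) (x1 \<bullet> y) < \<epsilon>})"
    have "F \<noteq> bot" using \<epsilon>(2) by (simp add: F_def trivial_limit_def eventually_inf_principal)
    then obtain F2 z2 x2 where F2: "F2 \<le> F" "F2 \<noteq> bot" "cluster z2 x2 F2" using cluster_exists by blast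
    have "F2 \<le> sequentially" using F2(1) by (simp add: F_def)
    then have "x1 = x2" by (rule cluster_unique[OF F1 _ F2(2,3)])
    then have "((\<lambda>k. X (z k) \<bullet> y) \<longlongrightarrow> x1 \<bullet> y) F2" using F2(3) by (simp add: cluster_def wlim_def)
    then have "\<forall>\<^sub>F k in F2. dist (X (z k) \<bullet> y) (x1 \<bullet> y) < \<epsilon>" using \<epsilon>(1) by (rule tendstoD)
    moreover have "\<forall>\<^sub>F k in F2. \<not> dist (X (z k) \<bullet> y) (x1 \<bullet> y) < \<epsilon>"
      by (rule filter_leD[OF F2(1)]) (simp add: F_def eventually_inf_principal)
    ultimately have "\<forall>\<^sub>F k in F2. False" by eventually_elim auto
    then show False using F2(2) by (simp add: trivial_limit_def)
  qed
  then show ?thesis using cluster_fixed[OF F1] by blast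
qed

end

context preconditioned_splitting
begin

lemma fixed_minimizer:
  assumes fx: "fixed z x"
  shows "(\<Sum>i\<in>I. g i x) + ereal (f x) + h x \<le> (\<Sum>i\<in>I. g i y) + ereal (f y) + h y"
proof -
  define u where "u i = subgr z x (\<lambda>i. P i x) i" for i
  define v where "v = subgr_h z x"
  have uH: "u i \<in> H i" if "i \<in> I" for i
    unfolding u_def subgr_def by (intro subspace_diff H that M_in W_in)
  have gi: "g i x + ereal (u i \<bullet> (y - x)) \<le> g i y" if i: "i \<in> I" for i
  proof -
    have "u i \<in> subdiff (g i) (P i x)" using fx i by (simp add: fixed_def state_def u_def)
    then have "g i (P i x) + ereal (u i \<bullet> (y - P i x)) \<le> g i y" by (simp add: subdiff_def)
    then show ?thesis by (simp add: g_proj[OF i] inner_diff_right in_H_inner_P[OF i uH[OF i]])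
  qed
  have hi: "h x + ereal (v \<bullet> (y - x)) \<le> h y" using fx by (simp add: fixed_def state_def v_def subdiff_def)
  have fi: "ereal (f x) + ereal (D x \<bullet> (y - x)) \<le> ereal (f y)"
    using gradient_in_subdiff[OF f D, of x] by (simp add: subdiff_def)
  have "((\<Sum>i\<in>I. u i) + v + D x) \<bullet> (y - x) = 0"
    using fixed_subgradients_sum[of z x] by (simp add: u_def v_def)
  then have zero: "(\<Sum>i\<in>I. u i \<bullet> (y - x)) + D x \<bullet> (y - x) + v \<bullet> (y - x) = 0"
    by (simp add: inner_add_left inner_sum_left)
  \<comment> \<open>The vanishing sum of pairings is added as a real and distributed over the
    functions, which avoids subtracting extended reals.\<close>
  have "(\<Sum>i\<in>I. g i x) + ereal (f x) + h x
      = (\<Sum>i\<in>I. g i x) + ereal (f x) + h x + ereal ((\<Sum>i\<in>I. u i \<bullet> (y - x)) + D x \<bullet> (y - x) + v \<bullet> (y - x))"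
    by (simp add: zero)
  also have "\<dots> = (\<Sum>i\<in>I. g i x + ereal (u i \<bullet> (y - x))) + (ereal (f x) + ereal (D x \<bullet> (y - x))) + (h x + ereal (v \<bullet> (y - x)))"
    unfolding sum.distrib sum_ereal plus_ereal.simps(1)[symmetric] by (simp only: ac_simps)
  also have "\<dots> \<le> (\<Sum>i\<in>I. g i y) + ereal (f y) + h y"
    by (intro add_mono sum_mono gi hi fi)
  finally show ?thesis .
qed

end

section \<open>From the stated hypotheses to the iteration\<close>

theorem corollary3p1:
  fixes L \<Gamma> :: "'a::{real_inner, complete_space} \<Rightarrow>\<^sub>L 'a"
    and W :: "nat \<Rightarrow> 'a \<Rightarrow>\<^sub>L 'a"
    and n :: nat
    and H :: "nat \<Rightarrow> 'a set"
    and f :: "'a \<Rightarrow> real"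
    and g :: "nat \<Rightarrow> 'a \<Rightarrow> ereal"
    and h :: "'a \<Rightarrow> ereal"
    and x b c :: "nat \<Rightarrow> 'a"
    and z a :: "nat \<Rightarrow> nat \<Rightarrow> 'a"
    and \<rho> :: "nat \<Rightarrow> real"
  defines "F \<equiv> \<lambda>y. (\<Sum>i=1..n. g i y) + ereal (f y) + h y"
    and "\<delta> \<equiv> 2 - 1/2 * norm (op_sqrt L o\<^sub>L \<Gamma> o\<^sub>L op_sqrt L)"
  assumes n: "n \<ge> 1"
    and L: "spos_op_on UNIV L"
    and f_convex: "convex_on UNIV f"
    and f_diff: "\<And>y. f differentiable (at y)"
    and f_grad: "\<And>y y'. norm_wrt L (inv (blinfun_apply L) (gradient f y)
                                    - inv (blinfun_apply L) (gradient f y'))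
                       \<le> norm_wrt L (y - y')"
    and H: "\<And>i. i \<in> {1..n} \<Longrightarrow> subspace (H i) \<and> closed (H i)"
    and g: "\<And>i. i \<in> {1..n} \<Longrightarrow> convex_fun (g i) \<and> proper_fun (g i) \<and> lsc_fun (g i)"
    and g_proj: "\<And>i. i \<in> {1..n} \<Longrightarrow> g i = g i \<circ> orth_proj (H i)"
    and h: "convex_fun h" "proper_fun h" "lsc_fun h"
    and sri_h: "0 \<in> sri (minkowski_diff (effdom h) (\<Inter>i\<in>{1..n}. effdom (g i)))"
    and sri_g: "\<And>i. i \<in> {1..n} \<Longrightarrow>
                  0 \<in> sri (minkowski_diff (effdom (g i)) (\<Inter>j\<in>{1..<i}. effdom (g j)))"
    and argmin: "argmin_set F \<noteq> {}"
    and \<Gamma>: "spos_op_on UNIV \<Gamma>"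
    and \<Gamma>_norm: "norm (op_sqrt L o\<^sub>L \<Gamma> o\<^sub>L op_sqrt L) < 2"
    and \<Gamma>_H: "\<And>i. i \<in> {1..n} \<Longrightarrow> blinfun_apply \<Gamma> ` H i \<subseteq> H i"
    and W: "\<And>i. i \<in> {1..n} \<Longrightarrow> pos_op_on UNIV (W i)"
    and W_ker: "\<And>i. i \<in> {1..n} \<Longrightarrow> {v. W i v = 0} = (H i)\<^sup>\<bottom>"
    and W_H: "\<And>i. i \<in> {1..n} \<Longrightarrow> spos_op_on (H i) (W i)"
    and W_\<Gamma>: "\<And>i. i \<in> {1..n} \<Longrightarrow>
                 inv (blinfun_apply \<Gamma>) \<circ> blinfun_apply (W i)
                   = blinfun_apply (W i) \<circ> inv (blinfun_apply \<Gamma>)"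
    and W_sum: "(\<Sum>i=1..n. W i) = id_blinfun"
    and z0: "\<And>i. i \<in> {1..n} \<Longrightarrow> z i 0 \<in> H i"
    and a_H: "\<And>i k. i \<in> {1..n} \<Longrightarrow> a i k \<in> H i"
    and \<rho>: "\<And>k. \<rho> k \<in> {0<..<\<delta>}"
    and x_def: "\<And>k. x k = prox_on UNIV (inv (blinfun_apply \<Gamma>)) h (\<Sum>i=1..n. W i (z i k)) + c k"
    and z_step: "\<And>i k. i \<in> {1..n} \<Longrightarrow>
           z i (Suc k) = z i k + \<rho> k *\<^sub>R
             (prox_on (H i) (inv (blinfun_apply \<Gamma>) \<circ> blinfun_apply (W i)) (g i)
                (2 *\<^sub>R orth_proj (H i) (x k) - z i k
                   - \<Gamma> (orth_proj (H i) (gradient f (x k) + b k)))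
              + a i k - orth_proj (H i) (x k))"
    and \<rho>_sum: "filterlim (\<lambda>N. \<Sum>k<N. \<rho> k * (\<delta> - \<rho> k)) at_top sequentially"
    and b_sum: "summable (\<lambda>k. \<rho> k * norm (b k))"
    and c_sum: "summable (\<lambda>k. \<rho> k * norm (c k))"
    and c_lim: "c \<longlonglongrightarrow> 0"
    and a_sum: "\<And>i. i \<in> {1..n} \<Longrightarrow> summable (\<lambda>k. \<rho> k * norm (a i k))"
  shows "(\<exists>y\<in>argmin_set F. weakly_converges x y) \<and>
         (\<forall>i\<in>{1..n}. uniformly_convex_fun (g i) \<longrightarrow> convergent (\<lambda>k. orth_proj (H i) (x k))) \<and>
         (uniformly_convex_fun (\<lambda>y. ereal (f y)) \<or> uniformly_convex_fun h \<longrightarrow> convergent x)"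
proof -
  obtain G :: "'a \<Rightarrow>\<^sub>L 'a" where G: "inv (blinfun_apply \<Gamma>) = blinfun_apply G"
    "\<And>x. G (\<Gamma> x) = x" "\<And>x. \<Gamma> (G x) = x" "spos_op_on UNIV G"
    using spos_op_inverse[OF \<Gamma>] by blast
  obtain Li :: "'a \<Rightarrow>\<^sub>L 'a" where Li: "inv (blinfun_apply L) = blinfun_apply Li"
    "\<And>x. Li (L x) = x" "\<And>x. L (Li x) = x" "spos_op_on UNIV Li"
    using spos_op_inverse[OF L] by blast
  define \<kappa> where "\<kappa> = norm (op_sqrt L o\<^sub>L \<Gamma> o\<^sub>L op_sqrt L)"
  have \<delta>: "\<delta> = 2 - \<kappa>/2" by (simp add: \<delta>_def \<kappa>_def)
  have D: "GDERIV f y :> gradient f y" for y by (rule gradient_eq[OF f_diff])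
  have Lpos: "pos_op_on UNIV L" using L by (simp add: spos_op_on_def)
  have BH: "Li (gradient f x - gradient f y) \<bullet> (gradient f x - gradient f y) \<le> (gradient f x - gradient f y) \<bullet> (x - y)" for x y
    by (rule Baillon_Haddad[OF f_convex D Lpos Li(3) f_grad[unfolded Li(1)]])
  have coco: "\<Gamma> (gradient f x - gradient f y) \<bullet> (gradient f x - gradient f y)
      \<le> \<kappa> * ((gradient f x - gradient f y) \<bullet> (x - y))" for x y
    unfolding \<kappa>_def by (rule order_trans[OF quadratic_form_bound[OF L Li(2,3)] mult_left_mono[OF BH norm_ge_zero]])
  obtain m where m: "m > 0" "\<And>v. m * (norm v)\<^sup>2 \<le> Li v \<bullet> v" using Li(4) by (auto simp: spos_op_on_def)
  have lip: "norm (gradient f x - gradient f y) \<le> 1/m * norm (x - y)" for x y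
  proof -
    let ?d = "gradient f x - gradient f y"
    have "m * norm ?d * norm ?d \<le> norm (x - y) * norm ?d"
      using order_trans[OF m(2) BH[of x y]] norm_cauchy_schwarz[of ?d "x - y"] by (simp add: power2_eq_square ac_simps)
    then have "m * norm ?d \<le> norm (x - y)"
      by (cases "?d = 0") (auto dest: mult_right_le_imp_le)
    then show ?thesis using m(1) by (simp add: field_simps)
  qed
  have GW: "G (W i v) = W i (G v)" if "i \<in> {1..n}" for i v
    using fun_cong[OF W_\<Gamma>[OF that], of v] by (simp add: G(1))
  have Wsum: "(\<Sum>i\<in>{1..n}. W i v) = v" for v
    using W_sum by (metis blinfun.sum_left blinfun_apply_id_blinfun id_apply)
  interpret sp: preconditioned_splitting "{1..n}" H W \<Gamma> G g h f "gradient f" \<kappa> "1/m"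
  proof unfold_locales
    show "g i (orth_proj (H i) y) = g i y" if "i \<in> {1..n}" for i y
      using fun_cong[OF g_proj[OF that], of y] by simp
    show "\<Gamma> v \<in> H i" if "i \<in> {1..n}" "v \<in> H i" for i v
      using \<Gamma>_H[OF that(1)] that(2) by blast
  qed (use H G \<Gamma> W W_H W_ker Wsum GW g h f_convex D coco lip m(1) \<Gamma>_norm in \<open>auto simp: \<kappa>_def\<close>)
  define s where "s y = (\<Sum>i=1..n. g i y)" for y
  have ninf: "s y \<noteq> -\<infinity>" "h y \<noteq> -\<infinity>" for y
    using sp.g_ninf h(2) by (auto simp: s_def proper_fun_def intro!: sum_ereal_not_MInf)
  have doms: "effdom s = (\<Inter>i\<in>{1..n}. effdom (g i))"
    by (auto simp: s_def effdom_def sum_Pinfty less_top[symmetric] top_ereal_def)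
  have s_conv: "convex_fun s" "lsc_fun s" using convex_lsc_sum[of "{1..n}" g] g by (simp_all add: s_def[abs_def])
  obtain xs where xs: "\<And>y. F xs \<le> F y"
    using argmin by (auto simp: argmin_set_def is_arg_min_linorder)
  \<comment> \<open>That 0 is a difference of domain points means a common domain point, so the
    minimum is finite.\<close>
  obtain y0 where y0: "h y0 < \<infinity>" "s y0 < \<infinity>"
  proof -
    obtain d d' where "d \<in> effdom h" "d' \<in> effdom s" "0 = d - d'"
      using sri_h unfolding sri_def minkowski_diff_def doms by blast
    then show ?thesis using that[of d] by (simp add: effdom_def)
  qed
  have F: "F y = ereal (f y) + (s y + h y)" for y unfolding F_def s_def by (simp only: ac_simps)
  have "F y0 < \<infinity>" using y0 unfolding F by simp
  then have "F xs < \<infinity>" by (rule le_less_trans[OF xs])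
  then have fin: "\<bar>s xs + h xs\<bar> \<noteq> \<infinity>" "s xs < \<infinity>" using ninf[of xs] unfolding F by (cases "s xs"; cases "h xs"; simp)+
  then have sp_s: "proper_fun s" using ninf(1) by (auto simp: proper_fun_def effdom_def)
  have "s xs + h xs + ereal (- (gradient f xs \<bullet> (y - xs))) \<le> s y + h y" for y
    by (rule convex_smooth_minimizer[OF convex_fun_add[OF s_conv(1) h(1) ninf] fin(1) _ GDERIV_quotient_right[OF D]])
      (use xs in \<open>simp add: F\<close>)
  then have "- gradient f xs \<in> subdiff (\<lambda>y. s y + h y) xs" using fin(1) by (simp add: subdiff_def)
  \<comment> \<open>The condition on \<open>h\<close> separates \<open>h\<close> from the sum of the
    \<open>g i\<close>; the conditions on the \<open>g i\<close> then split that sum.\<close>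
  then obtain q where q: "- gradient f xs - q \<in> subdiff s xs" "q \<in> subdiff h xs"
    using Attouch_Brezis[OF s_conv(1) sp_s s_conv(2) h, of "- gradient f xs" xs] sri_h unfolding doms by blast
  obtain u where u: "\<forall>i\<in>{1..n}. u i \<in> subdiff (g i) xs" "- gradient f xs - q = (\<Sum>i=1..n. u i)"
    using subdiff_sum_split[OF g sri_g q(1)[unfolded s_def[abs_def]]] by blast
  have "(\<Sum>i=1..n. u i) + q + gradient f xs = 0" using u(2)[symmetric] by simp
  then have fixed_ex: "\<exists>z x. sp.fixed z x" using sp.fixed_exists[OF bspec[OF u(1)] q(2)] by blast
  have M: "sp.M i = inv (blinfun_apply \<Gamma>) \<circ> blinfun_apply (W i)" for i
    by (simp add: sp.M_def G(1) fun_eq_iff)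
  have xk: "x k = sp.X (\<lambda>i. z i k) + c k" for k unfolding sp.X_def using x_def[of k] by (simp only: G(1))
  interpret it: splitting_iteration "{1..n}" H W \<Gamma> G g h f "gradient f" \<kappa> "1/m" "\<lambda>k i. z i k" "\<lambda>k i. a i k" b c \<rho>
  proof unfold_locales
    fix i k assume "i \<in> {1..n}"
    from z_step[OF this, of k] show "z i (Suc k) = z i k + \<rho> k *\<^sub>R
        (sp.T i (2 *\<^sub>R orth_proj (H i) (sp.X (\<lambda>i. z i k) + c k) - z i k -
          \<Gamma> (orth_proj (H i) (gradient f (sp.X (\<lambda>i. z i k) + c k) + b k))) + a i k -
          orth_proj (H i) (sp.X (\<lambda>i. z i k) + c k))"
      unfolding sp.T_def M xk .
  qed (use z0 a_H \<rho> \<rho>_sum b_sum c_sum a_sum fixed_ex in \<open>auto simp: \<delta>\<close>)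
  define X where "X k = sp.X (\<lambda>i. z i k)" for k
  obtain z\<^sub>0 x\<^sub>0 where fx: "sp.fixed z\<^sub>0 x\<^sub>0" and wl: "wlim X x\<^sub>0 sequentially"
    using it.weak_convergence unfolding X_def[abs_def] by blast
  have x_eq: "x = (\<lambda>k. X k + c k)" by (simp add: xk X_def fun_eq_iff)
  \<comment> \<open>The iteration controls \<open>X\<close>; passing to \<open>x\<close> uses
    \<open>c_lim\<close>, assumed besides \<open>c_sum\<close>. Summability of
    \<open>\<rho> k * norm (c k)\<close> does not force \<open>c\<close> to 0 when
    \<open>\<rho>\<close> comes arbitrarily close to 0.\<close>
  have "wlim x (x\<^sub>0 + 0) sequentially" unfolding x_eq by (intro wlim_add wl wlim_strong c_lim)
  then have weak: "weakly_converges x x\<^sub>0" by (simp add: wlim_def weakly_converges_def)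
  have "F x\<^sub>0 \<le> F y" for y using sp.fixed_minimizer[OF fx, of y] by (simp add: F_def)
  then have min: "x\<^sub>0 \<in> argmin_set F" by (auto simp: argmin_set_def is_arg_min_linorder)
  note s0 = fx[unfolded sp.fixed_def sp.state_def] and sk = it.state_k[unfolded sp.state_def, folded X_def]
  note gaps = it.gaps_tendsto_0[OF fx, folded X_def]
  have conv_g: "convergent (\<lambda>k. orth_proj (H i) (x k))" if i: "i \<in> {1..n}" and uc: "uniformly_convex_fun (g i)" for i
  proof -
    note Hi = sp.H[OF i]
    have "(\<lambda>k. sp.p (\<lambda>i. z i k) i) \<longlonglongrightarrow> orth_proj (H i) x\<^sub>0"
      by (rule uniformly_convex_strong_convergence[OF uc _ _ gaps(1)[OF i]])
        (use s0 sk i in blast)+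
    \<comment> \<open>Uniform convexity gives the limit of the proximal points of
      \<open>g i\<close>; removing the residual and adding the projected error recovers the
      projection of \<open>x k\<close>.\<close>
    then have "(\<lambda>k. sp.p (\<lambda>i. z i k) i - it.e k i + orth_proj (H i) (c k)) \<longlonglongrightarrow> orth_proj (H i) x\<^sub>0 - 0 + orth_proj (H i) 0"
      by (intro tendsto_add tendsto_diff it.e_tendsto i bounded_linear.tendsto[OF bounded_linear_orth_proj[OF Hi]] c_lim)
    moreover have "sp.p (\<lambda>i. z i k) i - it.e k i + orth_proj (H i) (c k) = orth_proj (H i) (x k)" for k
      unfolding it.e_def sp.res_def xk orth_proj_add[OF Hi] by (simp only: diff_diff_eq2 add_diff_cancel_left')
    ultimately show ?thesis by (auto simp: convergent_def)
  qed
  have conv: "convergent x" if "uniformly_convex_fun (\<lambda>y. ereal (f y)) \<or> uniformly_convex_fun h"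
  proof -
    have "X \<longlonglongrightarrow> x\<^sub>0" using that
    proof
      assume "uniformly_convex_fun (\<lambda>y. ereal (f y))"
      then show ?thesis
        by (rule uniformly_convex_strong_convergence[OF _ _ _ gaps(3)]) (rule gradient_in_subdiff[OF f_convex D])+
    next
      assume "uniformly_convex_fun h"
      then show ?thesis
        by (rule uniformly_convex_strong_convergence[OF _ _ _ gaps(2)])
          (use s0 sk in blast)+
    qed
    then have "x \<longlonglongrightarrow> x\<^sub>0 + 0" unfolding x_eq by (intro tendsto_add c_lim)
    then show ?thesis by (auto simp: convergent_def)
  qed
  show ?thesis using min weak conv_g conv by blast
qed

end
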